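(* Let $(M,\langle\cdot,\cdot\rangle)$ be an $n$-dimensional pseudo-Riemannian Einstein manifold and suppose there exists a constant $c$ such that $$\mathcal{R}^{2)}_\gamma=c\,\langle\dot\gamma,\dot\gamma\rangle\,\mathcal{R}^{0)}_\gamma$$ for all geodesics $\gamma$ of $M$. Then the curvature tensor $R$ of $M$ satisfies $$\nabla^*\nabla R=-\frac{(n+4)\,c}{2}\,R .$$ In particular, the constant $c$ is negative on a compact Riemannian manifold.
   Context: $\nabla$ is the Levi-Civita connection and $R$ the $(0,4)$ curvature tensor of $M$. Einstein means $\mathrm{ric}=\lambda\langle\cdot,\cdot\rangle$ with $\lambda\in\mathbb{R}$ constant, where $\mathrm{ric}$ is the Ricci tensor. For a geodesic $\gamma$, $\mathcal{R}^{0)}_\gamma(x,y)=R(x,\dot\gamma,\dot\gamma,y)$ is the Jacobi operator along $\gamma$, and $\mathcal{R}^{2)}_\gamma(x,y)=\frac{\nabla^2}{dt^2}\mathcal{R}^{0)}_\gamma(x,y)=\nabla^{2)}_{\dot\gamma,\dot\gamma}R(x,\dot\gamma,\dot\gamma,y)$ is its second covariant derivative along $\gamma$, where $\nabla^{2)}R$ is the second covariant derivative of $R$. The rough Laplacian is $\nabla^*\nabla R=-\sum_i\epsilon_i\nabla^{2)}_{e_i,e_i}R$ for a local orthonormal frame $\{e_i\}$ with $\epsilon_i=\langle e_i,e_i\rangle=\pm1$ (all $\epsilon_i=1$ in the Riemannian case).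
   Formalization: The final claim fails on round spheres (c = 0) and flat tori (any c), so it is corrected: on a compact Riemannian manifold c is negative if the manifold is not locally symmetric, and c ≤ 0 if it is not flat. *)

theory Defs
  imports "HOL-Analysis.Analysis"
begin

section \<open>Smooth manifolds\<close>

definition pd :: "'n::finite \<Rightarrow> (real^'n \<Rightarrow> 'b::real_normed_vector) \<Rightarrow> real^'n \<Rightarrow> 'b" where
  "pd i f x = frechet_derivative f (at x) (axis i 1)"

primrec Ck_on :: "nat \<Rightarrow> (real^'n::finite \<Rightarrow> 'b::real_normed_vector) \<Rightarrow> (real^'n) set \<Rightarrow> bool" where
  "Ck_on 0 f S \<longleftrightarrow> continuous_on S f"
| "Ck_on (Suc k) f S \<longleftrightarrow> (\<forall>x\<in>S. f differentiable (at x)) \<and> (\<forall>i. Ck_on k (pd i f) S)"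

definition smooth_on :: "(real^'n::finite \<Rightarrow> 'b::real_normed_vector) \<Rightarrow> (real^'n) set \<Rightarrow> bool" where
  "smooth_on f S \<longleftrightarrow> (\<forall>k. Ck_on k f S)"

text \<open>A chart is a pair of a domain and a coordinate map; the values of the map outside
  the domain are irrelevant.\<close>

type_synonym ('m, 'n) chart = "'m set \<times> ('m \<Rightarrow> real^'n)"

abbreviation dom_of :: "('m, 'n::finite) chart \<Rightarrow> 'm set" where
  "dom_of C \<equiv> fst C"

abbreviation coord :: "('m, 'n::finite) chart \<Rightarrow> 'm \<Rightarrow> real^'n" where
  "coord C \<equiv> snd C"

definition chart_inv :: "('m, 'n::finite) chart \<Rightarrow> real^'n \<Rightarrow> 'm" where
  "chart_inv C = inv_into (dom_of C) (coord C)"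

definition chart_image :: "('m, 'n::finite) chart \<Rightarrow> (real^'n) set" where
  "chart_image C = coord C ` dom_of C"

definition transition :: "('m, 'n::finite) chart \<Rightarrow> ('m, 'n) chart \<Rightarrow> real^'n \<Rightarrow> real^'n" where
  "transition C D = coord D \<circ> chart_inv C"

definition points :: "('m, 'n::finite) chart set \<Rightarrow> 'm set" where
  "points \<A> = \<Union> (dom_of ` \<A>)"

text \<open>The manifold is the set \<open>points \<A>\<close> (an open subset of the underlying topological space,
  hence itself Hausdorff and second countable); its dimension is \<open>CARD('n)\<close>.\<close>

locale smooth_manifold =
  fixes \<A> :: "('m::{t2_space, second_countable_topology}, 'n::finite) chart set"
  assumes chart: "C \<in> \<A> \<Longrightarrow> open (dom_of C) \<and> open (chart_image C) \<and>
      homeomorphism (dom_of C) (chart_image C) (coord C) (chart_inv C)"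
    and compatible: "C \<in> \<A> \<Longrightarrow> D \<in> \<A> \<Longrightarrow>
      smooth_on (transition C D) (coord C ` (dom_of C \<inter> dom_of D))"


section \<open>Metrics\<close>

text \<open>A tensor field is given by its components in each chart, viewed as functions of the
  coordinates; \<open>g C x $ i $ j\<close> is the value of the metric on the coordinate fields \<open>i, j\<close> of
  the chart \<open>C\<close> at the point with coordinates \<open>x\<close>. The signature is arbitrary.\<close>

locale pseudo_riemannian_manifold = smooth_manifold \<A>
  for \<A> :: "('m::{t2_space, second_countable_topology}, 'n::finite) chart set" +
  fixes g :: "('m, 'n) chart \<Rightarrow> real^'n \<Rightarrow> real^'n^'n"
  assumes metric_smooth: "C \<in> \<A> \<Longrightarrow> smooth_on (g C) (chart_image C)"
    and metric_symmetric: "C \<in> \<A> \<Longrightarrow> x \<in> chart_image C \<Longrightarrow> transpose (g C x) = g C x"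
    and metric_nondegenerate: "C \<in> \<A> \<Longrightarrow> x \<in> chart_image C \<Longrightarrow> invertible (g C x)"
    and metric_transforms: "C \<in> \<A> \<Longrightarrow> D \<in> \<A> \<Longrightarrow> x \<in> coord C ` (dom_of C \<inter> dom_of D) \<Longrightarrow>
      g C x = transpose (jacobian (transition C D) (at x)) ** g D (transition C D x)
                ** jacobian (transition C D) (at x)"

definition gprod :: "(real^'n::finite \<Rightarrow> real^'n^'n) \<Rightarrow> real^'n \<Rightarrow> real^'n \<Rightarrow> real^'n \<Rightarrow> real" where
  "gprod G x u v = u \<bullet> (G x *v v)"

definition riemannian :: "('m, 'n::finite) chart set \<Rightarrow> (('m, 'n) chart \<Rightarrow> real^'n \<Rightarrow> real^'n^'n) \<Rightarrow> bool"
  where "riemannian \<A> g \<longleftrightarrow> (\<forall>C\<in>\<A>. \<forall>x\<in>chart_image C. \<forall>v. v \<noteq> 0 \<longrightarrow> 0 < gprod (g C) x v v)"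


section \<open>Levi-Civita connection and curvature in a chart\<close>

text \<open>Below, \<open>G\<close> is the matrix of the metric in a fixed chart. \<open>christoffel G x l i j\<close> is the
  \<open>l\<close>-th component of the Levi-Civita derivative of the coordinate field \<open>j\<close> in direction
  \<open>i\<close>.\<close>

definition christoffel ::
    "(real^'n::finite \<Rightarrow> real^'n^'n) \<Rightarrow> real^'n \<Rightarrow> 'n \<Rightarrow> 'n \<Rightarrow> 'n \<Rightarrow> real" where
  "christoffel G x l i j = (1/2) * (\<Sum>k\<in>UNIV. matrix_inv (G x) $ l $ k *
     (pd i (\<lambda>y. G y $ k $ j) x + pd j (\<lambda>y. G y $ k $ i) x - pd k (\<lambda>y. G y $ i $ j) x))"

text \<open>The sign convention is \<open>R(X,Y)Z = \<nabla>\<^sub>X \<nabla>\<^sub>Y Z - \<nabla>\<^sub>Y \<nabla>\<^sub>X Z - \<nabla>\<^bsub>[X,Y]\<^esub> Z\<close>, and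
  \<open>curvature_op G x l i j k\<close> is the \<open>l\<close>-th component of \<open>R(\<partial>\<^sub>i,\<partial>\<^sub>j)\<partial>\<^sub>k\<close>. The (0,4) tensor is
  \<open>R(X,Y,Z,W) = \<langle>R(X,Y)Z, W\<rangle>\<close>, and \<open>ric(Y,Z)\<close> is the trace of \<open>X \<mapsto> R(X,Y)Z\<close>.\<close>

definition curvature_op ::
    "(real^'n::finite \<Rightarrow> real^'n^'n) \<Rightarrow> real^'n \<Rightarrow> 'n \<Rightarrow> 'n \<Rightarrow> 'n \<Rightarrow> 'n \<Rightarrow> real" where
  "curvature_op G x l i j k =
     pd i (\<lambda>y. christoffel G y l j k) x - pd j (\<lambda>y. christoffel G y l i k) x
     + (\<Sum>m\<in>UNIV. christoffel G x m j k * christoffel G x l i m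
                 - christoffel G x m i k * christoffel G x l j m)"

definition ricci :: "(real^'n::finite \<Rightarrow> real^'n^'n) \<Rightarrow> real^'n \<Rightarrow> 'n \<Rightarrow> 'n \<Rightarrow> real" where
  "ricci G x j k = (\<Sum>i\<in>UNIV. curvature_op G x i i j k)"

text \<open>A covariant tensor field of degree \<open>d\<close> in a chart is represented by its components, a
  function of the point and of the list (of length \<open>d\<close>) of its indices.\<close>

type_synonym 'n tensor_field = "real^'n \<Rightarrow> 'n list \<Rightarrow> real"

definition curvature :: "(real^'n::finite \<Rightarrow> real^'n^'n) \<Rightarrow> 'n tensor_field" where
  "curvature G x is = (\<Sum>m\<in>UNIV. curvature_op G x m (is!0) (is!1) (is!2) * G x $ m $ (is!3))"

text \<open>The derivative direction is the first index of \<open>nabla G T\<close>. In particular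
  \<open>nabla G (nabla G T) x (a # b # is)\<close> are the components of the second covariant derivative
  \<open>\<nabla>\<^sup>2\<^bsub>a,b\<^esub> T\<close>, where \<open>\<nabla>\<^sup>2\<^bsub>X,Y\<^esub> = \<nabla>\<^sub>X \<nabla>\<^sub>Y - \<nabla>\<^bsub>\<nabla>\<^sub>X Y\<^esub>\<close>.\<close>

fun nabla :: "(real^'n::finite \<Rightarrow> real^'n^'n) \<Rightarrow> 'n tensor_field \<Rightarrow> 'n tensor_field" where
  "nabla G T x [] = 0"
| "nabla G T x (a # is) = pd a (\<lambda>y. T y is) x
     - (\<Sum>p<length is. \<Sum>m\<in>UNIV. christoffel G x m a (is!p) * T x (is[p := m]))"

text \<open>Orthonormal bases of the tangent space at one point. As the rough Laplacian is tensorial,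
  only the value of the frame at the point matters.\<close>

definition orthonormal_frame ::
    "(real^'n::finite \<Rightarrow> real^'n^'n) \<Rightarrow> real^'n \<Rightarrow> ('n \<Rightarrow> real^'n) \<Rightarrow> bool" where
  "orthonormal_frame G x e \<longleftrightarrow>
     (\<forall>i. gprod G x (e i) (e i) \<in> {1, -1}) \<and> (\<forall>i j. i \<noteq> j \<longrightarrow> gprod G x (e i) (e j) = 0)"

definition rough_laplacian ::
    "(real^'n::finite \<Rightarrow> real^'n^'n) \<Rightarrow> ('n \<Rightarrow> real^'n) \<Rightarrow> 'n tensor_field \<Rightarrow> 'n tensor_field" where
  "rough_laplacian G e T x is =
     - (\<Sum>i\<in>UNIV. gprod G x (e i) (e i) *
          (\<Sum>a\<in>UNIV. \<Sum>b\<in>UNIV. e i $ a * e i $ b * nabla G (nabla G T) x (a # b # is)))"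


section \<open>Curves\<close>

text \<open>Now \<open>\<xi>\<close> is the coordinate expression of a curve in the chart, \<open>Y\<close> are the components of a
  vector field along it, and \<open>A\<close> those of a (0,2) tensor field along it.\<close>

definition velocity :: "(real \<Rightarrow> real^'n::finite) \<Rightarrow> real \<Rightarrow> real^'n" where
  "velocity \<xi> t = vector_derivative \<xi> (at t)"

definition covd_vector :: "(real^'n::finite \<Rightarrow> real^'n^'n) \<Rightarrow> (real \<Rightarrow> real^'n) \<Rightarrow>
    (real \<Rightarrow> real^'n) \<Rightarrow> real \<Rightarrow> real^'n" where
  "covd_vector G \<xi> Y t = vector_derivative Y (at t) +
     (\<chi> l. \<Sum>i\<in>UNIV. \<Sum>j\<in>UNIV. christoffel G (\<xi> t) l i j * velocity \<xi> t $ i * Y t $ j)"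

definition covd_tensor :: "(real^'n::finite \<Rightarrow> real^'n^'n) \<Rightarrow> (real \<Rightarrow> real^'n) \<Rightarrow>
    (real \<Rightarrow> 'n \<Rightarrow> 'n \<Rightarrow> real) \<Rightarrow> real \<Rightarrow> 'n \<Rightarrow> 'n \<Rightarrow> real" where
  "covd_tensor G \<xi> A t i j = vector_derivative (\<lambda>s. A s i j) (at t) -
     (\<Sum>a\<in>UNIV. \<Sum>m\<in>UNIV. velocity \<xi> t $ a *
        (christoffel G (\<xi> t) m a i * A t m j + christoffel G (\<xi> t) m a j * A t i m))"

definition jacobi_op :: "(real^'n::finite \<Rightarrow> real^'n^'n) \<Rightarrow> (real \<Rightarrow> real^'n) \<Rightarrow>
    real \<Rightarrow> 'n \<Rightarrow> 'n \<Rightarrow> real" where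
  "jacobi_op G \<xi> t i j = (\<Sum>a\<in>UNIV. \<Sum>b\<in>UNIV.
     curvature G (\<xi> t) [i, a, b, j] * velocity \<xi> t $ a * velocity \<xi> t $ b)"

definition jacobi_op2 :: "(real^'n::finite \<Rightarrow> real^'n^'n) \<Rightarrow> (real \<Rightarrow> real^'n) \<Rightarrow>
    real \<Rightarrow> 'n \<Rightarrow> 'n \<Rightarrow> real" where
  "jacobi_op2 G \<xi> = covd_tensor G \<xi> (covd_tensor G \<xi> (jacobi_op G \<xi>))"

text \<open>Geodesics are defined on open intervals. Twice differentiable solutions of the geodesic
  equation are automatically smooth.\<close>

definition geodesic :: "('m::topological_space, 'n::finite) chart set \<Rightarrow>
    (('m, 'n) chart \<Rightarrow> real^'n \<Rightarrow> real^'n^'n) \<Rightarrow> real set \<Rightarrow> (real \<Rightarrow> 'm) \<Rightarrow> bool" where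
  "geodesic \<A> g I \<gamma> \<longleftrightarrow> open I \<and> is_interval I \<and> continuous_on I \<gamma> \<and> \<gamma> ` I \<subseteq> points \<A> \<and>
     (\<forall>C\<in>\<A>. \<forall>t\<in>I. \<gamma> t \<in> dom_of C \<longrightarrow>
        (coord C \<circ> \<gamma>) differentiable (at t) \<and>
        velocity (coord C \<circ> \<gamma>) differentiable (at t) \<and>
        covd_vector (g C) (coord C \<circ> \<gamma>) (velocity (coord C \<circ> \<gamma>)) t = 0)"


section \<open>Conditions on the curvature\<close>

definition einstein :: "('m, 'n::finite) chart set \<Rightarrow>
    (('m, 'n) chart \<Rightarrow> real^'n \<Rightarrow> real^'n^'n) \<Rightarrow> bool" where
  "einstein \<A> g \<longleftrightarrow> (\<exists>r::real. \<forall>C\<in>\<A>. \<forall>x\<in>chart_image C. \<forall>i j.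
     ricci (g C) x i j = r * g C x $ i $ j)"

definition flat :: "('m, 'n::finite) chart set \<Rightarrow>
    (('m, 'n) chart \<Rightarrow> real^'n \<Rightarrow> real^'n^'n) \<Rightarrow> bool" where
  "flat \<A> g \<longleftrightarrow> (\<forall>C\<in>\<A>. \<forall>x\<in>chart_image C. \<forall>is. length is = 4 \<longrightarrow> curvature (g C) x is = 0)"

definition locally_symmetric :: "('m, 'n::finite) chart set \<Rightarrow>
    (('m, 'n) chart \<Rightarrow> real^'n \<Rightarrow> real^'n^'n) \<Rightarrow> bool" where
  "locally_symmetric \<A> g \<longleftrightarrow> (\<forall>C\<in>\<A>. \<forall>x\<in>chart_image C. \<forall>is. length is = 5 \<longrightarrow>
     nabla (g C) (curvature (g C)) x is = 0)"

end

theory Submission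
  imports Defs
begin

text \<open>
  Along a geodesic \<open>\<gamma>\<close> the iterated covariant derivative of the Jacobi operator is the contraction of
  \<open>\<nabla>\<nabla>R\<close> with four copies of \<open>\<gamma>'\<close> (\<open>jacobi_op2_eq\<close>). As a geodesic starts in every direction
  (\<open>geodesic_exists\<close>, \<open>geodesic_through\<close>), the hypothesis therefore amounts to the identity
  \<open>\<nabla>\<nabla>R(v,v,x,v,v,y) = c \<langle>v,v\<rangle> R(x,v,v,y)\<close> for all tangent vectors (\<open>J2_eq\<close>), and the first
  assertion becomes linear algebra at one point (\<open>laplacian_of_quartic\<close>). One polarizes this quartic
  in \<open>v\<close> and takes metric traces. On an Einstein manifold the traces of \<open>\<nabla>\<nabla>R\<close> over an index pair of
  \<open>R\<close>, and of the inner derivative index with an index of \<open>R\<close>, vanish. The traces that remain are the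
  Laplacian \<open>L = tr \<nabla>\<nabla>R\<close> and \<open>E(a;i,c,d)\<close>, the trace of the outer derivative index with an index of
  \<open>R\<close>. Tracing all slots shows that \<open>c\<close> times the Einstein constant is \<open>0\<close>, so that Ricci terms drop
  out below. Tracing one slot \<open>v\<close> against \<open>x\<close> gives, with both Bianchi identities,
  \<open>E(x;u,u,y) = L(x,u,u,y) / 2\<close>; tracing two slots \<open>v\<close> gives
  \<open>3 L(x,u,u,y) - E(x;u,u,y) - E(y;u,u,x) = (n + 4) c R(x,u,u,y)\<close>. Hence \<open>2 L = (n + 4) c R\<close> on all
  arguments \<open>(x,u,u,y)\<close>, and these determine an algebraic curvature tensor.

  For the assertion about compact manifolds the usual integration of \<open>\<langle>\<nabla>\<^sup>*\<nabla>R, R\<rangle>\<close> is replaced by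
  a maximum principle on the unit tangent bundle. Put \<open>F(v) = |R\<^sub>v|\<^sup>2\<close> and \<open>\<Psi>(v) = |\<nabla>\<^sub>vR\<^sub>v|\<^sup>2\<close>
  for the Jacobi operator \<open>R\<^sub>v = R(-,v,v,-)\<close>. Along a unit speed geodesic the hypothesis gives
  \<open>F'' = 2 (\<Psi> + c F)\<close> and \<open>\<Psi>' = c F'\<close>, so that \<open>\<Theta> = \<Psi> + (\<epsilon> - c) F\<close> has the second derivative
  \<open>2 \<epsilon> (\<Psi> + c F)\<close>. If \<open>c \<ge> 0\<close>, this is nonnegative, whence \<open>\<Psi> = c F = 0\<close> where \<open>\<Theta>\<close> is maximal
  (\<open>max_principle\<close>). For \<open>c > 0\<close> and \<open>\<epsilon> = c + 1\<close> the maximum is \<open>0\<close>, which forces \<open>R = 0\<close>; for \<open>c = 0\<close>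
  one obtains \<open>\<Psi> \<le> \<epsilon> max F\<close> for every \<open>\<epsilon> > 0\<close>, hence \<open>\<nabla>\<^sub>vR\<^sub>v = 0\<close> for all \<open>v\<close> and so \<open>\<nabla>R = 0\<close>.

  Two things support this. In one chart, the connection, the curvature and their symmetries are computed
  in components (locale \<open>metric_on\<close>). Between charts, the transformation law of the Christoffel symbols
  shows that geodesics are independent of the chart and that \<open>F\<close> is a function on the tangent bundle
  (locale \<open>chart_change\<close>).
\<close>

section \<open>Calculus with partial derivatives\<close>

text \<open>Tensor indices range over a finite type, and index sums over all of it; \<open>\<Sigma> i j. t\<close> is the double
  sum.\<close>

abbreviation (input) index_sum :: "('i::finite \<Rightarrow> 'a::comm_monoid_add) \<Rightarrow> 'a" (binder \<open>\<Sigma>\<close> 10)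
  where "index_sum f \<equiv> sum f UNIV"

lemma has_derivative_pd:
  assumes "f differentiable (at x)"
  shows "(f has_derivative (\<lambda>v. \<Sigma> i. v $ i *\<^sub>R pd i f x)) (at x)"
proof -
  have D: "(f has_derivative frechet_derivative f (at x)) (at x)"
    using assms frechet_derivative_works by blast
  then have L: "linear (frechet_derivative f (at x))"
    by (rule has_derivative_linear)
  have "frechet_derivative f (at x) v = (\<Sigma> i. v $ i *\<^sub>R pd i f x)" for v
  proof -
    have "v = (\<Sigma> i. v $ i *\<^sub>R axis i 1)"
      by (simp add: vec_eq_iff axis_def if_distrib[of "\<lambda>z. _ * z"] cong: if_cong)
    then have "frechet_derivative f (at x) v = frechet_derivative f (at x) (\<Sigma> i. v $ i *\<^sub>R axis i 1)"
      by simp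
    also have "\<dots> = (\<Sigma> i. v $ i *\<^sub>R pd i f x)"
      by (simp add: linear_sum[OF L] linear_scale[OF L] pd_def)
    finally show ?thesis .
  qed
  with D show ?thesis by (metis (no_types, lifting) ext)
qed

lemma pd_eqI:
  assumes "(f has_derivative f') (at x)"
  shows "pd i f x = f' (axis i 1)"
  unfolding pd_def using frechet_derivative_at[OF assms] by simp

lemma pd_cong:
  assumes "open S" "x \<in> S" "\<And>y. y \<in> S \<Longrightarrow> f y = h y"
  shows "pd i f x = pd i h x"
proof -
  have "(f has_derivative D) (at x) \<longleftrightarrow> (h has_derivative D) (at x)" for D
    using has_derivative_transform_within_open[of f D x UNIV S h]
      has_derivative_transform_within_open[of h D x UNIV S f] assms by auto
  then show ?thesis unfolding pd_def frechet_derivative_def by simp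
qed

lemma differentiable_cong_open:
  assumes "open S" "x \<in> S" "\<And>y. y \<in> S \<Longrightarrow> f y = h y" "h differentiable (at x)"
  shows "f differentiable (at x)"
  using assms has_derivative_transform_within_open[of h _ x UNIV S f]
  unfolding differentiable_def by (metis)

lemma pd_const [simp]: "pd i (\<lambda>y. k) x = 0"
  by (rule trans[OF pd_eqI[OF has_derivative_const]]) simp

lemma pd_add:
  assumes "f differentiable (at x)" "h differentiable (at x)"
  shows "pd i (\<lambda>y. f y + h y) x = pd i f x + pd i h x"
  using pd_eqI[OF has_derivative_add[OF has_derivative_pd has_derivative_pd, OF assms], of i]
    pd_eqI[OF has_derivative_pd[OF assms(1)], of i] pd_eqI[OF has_derivative_pd[OF assms(2)], of i]
  by simp

lemma pd_diff:
  assumes "f differentiable (at x)" "h differentiable (at x)"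
  shows "pd i (\<lambda>y. f y - h y) x = pd i f x - pd i h x"
  using pd_eqI[OF has_derivative_diff[OF has_derivative_pd has_derivative_pd, OF assms], of i]
    pd_eqI[OF has_derivative_pd[OF assms(1)], of i] pd_eqI[OF has_derivative_pd[OF assms(2)], of i]
  by simp

lemma pd_sum:
  assumes "\<And>k. k \<in> K \<Longrightarrow> f k differentiable (at x)"
  shows "pd i (\<lambda>y. \<Sum>k\<in>K. f k y) x = (\<Sum>k\<in>K. pd i (f k) x)"
proof -
  have "((\<lambda>y. \<Sum>k\<in>K. f k y) has_derivative (\<lambda>v. \<Sum>k\<in>K. \<Sigma> i. v $ i *\<^sub>R pd i (f k) x)) (at x)"
    by (intro has_derivative_sum has_derivative_pd assms)
  from pd_eqI[OF this, of i] show ?thesis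
    using pd_eqI[OF has_derivative_pd[OF assms], of _ i] by simp
qed

lemma pd_mult:
  fixes f h :: "real^'n::finite \<Rightarrow> real"
  assumes "f differentiable (at x)" "h differentiable (at x)"
  shows "pd i (\<lambda>y. f y * h y) x = pd i f x * h x + f x * pd i h x"
  using pd_eqI[OF has_derivative_mult[OF has_derivative_pd has_derivative_pd, OF assms], of i]
    pd_eqI[OF has_derivative_pd[OF assms(1)], of i] pd_eqI[OF has_derivative_pd[OF assms(2)], of i]
  by simp

lemma pd_cmult:
  fixes f :: "real^'n::finite \<Rightarrow> real"
  assumes "f differentiable (at x)"
  shows "pd i (\<lambda>y. k * f y) x = k * pd i f x"
  using pd_mult[of "\<lambda>_. k" x f i] assms by simp

lemma pd_inverse:
  fixes f :: "real^'n::finite \<Rightarrow> real"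
  assumes "f differentiable (at x)" "f x \<noteq> 0"
  shows "pd i (\<lambda>y. inverse (f y)) x = - (inverse (f x) * pd i f x * inverse (f x))"
  using pd_eqI[OF Deriv.has_derivative_inverse[OF assms(2) has_derivative_pd[OF assms(1)]], of i]
    pd_eqI[OF has_derivative_pd[OF assms(1)], of i]
  by simp

lemma pd_linear:
  assumes "f differentiable (at x)" "bounded_linear L"
  shows "pd i (\<lambda>y. L (f y)) x = L (pd i f x)"
  using pd_eqI[OF bounded_linear.has_derivative[OF assms(2) has_derivative_pd[OF assms(1)]], of i]
    pd_eqI[OF has_derivative_pd[OF assms(1)], of i]
  by simp

lemma pd_compose:
  fixes \<tau> :: "real^'n::finite \<Rightarrow> real^'n" and f :: "real^'n \<Rightarrow> real"
  assumes "f differentiable (at (\<tau> x))" "\<tau> differentiable (at x)"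
  shows "pd i (\<lambda>y. f (\<tau> y)) x = (\<Sigma> a. pd i \<tau> x $ a * pd a f (\<tau> x))"
  using pd_eqI[OF has_derivative_compose[OF has_derivative_pd[OF assms(2)] has_derivative_pd[OF assms(1)]], of i]
    pd_eqI[OF has_derivative_pd[OF assms(2)], of i]
  by simp

lemma has_real_derivative_along:
  fixes f :: "real^'n::finite \<Rightarrow> real"
  assumes "f differentiable (at (\<eta> t))" "(\<eta> has_vector_derivative v) (at t)"
  shows "((\<lambda>s. f (\<eta> s)) has_real_derivative (\<Sigma> a. v $ a * pd a f (\<eta> t))) (at t)"
proof -
  have "((\<lambda>s. f (\<eta> s)) has_derivative (\<lambda>s. \<Sigma> a. (s *\<^sub>R v) $ a *\<^sub>R pd a f (\<eta> t))) (at t)"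
    by (rule has_derivative_compose[OF assms(2)[unfolded has_vector_derivative_def] has_derivative_pd[OF assms(1)]])
  then show ?thesis
    unfolding has_field_derivative_def
    by (elim has_derivative_eq_rhs) (simp add: fun_eq_iff sum_distrib_left sum_distrib_right mult_ac)
qed

lemma has_vector_derivative_along:
  fixes f :: "real^'n::finite \<Rightarrow> 'b::real_normed_vector"
  assumes "f differentiable (at (\<eta> t))" "(\<eta> has_vector_derivative v) (at t)"
  shows "((\<lambda>s. f (\<eta> s)) has_vector_derivative (\<Sigma> a. v $ a *\<^sub>R pd a f (\<eta> t))) (at t)"
proof -
  have "((\<lambda>s. f (\<eta> s)) has_derivative (\<lambda>s. \<Sigma> a. (s *\<^sub>R v) $ a *\<^sub>R pd a f (\<eta> t))) (at t)"
    by (rule has_derivative_compose[OF assms(2)[unfolded has_vector_derivative_def] has_derivative_pd[OF assms(1)]])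
  then show ?thesis
    unfolding has_vector_derivative_def by (simp add: scaleR_sum_right)
qed

subsection \<open>Smooth functions\<close>

lemma Ck_on_cong:
  assumes "open S" "\<And>y. y \<in> S \<Longrightarrow> f y = h y" "Ck_on k f S"
  shows "Ck_on k h S"
  using assms(2,3)
proof (induction k arbitrary: f h)
  case 0
  then show ?case using continuous_on_cong[of S S f h] by force
next
  case (Suc k)
  have "h differentiable (at x)" if "x \<in> S" for x
    by (rule differentiable_cong_open[OF assms(1) that, of h f]) (use Suc.prems(1) Suc.prems(2)[simplified] that in simp_all)
  moreover have "Ck_on k (pd i h) S" for i
    by (rule Suc.IH[of "pd i f"]) (use Suc.prems(1) Suc.prems(2)[simplified] pd_cong[OF assms(1), of _ f h] in simp_all)
  ultimately show ?case by simp
qed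

lemma Ck_on_SucD: "Ck_on (Suc k) f S \<Longrightarrow> Ck_on k f S"
proof (induction k arbitrary: f)
  case 0
  then show ?case
    by (auto intro!: continuous_at_imp_continuous_on differentiable_imp_continuous_within)
next
  case (Suc k)
  then show ?case by (metis Ck_on.simps(2))
qed

lemma Ck_on_const:
  fixes S :: "(real^'n::finite) set"
  shows "Ck_on k (\<lambda>_. c) S"
proof (induction k arbitrary: c)
  case (Suc k)
  have "pd i (\<lambda>_. c) = (\<lambda>_. 0)" for i :: 'n by (rule ext) simp
  then show ?case using Suc[of 0] by simp
qed simp

lemma Ck_on_add:
  assumes "open S" "Ck_on k f S" "Ck_on k h S"
  shows "Ck_on k (\<lambda>y. f y + h y) S"
  using assms(2,3)
proof (induction k arbitrary: f h)
  case 0 then show ?case by (auto intro: continuous_intros)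
next
  case (Suc k)
  have "Ck_on k (pd i (\<lambda>y. f y + h y)) S" for i
    by (rule Ck_on_cong[OF assms(1), of "\<lambda>y. pd i f y + pd i h y"]) (use Suc in \<open>auto simp: pd_add\<close>)
  then show ?case using Suc.prems by (auto intro: differentiable_add)
qed

lemma Ck_on_mult:
  fixes f h :: "real^'n::finite \<Rightarrow> real"
  assumes "open S" "Ck_on k f S" "Ck_on k h S"
  shows "Ck_on k (\<lambda>y. f y * h y) S"
  using assms(2,3)
proof (induction k arbitrary: f h)
  case 0 then show ?case by (auto intro: continuous_intros)
next
  case (Suc k)
  have *: "Ck_on k f S" "Ck_on k h S" using Suc.prems Ck_on_SucD by blast+
  have "Ck_on k (\<lambda>y. pd i f y * h y + f y * pd i h y) S" for i
    by (intro Ck_on_add Suc.IH assms(1) *) (use Suc.prems in auto)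
  from Ck_on_cong[OF assms(1) _ this] have "Ck_on k (pd i (\<lambda>y. f y * h y)) S" for i
    using Suc.prems by (simp add: pd_mult)
  then show ?case using Suc.prems by (auto intro: differentiable_mult)
qed

lemma Ck_on_inverse:
  fixes f :: "real^'n::finite \<Rightarrow> real"
  assumes "open S" "Ck_on k f S" "\<And>y. y \<in> S \<Longrightarrow> f y \<noteq> 0"
  shows "Ck_on k (\<lambda>y. inverse (f y)) S"
  using assms(2,3)
proof (induction k)
  case 0 then show ?case by (auto intro: continuous_intros)
next
  case (Suc k)
  have *: "Ck_on k (\<lambda>y. inverse (f y)) S" using Suc Ck_on_SucD by blast
  have "Ck_on k (\<lambda>y. (-1) * (inverse (f y) * pd i f y * inverse (f y))) S" for i
    by (intro Ck_on_mult Ck_on_const assms(1) *) (use Suc.prems in auto)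
  from Ck_on_cong[OF assms(1) _ this] have "Ck_on k (pd i (\<lambda>y. inverse (f y))) S" for i
    using Suc.prems by (simp add: pd_inverse)
  then show ?case using Suc.prems by auto
qed

lemma Ck_on_linear:
  assumes "open S" "Ck_on k f S" "bounded_linear L"
  shows "Ck_on k (\<lambda>y. L (f y)) S"
  using assms(2)
proof (induction k arbitrary: f)
  case 0 then show ?case
    by (auto intro!: bounded_linear.continuous_on[OF assms(3)])
next
  case (Suc k)
  have "Ck_on k (pd i (\<lambda>y. L (f y))) S" for i
    by (rule Ck_on_cong[OF assms(1), of "\<lambda>y. L (pd i f y)"]) (use Suc in \<open>auto simp: pd_linear assms(3)\<close>)
  moreover have "(\<lambda>y. L (f y)) differentiable (at x)" if "x \<in> S" for x
    using Suc.prems that bounded_linear.has_derivative[OF assms(3)] by (fastforce simp: differentiable_def)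
  ultimately show ?case by simp
qed

lemma smooth_on_cong: "open S \<Longrightarrow> (\<And>y. y \<in> S \<Longrightarrow> f y = h y) \<Longrightarrow> smooth_on f S \<Longrightarrow> smooth_on h S"
  unfolding smooth_on_def using Ck_on_cong by blast

lemma smooth_on_const: "smooth_on (\<lambda>_. c) S"
  unfolding smooth_on_def by (simp add: Ck_on_const)

lemma smooth_on_add: "open S \<Longrightarrow> smooth_on f S \<Longrightarrow> smooth_on h S \<Longrightarrow> smooth_on (\<lambda>y. f y + h y) S"
  unfolding smooth_on_def by (simp add: Ck_on_add)

lemma smooth_on_mult:
  fixes f h :: "real^'n::finite \<Rightarrow> real"
  shows "open S \<Longrightarrow> smooth_on f S \<Longrightarrow> smooth_on h S \<Longrightarrow> smooth_on (\<lambda>y. f y * h y) S"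
  unfolding smooth_on_def by (simp add: Ck_on_mult)

lemma smooth_on_minus:
  fixes f :: "real^'n::finite \<Rightarrow> real"
  shows "open S \<Longrightarrow> smooth_on f S \<Longrightarrow> smooth_on (\<lambda>y. - f y) S"
  using smooth_on_mult[of S "\<lambda>_. -1" f] by (simp add: smooth_on_const)

lemma smooth_on_diff:
  fixes f h :: "real^'n::finite \<Rightarrow> real"
  shows "open S \<Longrightarrow> smooth_on f S \<Longrightarrow> smooth_on h S \<Longrightarrow> smooth_on (\<lambda>y. f y - h y) S"
  using smooth_on_add[of S f "\<lambda>y. - h y"] by (simp add: smooth_on_minus)

lemma smooth_on_inverse:
  fixes f :: "real^'n::finite \<Rightarrow> real"
  shows "open S \<Longrightarrow> smooth_on f S \<Longrightarrow> (\<And>y. y \<in> S \<Longrightarrow> f y \<noteq> 0) \<Longrightarrow> smooth_on (\<lambda>y. inverse (f y)) S"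
  unfolding smooth_on_def by (simp add: Ck_on_inverse)

lemma smooth_on_sum:
  assumes "open S" "\<And>k. k \<in> K \<Longrightarrow> smooth_on (f k) S"
  shows "smooth_on (\<lambda>y. \<Sum>k\<in>K. f k y) S"
  using assms(2)
  by (induction K rule: infinite_finite_induct) (auto intro: smooth_on_const smooth_on_add assms(1))

lemma smooth_on_prod:
  fixes f :: "'k \<Rightarrow> real^'n::finite \<Rightarrow> real"
  assumes "open S" "\<And>k. k \<in> K \<Longrightarrow> smooth_on (f k) S"
  shows "smooth_on (\<lambda>y. \<Prod>k\<in>K. f k y) S"
  using assms(2)
  by (induction K rule: infinite_finite_induct) (auto intro: smooth_on_const smooth_on_mult assms(1))

lemma smooth_on_linear: "open S \<Longrightarrow> smooth_on f S \<Longrightarrow> bounded_linear L \<Longrightarrow> smooth_on (\<lambda>y. L (f y)) S"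
  unfolding smooth_on_def by (simp add: Ck_on_linear)

lemma smooth_on_nth: "open S \<Longrightarrow> smooth_on f S \<Longrightarrow> smooth_on (\<lambda>y. f y $ i) S"
  by (rule smooth_on_linear[OF _ _ bounded_linear_vec_nth])

lemma smooth_on_pd: "smooth_on f S \<Longrightarrow> smooth_on (pd i f) S"
  unfolding smooth_on_def by (metis Ck_on.simps(2))

lemma smooth_on_differentiable: "smooth_on f S \<Longrightarrow> x \<in> S \<Longrightarrow> f differentiable (at x)"
  unfolding smooth_on_def by (metis Ck_on.simps(2))

lemma smooth_on_continuous: "smooth_on f S \<Longrightarrow> continuous_on S f"
  unfolding smooth_on_def by (metis Ck_on.simps(1))

lemma smooth_on_subset:
  assumes "smooth_on f S" "T \<subseteq> S"
  shows "smooth_on f T"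
proof -
  have "Ck_on k f S \<Longrightarrow> Ck_on k f T" for k
    using assms(2) by (induction k arbitrary: f) (auto intro: continuous_on_subset)
  then show ?thesis using assms(1) unfolding smooth_on_def by blast
qed

lemmas smooth_intros = smooth_on_const smooth_on_add smooth_on_diff smooth_on_minus smooth_on_mult
  smooth_on_sum smooth_on_pd smooth_on_nth

lemma has_real_derivative_line:
  fixes f :: "real^'n::finite \<Rightarrow> real"
  assumes "f differentiable (at (p + s *\<^sub>R axis i 1))"
  shows "((\<lambda>s. f (p + s *\<^sub>R axis i 1)) has_real_derivative pd i f (p + s *\<^sub>R axis i 1)) (at s)"
proof -
  have D: "((\<lambda>s. p + s *\<^sub>R axis i 1 :: real^'n) has_vector_derivative axis i 1) (at s)"
    unfolding has_vector_derivative_def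
    by (rule has_derivative_eq_rhs[OF has_derivative_add[OF has_derivative_const
          has_derivative_scaleR_left[OF has_derivative_ident]]]) simp
  have "(\<Sigma> a. (axis i 1 :: real^'n) $ a * q a) = q i" for q :: "'n \<Rightarrow> real"
    by (simp add: axis_def if_distrib[of "\<lambda>z. z * _"] cong: if_cong)
  then show ?thesis
    using has_real_derivative_along[of f "\<lambda>s. p + s *\<^sub>R axis i 1" s "axis i 1", OF assms D] by simp
qed

text \<open>The second difference of \<open>f\<close> over a small square is the area times a mixed second partial
  derivative at an intermediate point; the second difference does not see the order of the two
  directions.\<close>

lemma second_difference_mvt:
  fixes f :: "real^'n::finite \<Rightarrow> real"
  assumes sm: "smooth_on f (ball x r)" and h: "0 < h" "2 * h < r"
  shows "\<exists>y\<in>ball x (3 * h). f (x + h *\<^sub>R axis i 1 + h *\<^sub>R axis j 1) - f (x + h *\<^sub>R axis i 1)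
            - f (x + h *\<^sub>R axis j 1) + f x = h * (h * pd j (pd i f) y)"
proof -
  define F where "F s = f (x + h *\<^sub>R axis j 1 + s *\<^sub>R axis i 1) - f (x + s *\<^sub>R axis i 1)" for s :: real
  have near: "x + b *\<^sub>R axis j 1 + a *\<^sub>R axis i 1 \<in> ball x (a + b + e)"
    if "0 \<le> a" "0 \<le> b" "0 < e" for a b e :: real
  proof -
    define w where "w = b *\<^sub>R axis j 1 + a *\<^sub>R axis i (1::real)"
    have "norm w \<le> norm (b *\<^sub>R axis j (1::real)) + norm (a *\<^sub>R axis i (1::real))"
      unfolding w_def by (rule norm_triangle_ineq)
    also have "\<dots> = b + a" using that by (simp add: norm_axis_1)
    finally have "x + w \<in> ball x (a + b + e)" using that by (simp add: dist_norm)
    then show ?thesis by (simp add: w_def add.assoc)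
  qed
  have in_r: "x + b *\<^sub>R axis j 1 + a *\<^sub>R axis i 1 \<in> ball x r" if "0 \<le> a" "0 \<le> b" "a \<le> h" "b \<le> h" for a b :: real
    using near[of a b "r - a - b"] that h by simp
  have D1: "(F has_real_derivative pd i f (x + h *\<^sub>R axis j 1 + s *\<^sub>R axis i 1) - pd i f (x + s *\<^sub>R axis i 1)) (at s)"
    if "0 \<le> s" "s \<le> h" for s :: real
    unfolding F_def
    using in_r[of s h] in_r[of s 0] that h
    by (intro DERIV_diff has_real_derivative_line smooth_on_differentiable[OF sm]) auto
  obtain s where s: "0 < s" "s < h"
    and Fs: "F h - F 0 = (h - 0) * (pd i f (x + h *\<^sub>R axis j 1 + s *\<^sub>R axis i 1) - pd i f (x + s *\<^sub>R axis i 1))"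
    using MVT2[of 0 h F "\<lambda>s. pd i f (x + h *\<^sub>R axis j 1 + s *\<^sub>R axis i 1) - pd i f (x + s *\<^sub>R axis i 1)"] h(1) D1
    by auto
  have D2: "((\<lambda>t. pd i f (x + s *\<^sub>R axis i 1 + t *\<^sub>R axis j 1)) has_real_derivative
      pd j (pd i f) (x + s *\<^sub>R axis i 1 + t *\<^sub>R axis j 1)) (at t)" if "0 \<le> t" "t \<le> h" for t :: real
    using in_r[of s t] that s
    by (intro has_real_derivative_line smooth_on_differentiable[OF smooth_on_pd[OF sm]]) (auto simp: algebra_simps)
  obtain t where t: "0 < t" "t < h"
    and Ft: "pd i f (x + s *\<^sub>R axis i 1 + h *\<^sub>R axis j 1) - pd i f (x + s *\<^sub>R axis i 1 + 0 *\<^sub>R axis j 1)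
       = (h - 0) * pd j (pd i f) (x + s *\<^sub>R axis i 1 + t *\<^sub>R axis j 1)"
    using MVT2[of 0 h "\<lambda>t. pd i f (x + s *\<^sub>R axis i 1 + t *\<^sub>R axis j 1)"
        "\<lambda>t. pd j (pd i f) (x + s *\<^sub>R axis i 1 + t *\<^sub>R axis j 1)"] h(1) D2
    by auto
  have "x + t *\<^sub>R axis j 1 + s *\<^sub>R axis i 1 \<in> ball x (3 * h)"
    using near[of s t "3 * h - s - t"] s t by simp
  moreover have "f (x + h *\<^sub>R axis i 1 + h *\<^sub>R axis j 1) - f (x + h *\<^sub>R axis i 1)
            - f (x + h *\<^sub>R axis j 1) + f x = F h - F 0"
    by (simp add: F_def algebra_simps)
  ultimately show ?thesis
    using Fs Ft by (intro bexI[of _ "x + t *\<^sub>R axis j 1 + s *\<^sub>R axis i 1"]) (auto simp: algebra_simps)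
qed

text \<open>Comparing the second differences over shrinking squares at \<open>x\<close> in the two orders of differentiation
  reduces this to the continuity of both mixed derivatives at \<open>x\<close>.\<close>

lemma pd_commute:
  fixes f :: "real^'n::finite \<Rightarrow> real"
  assumes S: "open S" "x \<in> S" and sm: "smooth_on f S"
  shows "pd i (pd j f) x = pd j (pd i f) x"
proof (rule ccontr)
  assume ne: "pd i (pd j f) x \<noteq> pd j (pd i f) x"
  define d where "d = \<bar>pd i (pd j f) x - pd j (pd i f) x\<bar> / 2"
  have d: "d > 0" using ne by (simp add: d_def)
  have C: "isCont (pd k (pd l f)) x" for k l
    using smooth_on_continuous[OF smooth_on_pd[OF smooth_on_pd[OF sm]]] S
    by (metis continuous_on_eq_continuous_at)
  obtain r where r: "r > 0" "ball x r \<subseteq> S" using S open_contains_ball by blast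
  obtain r1 where r1: "r1 > 0" "\<And>y. dist y x < r1 \<Longrightarrow> dist (pd i (pd j f) y) (pd i (pd j f) x) < d"
    using C[of i j] d unfolding continuous_at_eps_delta by blast
  obtain r2 where r2: "r2 > 0" "\<And>y. dist y x < r2 \<Longrightarrow> dist (pd j (pd i f) y) (pd j (pd i f) x) < d"
    using C[of j i] d unfolding continuous_at_eps_delta by blast
  define h where "h = min r (min r1 r2) / 4"
  have h: "0 < h" "2 * h < r" "3 * h < r1" "3 * h < r2" using r r1 r2 by (auto simp: h_def)
  have smb: "smooth_on f (ball x r)" using smooth_on_subset[OF sm r(2)] .
  obtain y where y: "y \<in> ball x (3 * h)" "f (x + h *\<^sub>R axis i 1 + h *\<^sub>R axis j 1) - f (x + h *\<^sub>R axis i 1)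
            - f (x + h *\<^sub>R axis j 1) + f x = h * (h * pd j (pd i f) y)"
    using second_difference_mvt[OF smb h(1,2)] by blast
  obtain z where z: "z \<in> ball x (3 * h)" "f (x + h *\<^sub>R axis j 1 + h *\<^sub>R axis i 1) - f (x + h *\<^sub>R axis j 1)
            - f (x + h *\<^sub>R axis i 1) + f x = h * (h * pd i (pd j f) z)"
    using second_difference_mvt[OF smb h(1,2)] by blast
  have "h * (h * pd j (pd i f) y) = h * (h * pd i (pd j f) z)"
    using y(2) z(2) by (simp add: algebra_simps)
  then have "pd j (pd i f) y = pd i (pd j f) z" using h by simp
  moreover have "dist (pd j (pd i f) y) (pd j (pd i f) x) < d" "dist (pd i (pd j f) z) (pd i (pd j f) x) < d"
    using r1(2)[of z] r2(2)[of y] y z h by (auto simp: dist_commute)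
  ultimately show False unfolding d_def dist_real_def by (smt (verit) field_sum_of_halves)
qed

section \<open>The Levi-Civita connection and the curvature in one chart\<close>

lemma smooth_on_det:
  fixes A :: "real^'n::finite \<Rightarrow> real^'k::finite^'k"
  assumes "open S" "\<And>i j. smooth_on (\<lambda>y. A y $ i $ j) S"
  shows "smooth_on (\<lambda>y. det (A y)) S"
  unfolding det_def
  by (intro smooth_on_sum smooth_on_mult smooth_on_const smooth_on_prod assms)

lemma matrix_inv_mult:
  fixes A :: "real^'k::finite^'k"
  assumes "invertible A"
  shows "A ** matrix_inv A = mat 1" "matrix_inv A ** A = mat 1"
  using someI_ex[OF assms[unfolded invertible_def]] by (simp_all add: matrix_inv_def)

lemma matrix_inv_eqI:
  fixes A :: "real^'k::finite^'k"
  assumes "A ** B = mat 1"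
  shows "matrix_inv A = B"
proof -
  have "invertible A" using assms invertible_right_inverse by blast
  then have "matrix_inv A = matrix_inv A ** (A ** B)" by (simp add: assms)
  also have "\<dots> = B"
    using matrix_inv_mult(2)[OF \<open>invertible A\<close>] by (simp add: matrix_mul_assoc)
  finally show ?thesis .
qed

text \<open>Cramer's rule. It shows that the inverse metric is smooth, being a rational function of the metric.\<close>

lemma matrix_inv_entry:
  fixes A :: "real^'k::finite^'k"
  assumes "invertible A"
  shows "matrix_inv A $ k $ j = det (\<chi> r s. if s = k then axis j 1 $ r else A $ r $ s) * inverse (det A)"
proof -
  have "A *v (matrix_inv A *v axis j 1) = axis j 1"
    using assms by (simp add: matrix_vector_mul_assoc matrix_inv_mult)
  moreover have "det A \<noteq> 0" using assms invertible_det_nz by blast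
  ultimately have "matrix_inv A *v axis j 1 = (\<chi> k. det (\<chi> r s. if s = k then axis j 1 $ r else A $ r $ s) / det A)"
    using cramer by blast
  then have "(matrix_inv A *v axis j 1) $ k = det (\<chi> r s. if s = k then axis j 1 $ r else A $ r $ s) / det A"
    by simp
  then show ?thesis by (simp add: matrix_vector_mul_component divide_inverse inner_axis)
qed

lemma smooth_on_matrix_inv:
  fixes A :: "real^'n::finite \<Rightarrow> real^'k::finite^'k"
  assumes S: "open S" and A: "\<And>i j. smooth_on (\<lambda>y. A y $ i $ j) S"
    and inv: "\<And>y. y \<in> S \<Longrightarrow> invertible (A y)"
  shows "smooth_on (\<lambda>y. matrix_inv (A y) $ i $ j) S"
proof (rule smooth_on_cong[OF S])
  show "det (\<chi> r s. if s = i then axis j 1 $ r else A y $ r $ s) * inverse (det (A y)) = matrix_inv (A y) $ i $ j"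
    if "y \<in> S" for y
    using matrix_inv_entry[OF inv[OF that]] by simp
  have "smooth_on (\<lambda>y. (\<chi> r s. if s = i then axis j 1 $ r else A y $ r $ s) $ p $ q) S" for p q
    using A by (cases "q = i") (simp_all add: smooth_on_const)
  then show "smooth_on (\<lambda>y. det (\<chi> r s. if s = i then axis j 1 $ r else A y $ r $ s) * inverse (det (A y))) S"
    using inv by (intro smooth_on_mult smooth_on_det smooth_on_inverse S A) (auto simp: invertible_det_nz)
qed

subsection \<open>Covariant derivatives of tensor fields\<close>

text \<open>The list \<open>ps\<close> encodes a permutation of the tensor indices; a connection term at position \<open>p\<close> of the
  permuted list is the one at position \<open>ps ! p\<close> of the original list.\<close>

lemma nabla_permute:
  assumes "distinct ps" "set ps = {..<length is}"
  shows "nabla G (\<lambda>y is. T y (map ((!) is) ps)) x (a # is) = nabla G T x (a # map ((!) is) ps)"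
proof -
  have len: "length ps = length is"
    using distinct_card[OF assms(1)] assms(2) by simp
  have upd: "(map ((!) is) ps)[p := m] = map ((!) (is[ps ! p := m])) ps" if "p < length ps" for p m
  proof (rule nth_equalityI)
    fix k assume "k < length ((map ((!) is) ps)[p := m])"
    then have k: "k < length ps" by simp
    have "ps ! p < length is" "ps ! k = ps ! p \<longleftrightarrow> k = p"
      using that k assms nth_mem[of p ps] nth_eq_iff_index_eq[of ps k p] by auto
    then show "(map ((!) is) ps)[p := m] ! k = map ((!) (is[ps ! p := m])) ps ! k"
      using k by (cases "k = p") simp_all
  qed simp
  let ?F = "\<lambda>q. \<Sigma> m. christoffel G x m a (is ! q) * T x (map ((!) (is[q := m])) ps)"
  have "bij_betw ((!) ps) {..<length ps} {..<length is}"
    using bij_betw_nth[OF assms(1) refl] assms(2) by simp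
  then have "(\<Sum>p<length ps. ?F (ps ! p)) = (\<Sum>q<length is. ?F q)"
    by (rule sum.reindex_bij_betw)
  moreover have "(\<Sum>p<length ps. ?F (ps ! p))
      = (\<Sum>p<length ps. \<Sigma> m. christoffel G x m a (map ((!) is) ps ! p) * T x ((map ((!) is) ps)[p := m]))"
    by (intro sum.cong refl) (simp add: upd)
  ultimately show ?thesis by simp
qed

lemma nabla_linear3:
  assumes "\<And>is. (\<lambda>y. T1 y is) differentiable (at x)" "\<And>is. (\<lambda>y. T2 y is) differentiable (at x)"
    "\<And>is. (\<lambda>y. T3 y is) differentiable (at x)"
  shows "nabla G (\<lambda>y is. T1 y is + k2 * T2 y is + k3 * T3 y is) x (a # is)
     = nabla G T1 x (a # is) + k2 * nabla G T2 x (a # is) + k3 * nabla G T3 x (a # is)"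
proof -
  have "pd a (\<lambda>y. T1 y is + k2 * T2 y is + k3 * T3 y is) x
      = pd a (\<lambda>y. T1 y is) x + k2 * pd a (\<lambda>y. T2 y is) x + k3 * pd a (\<lambda>y. T3 y is) x"
    using assms by (simp add: pd_add pd_cmult)
  moreover have "(\<Sum>p<length is. \<Sigma> m. christoffel G x m a (is ! p) *
        (T1 x (is[p := m]) + k2 * T2 x (is[p := m]) + k3 * T3 x (is[p := m])))
      = (\<Sum>p<length is. \<Sigma> m. christoffel G x m a (is ! p) * T1 x (is[p := m]))
      + k2 * (\<Sum>p<length is. \<Sigma> m. christoffel G x m a (is ! p) * T2 x (is[p := m]))
      + k3 * (\<Sum>p<length is. \<Sigma> m. christoffel G x m a (is ! p) * T3 x (is[p := m]))"
    unfolding sum_distrib_left by (simp add: distrib_left sum.distrib mult.left_commute)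
  ultimately show ?thesis by (simp add: right_diff_distrib)
qed

lemma nabla_cong:
  assumes "open S" "x \<in> S" "\<And>y js. y \<in> S \<Longrightarrow> length js = length is \<Longrightarrow> T y js = U y js"
  shows "nabla G T x (a # is) = nabla G U x (a # is)"
  using assms pd_cong[OF assms(1,2), of "\<lambda>y. T y is" "\<lambda>y. U y is"] by simp

lemma nabla_zero: "nabla G (\<lambda>y is. 0) x (a # is) = 0"
  by simp

text \<open>Covariant differentiation preserves every linear relation between index permutations of a
  tensor field. All the symmetries of \<open>R\<close>, \<open>\<nabla>R\<close> and \<open>\<nabla>\<nabla>R\<close> are propagated by this lemma.\<close>

lemma nabla_relation:
  assumes S: "open S" "x \<in> S" and T: "\<And>is. (\<lambda>y. T y is) differentiable (at x)"
    and "distinct ps1" "set ps1 = {..<d}" "distinct ps2" "set ps2 = {..<d}" "distinct ps3" "set ps3 = {..<d}"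
    and rel: "\<And>y is. y \<in> S \<Longrightarrow> length is = d \<Longrightarrow>
      T y (map ((!) is) ps1) + k2 * T y (map ((!) is) ps2) + k3 * T y (map ((!) is) ps3) = 0"
    and len: "length is = d"
  shows "nabla G T x (a # map ((!) is) ps1) + k2 * nabla G T x (a # map ((!) is) ps2)
     + k3 * nabla G T x (a # map ((!) is) ps3) = 0"
proof -
  have "nabla G (\<lambda>y is. T y (map ((!) is) ps1) + k2 * T y (map ((!) is) ps2) + k3 * T y (map ((!) is) ps3)) x (a # is)
      = nabla G (\<lambda>y is. 0) x (a # is)"
    by (rule nabla_cong[OF S]) (use rel len in simp)
  then show ?thesis
    using assms
    by (simp only: nabla_linear3 nabla_permute nabla_zero)
qed

lemma smooth_on_nabla:
  assumes "open S" "\<And>l i j. smooth_on (\<lambda>y. christoffel G y l i j) S" "\<And>is. smooth_on (\<lambda>y. T y is) S"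
  shows "smooth_on (\<lambda>y. nabla G T y is) S"
proof (cases "is")
  case Nil
  then show ?thesis by (simp add: smooth_on_const)
next
  case (Cons a js)
  show ?thesis unfolding Cons nabla.simps
    by (intro smooth_on_diff smooth_on_pd smooth_on_sum smooth_on_mult assms)
qed

text \<open>The derivative of a metric trace. Here \<open>C\<close> is a connection matrix; the derivatives of the
  components of the inverse metric \<open>h\<close> and of the tensor \<open>A\<close> are written as covariant derivative
  (zero for \<open>h\<close>) plus connection terms, and those at the two traced indices cancel.\<close>

lemma contraction_leibniz:
  fixes h C :: "'n::finite \<Rightarrow> 'n \<Rightarrow> real" and A D :: "'n list \<Rightarrow> real"
  assumes d: "length is = d"
  shows "(\<Sigma> p q. (- (\<Sigma> m. C p m * h m q) - (\<Sigma> m. C q m * h p m)) * A (p # q # is)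
        + h p q * (D (p # q # is) + (\<Sum>r<Suc (Suc d). \<Sigma> m. C m ((p # q # is) ! r) * A ((p # q # is)[r := m]))))
     = (\<Sigma> p q. h p q * D (p # q # is)) + (\<Sum>r<d. \<Sigma> m. C m (is ! r) * (\<Sigma> p q. h p q * A (p # q # is[r := m])))"
proof -
  have 1: "(\<Sigma> p q. (\<Sigma> m. C p m * h m q) * A (p # q # is)) = (\<Sigma> p q. h p q * (\<Sigma> m. C m p * A (m # q # is)))" (is "?l = ?r")
  proof -
    have "?l = (\<Sigma> p m q. C p m * h m q * A (p # q # is))"
      unfolding sum_distrib_right by (intro sum.cong refl sum.swap)
    also have "\<dots> = (\<Sigma> m q p. C p m * h m q * A (p # q # is))"
      by (subst sum.swap) (intro sum.cong refl sum.swap)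
    finally show ?thesis by (simp add: sum_distrib_left mult_ac)
  qed
  have 2: "(\<Sigma> p q. (\<Sigma> m. C q m * h p m) * A (p # q # is)) = (\<Sigma> p q. h p q * (\<Sigma> m. C m q * A (p # m # is)))" (is "?l = ?r")
  proof -
    have "?l = (\<Sigma> p m q. C q m * h p m * A (p # q # is))"
      unfolding sum_distrib_right by (intro sum.cong refl sum.swap)
    then show ?thesis by (simp add: sum_distrib_left mult_ac)
  qed
  have 3: "(\<Sigma> p q. h p q * (\<Sum>r<d. \<Sigma> m. C m (is ! r) * A (p # q # is[r := m])))
     = (\<Sum>r<d. \<Sigma> m. C m (is ! r) * (\<Sigma> p q. h p q * A (p # q # is[r := m])))" (is "?l = ?r")
  proof -
    let ?t = "\<lambda>p q r m. h p q * (C m (is ! r) * A (p # q # is[r := m]))"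
    have "?l = (\<Sigma> p q. \<Sum>r<d. \<Sigma> m. ?t p q r m)"
      by (simp add: sum_distrib_left)
    also have "\<dots> = (\<Sigma> p. \<Sum>r<d. \<Sigma> q m. ?t p q r m)"
      by (intro sum.cong refl sum.swap)
    also have "\<dots> = (\<Sum>r<d. \<Sigma> p m q. ?t p q r m)"
      by (subst sum.swap) (intro sum.cong refl sum.swap)
    also have "\<dots> = (\<Sum>r<d. \<Sigma> m p q. ?t p q r m)"
      by (intro sum.cong refl sum.swap)
    finally show ?thesis by (simp add: sum_distrib_left mult_ac)
  qed
  show ?thesis
    unfolding 3[symmetric] using 1 2
    by (simp add: sum.lessThan_Suc_shift distrib_left left_diff_distrib sum_subtractf sum.distrib sum_negf del: sum.lessThan_Suc)
qed

subsection \<open>The metric in a chart\<close>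

locale metric_on =
  fixes G :: "real^'n::finite \<Rightarrow> real^'n^'n" and S :: "(real^'n) set"
  assumes open_S: "open S" and smooth_G: "smooth_on G S"
    and transpose_G: "x \<in> S \<Longrightarrow> transpose (G x) = G x"
    and invertible_G: "x \<in> S \<Longrightarrow> invertible (G x)"
begin

abbreviation (input) \<Gamma> :: "real^'n \<Rightarrow> 'n \<Rightarrow> 'n \<Rightarrow> 'n \<Rightarrow> real" where "\<Gamma> \<equiv> christoffel G"
abbreviation (input) g where "g x i j \<equiv> G x $ i $ j"
abbreviation (input) h where "h x i j \<equiv> matrix_inv (G x) $ i $ j"

lemma smooth_g: "smooth_on (\<lambda>y. g y i j) S"
  using smooth_on_nth[OF open_S smooth_on_nth[OF open_S smooth_G]] .

lemma smooth_h: "smooth_on (\<lambda>y. h y i j) S"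
  by (rule smooth_on_matrix_inv[OF open_S smooth_g invertible_G])

lemma smooth_\<Gamma>: "smooth_on (\<lambda>y. \<Gamma> y l i j) S"
  unfolding christoffel_def by (intro smooth_intros open_S smooth_g smooth_h)

lemma smooth_curvature_op: "smooth_on (\<lambda>y. curvature_op G y l i j k) S"
  unfolding curvature_op_def by (intro smooth_intros open_S smooth_\<Gamma>)

lemma smooth_curvature: "smooth_on (\<lambda>y. curvature G y is) S"
  unfolding curvature_def by (intro smooth_intros open_S smooth_g smooth_curvature_op)

lemma smooth_nabla: "(\<And>is. smooth_on (\<lambda>y. T y is) S) \<Longrightarrow> smooth_on (\<lambda>y. nabla G T y is) S"
  by (rule smooth_on_nabla[OF open_S smooth_\<Gamma>])

lemmas smooth = smooth_g smooth_h smooth_\<Gamma> smooth_curvature_op smooth_curvature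
lemmas diff = smooth[THEN smooth_on_differentiable]

lemma transpose_entry: "transpose A $ i $ j = A $ j $ i"
  by (simp add: transpose_def)

lemma g_sym: "x \<in> S \<Longrightarrow> g x i j = g x j i"
  using transpose_entry[of "G x" j i] by (simp only: transpose_G)

lemma hg: assumes "x \<in> S" shows "(\<Sigma> k. h x i k * g x k j) = (if i = j then 1 else 0)"
proof -
  have "(matrix_inv (G x) ** G x) $ i $ j = mat 1 $ i $ j"
    using matrix_inv_mult(2)[OF invertible_G[OF assms]] by simp
  then show ?thesis by (simp add: matrix_matrix_mult_def mat_def)
qed

lemma gh: assumes "x \<in> S" shows "(\<Sigma> k. g x i k * h x k j) = (if i = j then 1 else 0)"
proof -
  have "(G x ** matrix_inv (G x)) $ i $ j = mat 1 $ i $ j"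
    using matrix_inv_mult(1)[OF invertible_G[OF assms]] by simp
  then show ?thesis by (simp add: matrix_matrix_mult_def mat_def)
qed

lemma h_sym: assumes "x \<in> S" shows "h x i j = h x j i"
proof -
  have "transpose (matrix_inv (G x)) = matrix_inv (G x)"
    using matrix_inv_mult(2)[OF invertible_G[OF assms]] transpose_G[OF assms]
    by (intro matrix_inv_eqI[symmetric]) (metis matrix_transpose_mul transpose_mat)
  then show ?thesis using transpose_entry[of "matrix_inv (G x)" j i] by simp
qed

lemma contract_hg:
  assumes "x \<in> S"
  shows "(\<Sigma> k m. f m * h x m k * g x k j) = f j"
proof -
  have "(\<Sigma> k m. f m * h x m k * g x k j) = (\<Sigma> m. f m * (\<Sigma> k. h x m k * g x k j))"
    by (subst sum.swap) (simp add: sum_distrib_left mult.assoc)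
  then show ?thesis by (simp add: hg[OF assms] if_distrib cong: if_cong)
qed

lemma contract_gh:
  assumes "x \<in> S"
  shows "(\<Sigma> k m. f m * g x m k * h x k j) = f j"
proof -
  have "(\<Sigma> k m. f m * g x m k * h x k j) = (\<Sigma> m. f m * (\<Sigma> k. g x m k * h x k j))"
    by (subst sum.swap) (simp add: sum_distrib_left mult.assoc)
  then show ?thesis by (simp add: gh[OF assms] if_distrib cong: if_cong)
qed

lemma pd_g_sym: "x \<in> S \<Longrightarrow> pd a (\<lambda>y. g y i j) x = pd a (\<lambda>y. g y j i) x"
  by (rule pd_cong[OF open_S]) (auto simp: g_sym)

lemma \<Gamma>_sym: "x \<in> S \<Longrightarrow> \<Gamma> x l i j = \<Gamma> x l j i"
  unfolding christoffel_def by (simp only: pd_g_sym[of x _ i j] add.commute[of "pd i _ x"])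

lemma pd_\<Gamma>_sym: "x \<in> S \<Longrightarrow> pd a (\<lambda>y. \<Gamma> y l i j) x = pd a (\<lambda>y. \<Gamma> y l j i) x"
  by (rule pd_cong[OF open_S]) (auto simp: \<Gamma>_sym)

text \<open>Christoffel symbols of the first kind.\<close>

definition \<Gamma>1 :: "real^'n \<Rightarrow> 'n \<Rightarrow> 'n \<Rightarrow> 'n \<Rightarrow> real" where
  "\<Gamma>1 x i j k = (\<Sigma> m. \<Gamma> x m i j * g x m k)"

lemma \<Gamma>1_eq:
  assumes "x \<in> S"
  shows "\<Gamma>1 x i j k = (pd i (\<lambda>y. g y k j) x + pd j (\<lambda>y. g y k i) x - pd k (\<lambda>y. g y i j) x) / 2"
proof -
  let ?B = "\<lambda>k. (pd i (\<lambda>y. g y k j) x + pd j (\<lambda>y. g y k i) x - pd k (\<lambda>y. g y i j) x) / 2"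
  have "\<Gamma>1 x i j k = (\<Sigma> m l. ?B l * h x l m * g x m k)"
    unfolding \<Gamma>1_def christoffel_def using h_sym[OF assms]
    by (simp add: sum_distrib_left sum_distrib_right mult_ac)
  then show ?thesis using contract_hg[OF assms, of ?B] by simp
qed

text \<open>The metric is parallel; \<open>pd_h\<close> says the same of its inverse.\<close>

lemma pd_g:
  assumes "x \<in> S"
  shows "pd a (\<lambda>y. g y i j) x = \<Gamma>1 x a i j + \<Gamma>1 x a j i"
  using pd_g_sym[OF assms] by (simp add: \<Gamma>1_eq[OF assms] field_simps)

lemma raise_\<Gamma>1:
  assumes "x \<in> S"
  shows "(\<Sigma> k. \<Gamma>1 x i j k * h x k l) = \<Gamma> x l i j"
  unfolding \<Gamma>1_def using contract_gh[OF assms, of "\<lambda>m. \<Gamma> x m i j" l]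
  by (simp add: sum_distrib_right)

lemma pd_h:
  assumes x: "x \<in> S"
  shows "pd a (\<lambda>y. h y i j) x = - (\<Sigma> m. \<Gamma> x i a m * h x m j + \<Gamma> x j a m * h x i m)"
proof -
  have "(\<Sigma> k. pd a (\<lambda>y. h y i k) x * g x k l + h x i k * pd a (\<lambda>y. g y k l) x) = 0" for l
  proof -
    have "pd a (\<lambda>y. \<Sigma> k. h y i k * g y k l) x = pd a (\<lambda>y. if i = l then 1 else 0 :: real) x"
      by (rule pd_cong[OF open_S x]) (simp add: hg)
    then show ?thesis
      by (simp add: pd_sum pd_mult diff x)
  qed
  then have *: "(\<Sigma> k. pd a (\<lambda>y. h y i k) x * g x k l) = - (\<Sigma> k. h x i k * pd a (\<lambda>y. g y k l) x)" for l
    by (simp add: sum.distrib eq_neg_iff_add_eq_0)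
  have "pd a (\<lambda>y. h y i j) x = (\<Sigma> l. (\<Sigma> k. pd a (\<lambda>y. h y i k) x * g x k l) * h x l j)"
    using contract_gh[OF x, of "\<lambda>k. pd a (\<lambda>y. h y i k) x" j] by (simp add: sum_distrib_right)
  also have "\<dots> = - (\<Sigma> l. (\<Sigma> k. h x i k * (\<Gamma>1 x a k l + \<Gamma>1 x a l k)) * h x l j)"
    by (simp add: * pd_g[OF x] sum_negf)
  also have "\<dots> = - ((\<Sigma> l k. h x i k * (\<Gamma>1 x a k l * h x l j))
                  + (\<Sigma> l k. (\<Gamma>1 x a l k * h x k i) * h x l j))"
    using h_sym[OF x, of i] by (simp add: sum_distrib_left sum_distrib_right algebra_simps sum.distrib)
  also have "(\<Sigma> l k. h x i k * (\<Gamma>1 x a k l * h x l j)) = (\<Sigma> k. h x i k * \<Gamma> x j a k)"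
    by (subst sum.swap) (simp add: raise_\<Gamma>1[OF x] flip: sum_distrib_left)
  also have "(\<Sigma> l k. (\<Gamma>1 x a l k * h x k i) * h x l j) = (\<Sigma> l. \<Gamma> x i a l * h x l j)"
    by (simp add: raise_\<Gamma>1[OF x] flip: sum_distrib_right)
  finally show ?thesis by (simp add: sum.distrib mult.commute)
qed

text \<open>Contraction with the inverse metric commutes with covariant differentiation, because the
  inverse metric is parallel.\<close>

lemma nabla_contract:
  assumes x: "x \<in> S" and T: "\<And>is. (\<lambda>y. T y is) differentiable (at x)"
  shows "nabla G (\<lambda>y is. \<Sigma> p q. h y p q * T y (p # q # is)) x (a # is)
     = (\<Sigma> p q. h x p q * nabla G T x (a # p # q # is))"
proof -
  have "pd a (\<lambda>y. \<Sigma> p q. h y p q * T y (p # q # is)) x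
    = (\<Sigma> p q. pd a (\<lambda>y. h y p q) x * T x (p # q # is) + h x p q * pd a (\<lambda>y. T y (p # q # is)) x)"
    using T diff(2)[OF x] by (simp add: pd_sum pd_mult)
  moreover have "pd a (\<lambda>y. T y js) x = nabla G T x (a # js) + (\<Sum>r<length js. \<Sigma> m. \<Gamma> x m a (js ! r) * T x (js[r := m]))" for js
    by simp
  moreover have "pd a (\<lambda>y. h y p q) x = - (\<Sigma> m. \<Gamma> x p a m * h x m q) - (\<Sigma> m. \<Gamma> x q a m * h x p m)" for p q
    by (simp add: pd_h[OF x] sum.distrib)
  ultimately have "pd a (\<lambda>y. \<Sigma> p q. h y p q * T y (p # q # is)) x
    = (\<Sigma> p q. h x p q * nabla G T x (a # p # q # is))
      + (\<Sum>r<length is. \<Sigma> m. \<Gamma> x m a (is ! r) * (\<Sigma> p q. h x p q * T x (p # q # is[r := m])))"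
    using contraction_leibniz[OF refl, of "\<lambda>m i. \<Gamma> x m a i" "h x" "T x" "is" "\<lambda>js. nabla G T x (a # js)"]
    by (simp only: length_Cons)
  then show ?thesis by simp
qed

end

subsection \<open>Algebraic curvature tensors\<close>

definition curvature_like :: "('n \<Rightarrow> 'n \<Rightarrow> 'n \<Rightarrow> 'n \<Rightarrow> real) \<Rightarrow> bool" where
  "curvature_like K \<longleftrightarrow> (\<forall>i j k l. K i j k l + K j i k l = 0) \<and> (\<forall>i j k l. K i j k l + K i j l k = 0)
     \<and> (\<forall>i j k l. K i j k l + K j k i l + K k i j l = 0)"

lemma curvature_like_antisym12: "curvature_like K \<Longrightarrow> K j i k l = - K i j k l"
  unfolding curvature_like_def by (metis add.commute eq_neg_iff_add_eq_0)

lemma curvature_like_antisym34: "curvature_like K \<Longrightarrow> K i j l k = - K i j k l"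
  unfolding curvature_like_def by (metis add.commute eq_neg_iff_add_eq_0)

lemma curvature_like_cyclic: "curvature_like K \<Longrightarrow> K i j k l + K j k i l + K k i j l = 0"
  unfolding curvature_like_def by blast

text \<open>The four cyclic identities at the index triples of \<open>{i,j,k,l}\<close>, added with signs.\<close>

lemma curvature_like_pair:
  assumes "curvature_like K"
  shows "K k l i j = K i j k l"
  using curvature_like_cyclic[OF assms, of i j k l] curvature_like_cyclic[OF assms, of j k l i]
    curvature_like_cyclic[OF assms, of k l i j] curvature_like_cyclic[OF assms, of l i j k]
    curvature_like_antisym12[OF assms, of i j k l] curvature_like_antisym34[OF assms, of i j k l]
    curvature_like_antisym12[OF assms, of j k i l] curvature_like_antisym34[OF assms, of j k i l]
    curvature_like_antisym12[OF assms, of k i j l] curvature_like_antisym34[OF assms, of k i j l]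
    curvature_like_antisym12[OF assms, of i l j k] curvature_like_antisym34[OF assms, of i l j k]
    curvature_like_antisym12[OF assms, of j l i k] curvature_like_antisym34[OF assms, of j l i k]
    curvature_like_antisym12[OF assms, of k l i j] curvature_like_antisym34[OF assms, of k l i j]
    curvature_like_antisym34[OF assms, of l i k j] curvature_like_antisym34[OF assms, of l j k i]
    curvature_like_antisym34[OF assms, of i k j l]
  by linarith

text \<open>An algebraic curvature tensor is determined by its sectional part, the values
  \<open>K(x,u,u,y)\<close>.\<close>

lemma curvature_like_zero:
  assumes K: "curvature_like K" and sec: "\<And>x a b y. K x a b y + K x b a y = 0"
  shows "K i j k l = 0"
  using sec[of i j k l] sec[of j k i l] sec[of k i j l] curvature_like_cyclic[OF K, of i j k l]
    curvature_like_antisym12[OF K, of i k j l] curvature_like_antisym12[OF K, of j i k l]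
    curvature_like_antisym12[OF K, of k j i l]
  by linarith

lemma curvature_like_diff_scale:
  assumes "curvature_like K" "curvature_like L"
  shows "curvature_like (\<lambda>i j k l. K i j k l - c * L i j k l)"
proof -
  have "K i j k l - c * L i j k l + (K j i k l - c * L j i k l) = (K i j k l + K j i k l) - c * (L i j k l + L j i k l)"
    and "K i j k l - c * L i j k l + (K i j l k - c * L i j l k) = (K i j k l + K i j l k) - c * (L i j k l + L i j l k)"
    and "K i j k l - c * L i j k l + (K j k i l - c * L j k i l) + (K k i j l - c * L k i j l)
     = (K i j k l + K j k i l + K k i j l) - c * (L i j k l + L j k i l + L k i j l)" for i j k l
    by (simp_all add: algebra_simps)
  then show ?thesis
    using assms unfolding curvature_like_def by simp
qed

subsection \<open>Symmetries of the curvature and of its covariant derivatives\<close>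

lemma list4: "length is = 4 \<Longrightarrow> \<exists>i j k l. is = [i, j, k, l]"
  by (auto simp: length_Suc_conv numeral_eq_Suc)

lemma list5: "length is = 5 \<Longrightarrow> \<exists>a i j k l. is = [a, i, j, k, l]"
  by (auto simp: length_Suc_conv numeral_eq_Suc)

context metric_on
begin

lemma curvature4: "curvature G x [i, j, k, l] = (\<Sigma> m. curvature_op G x m i j k * g x m l)"
  by (simp add: curvature_def numeral_eq_Suc)

lemma curvature_op_antisym: "curvature_op G x l j i k = - curvature_op G x l i j k"
  unfolding curvature_op_def by (simp add: sum_subtractf)

lemma curvature_op_cyclic:
  assumes "x \<in> S"
  shows "curvature_op G x l i j k + curvature_op G x l j k i + curvature_op G x l k i j = 0"
  unfolding curvature_op_def
  using \<Gamma>_sym[OF assms, of _ k i] \<Gamma>_sym[OF assms, of _ k j] \<Gamma>_sym[OF assms, of _ j i]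
    pd_\<Gamma>_sym[OF assms, of _ l k i] pd_\<Gamma>_sym[OF assms, of _ l k j] pd_\<Gamma>_sym[OF assms, of _ l j i]
  by (simp add: sum_subtractf)

text \<open>With the index lowered, the quadratic terms of the curvature become the symmetric expressions of
  \<open>\<Gamma>_\<Gamma>1_sym\<close>.\<close>

lemma curvature_lowered:
  assumes x: "x \<in> S"
  shows "curvature G x [i, j, k, l] = pd i (\<lambda>y. \<Gamma>1 y j k l) x - pd j (\<lambda>y. \<Gamma>1 y i k l) x
     - (\<Sigma> m. \<Gamma> x m j k * \<Gamma>1 x i l m) + (\<Sigma> m. \<Gamma> x m i k * \<Gamma>1 x j l m)"
proof -
  have D: "pd i (\<lambda>y. \<Gamma>1 y j k l) x = (\<Sigma> m. pd i (\<lambda>y. \<Gamma> y m j k) x * g x m l)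
     + (\<Sigma> m. \<Gamma> x m j k * \<Gamma>1 x i m l) + (\<Sigma> m. \<Gamma> x m j k * \<Gamma>1 x i l m)" for i j
    unfolding \<Gamma>1_def[of _ j k l] using diff x
    by (simp add: pd_sum pd_mult pd_g[OF x] sum.distrib distrib_left)
  have Q: "(\<Sigma> n. (\<Sigma> m. \<Gamma> x m j k * \<Gamma> x n i m) * g x n l)
      = (\<Sigma> m. \<Gamma> x m j k * \<Gamma>1 x i m l)" for i j
    unfolding \<Gamma>1_def sum_distrib_left sum_distrib_right
    by (subst sum.swap) (simp add: mult.assoc)
  show ?thesis
    unfolding curvature4 curvature_op_def D
    by (simp add: Q sum_subtractf sum.distrib distrib_right left_diff_distrib)
qed

lemma \<Gamma>_\<Gamma>1_sym:
  assumes x: "x \<in> S"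
  shows "(\<Sigma> m. \<Gamma> x m i j * \<Gamma>1 x k l m) = (\<Sigma> m. \<Gamma> x m k l * \<Gamma>1 x i j m)"
  unfolding \<Gamma>1_def sum_distrib_left
  by (subst sum.swap) (simp add: g_sym[OF x] mult_ac)

lemma smooth_\<Gamma>1: "smooth_on (\<lambda>y. \<Gamma>1 y i j k) S"
  unfolding \<Gamma>1_def by (intro smooth_intros open_S smooth_g smooth_\<Gamma>)

text \<open>The antisymmetry in the last two indices is the commutativity of the second partial
  derivatives of the metric.\<close>

lemma curvature_antisym34:
  assumes x: "x \<in> S"
  shows "curvature G x [i, j, k, l] + curvature G x [i, j, l, k] = 0"
proof -
  have "pd i (\<lambda>y. \<Gamma>1 y j k l) x + pd i (\<lambda>y. \<Gamma>1 y j l k) x = pd i (pd j (\<lambda>y. g y k l)) x" for i j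
  proof -
    have "pd i (pd j (\<lambda>y. g y k l)) x = pd i (\<lambda>y. \<Gamma>1 y j k l + \<Gamma>1 y j l k) x"
      by (rule pd_cong[OF open_S x]) (simp add: pd_g)
    then show ?thesis using smooth_on_differentiable[OF smooth_\<Gamma>1 x] by (simp add: pd_add)
  qed
  from this[of i j] this[of j i] show ?thesis
    using pd_commute[OF open_S x smooth_g, of i j k l] \<Gamma>_\<Gamma>1_sym[OF x, of j k i l] \<Gamma>_\<Gamma>1_sym[OF x, of i k j l]
    unfolding curvature_lowered[OF x] by linarith
qed

lemma curvature_like_curvature:
  assumes x: "x \<in> S"
  shows "curvature_like (\<lambda>i j k l. curvature G x [i, j, k, l])"
proof -
  have "curvature G x [i, j, k, l] + curvature G x [j, i, k, l] = 0" for i j k l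
    unfolding curvature4 curvature_op_antisym[of x _ j i] by (simp add: sum_negf)
  moreover have "curvature G x [i, j, k, l] + curvature G x [j, k, i, l] + curvature G x [k, i, j, l] = 0" for i j k l
    unfolding curvature4 sum.distrib[symmetric] distrib_right[symmetric]
    by (simp add: curvature_op_cyclic[OF x])
  ultimately show ?thesis
    unfolding curvature_like_def using curvature_antisym34[OF x] by blast
qed

text \<open>The covariant derivative of the curvature operator, a tensor with one upper index \<open>m\<close>.\<close>

definition nabla_op :: "real^'n \<Rightarrow> 'n \<Rightarrow> 'n \<Rightarrow> 'n \<Rightarrow> 'n \<Rightarrow> 'n \<Rightarrow> real" where
  "nabla_op x m a i j k = pd a (\<lambda>y. curvature_op G y m i j k) x
     + (\<Sigma> p. \<Gamma> x m a p * curvature_op G x p i j k)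
     - (\<Sigma> p. \<Gamma> x p a i * curvature_op G x m p j k)
     - (\<Sigma> p. \<Gamma> x p a j * curvature_op G x m i p k)
     - (\<Sigma> p. \<Gamma> x p a k * curvature_op G x m i j p)"

text \<open>Lowering an index commutes with covariant differentiation, because the metric is parallel.\<close>

lemma nabla_curvature:
  assumes x: "x \<in> S"
  shows "nabla G (curvature G) x [a, i, j, k, l] = (\<Sigma> m. nabla_op x m a i j k * g x m l)"
proof -
  have pd: "pd a (\<lambda>y. curvature G y [i, j, k, l]) x
     = (\<Sigma> m. pd a (\<lambda>y. curvature_op G y m i j k) x * g x m l)
     + (\<Sigma> m. curvature_op G x m i j k * \<Gamma>1 x a m l) + (\<Sigma> m. curvature_op G x m i j k * \<Gamma>1 x a l m)"
    unfolding curvature4 using diff x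
    by (simp add: pd_sum pd_mult pd_g[OF x] sum.distrib distrib_left)
  have 1: "(\<Sigma> m. curvature_op G x m i j k * \<Gamma>1 x a m l)
     = (\<Sigma> m. (\<Sigma> p. \<Gamma> x m a p * curvature_op G x p i j k) * g x m l)"
    unfolding \<Gamma>1_def sum_distrib_left sum_distrib_right by (subst sum.swap) (simp add: mult_ac)
  have 2: "(\<Sigma> m. curvature_op G x m i j k * \<Gamma>1 x a l m)
     = (\<Sigma> p. \<Gamma> x p a l * (\<Sigma> m. curvature_op G x m i j k * g x m p))"
    unfolding \<Gamma>1_def sum_distrib_left sum_distrib_right by (subst sum.swap) (simp add: mult_ac g_sym[OF x])
  have 3: "(\<Sigma> p. c p * (\<Sigma> m. f p m * g x m l)) = (\<Sigma> m. (\<Sigma> p. c p * f p m) * g x m l)"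
    for c :: "'n \<Rightarrow> real" and f :: "'n \<Rightarrow> 'n \<Rightarrow> real"
    unfolding sum_distrib_left sum_distrib_right by (subst sum.swap) (simp add: mult_ac)
  have "nabla G (curvature G) x [a, i, j, k, l] = pd a (\<lambda>y. curvature G y [i, j, k, l]) x
     - (\<Sigma> p. \<Gamma> x p a i * curvature G x [p, j, k, l]) - (\<Sigma> p. \<Gamma> x p a j * curvature G x [i, p, k, l])
     - (\<Sigma> p. \<Gamma> x p a k * curvature G x [i, j, p, l]) - (\<Sigma> p. \<Gamma> x p a l * curvature G x [i, j, k, p])"
    by (simp add: numeral_eq_Suc)
  also have "\<dots> = (\<Sigma> m. nabla_op x m a i j k * g x m l)"
    unfolding pd 1 2 unfolding curvature4 3 nabla_op_def
    by (simp add: sum.distrib sum_subtractf left_diff_distrib distrib_right)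
  finally show ?thesis .
qed

text \<open>The second Bianchi identity. Regard \<open>\<Gamma>\<^sub>i\<close> as matrices, so that the curvature operator is
  \<open>\<partial>\<^sub>i\<Gamma>\<^sub>j - \<partial>\<^sub>j\<Gamma>\<^sub>i + [\<Gamma>\<^sub>i, \<Gamma>\<^sub>j]\<close>. In the cyclic sum the second derivatives (\<open>P\<close>) cancel as they
  commute, the terms \<open>A\<close>, \<open>B\<close> linear in first derivatives cancel in pairs, the cubic terms (\<open>T\<close>) by
  the Jacobi identity of the commutator, and the terms \<open>W\<close> acting on the first two indices because
  the connection is torsion free.\<close>

lemma nabla_op_cyclic:
  assumes x: "x \<in> S"
  shows "nabla_op x m a i j k + nabla_op x m i j a k + nabla_op x m j a i k = 0"
proof -
  define P where "P a i j = pd a (pd i (\<lambda>y. \<Gamma> y m j k)) x" for a i j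
  define A where "A a i j = (\<Sigma> p. \<Gamma> x m a p * pd i (\<lambda>y. \<Gamma> y p j k) x)" for a i j
  define B where "B a i j = (\<Sigma> p. \<Gamma> x p a k * pd i (\<lambda>y. \<Gamma> y m j p) x)" for a i j
  define T where "T a i j = (\<Sigma> p q. \<Gamma> x m a p * (\<Gamma> x p i q * \<Gamma> x q j k))" for a i j
  define W where "W a i j = (\<Sigma> p. \<Gamma> x p a i * curvature_op G x m p j k)" for a i j
  have D: "(\<lambda>y. pd i (\<lambda>y. \<Gamma> y m j k) y) differentiable (at x)" for i m j k
    using smooth_on_differentiable[OF smooth_on_pd[OF smooth_\<Gamma>] x] .
  have e1: "pd a (\<lambda>y. curvature_op G y m i j k) x = P a i j - P a j i + A i a j + B j a i - A j a i - B i a j" for a i j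
    unfolding curvature_op_def P_def A_def B_def using D[of i m j k] D[of j m i k] diff(3)[OF x]
    by (simp add: pd_add pd_diff pd_sum pd_mult sum.distrib sum_subtractf mult_ac)
  have e2: "(\<Sigma> p. \<Gamma> x m a p * curvature_op G x p i j k) = A a i j - A a j i + T a i j - T a j i" for a i j
    unfolding curvature_op_def A_def T_def
    by (simp add: distrib_left right_diff_distrib sum.distrib sum_subtractf sum_distrib_left mult_ac)
  have e3: "(\<Sigma> p. \<Gamma> x p a k * curvature_op G x m i j p) = B a i j - B a j i + T i j a - T j i a" for a i j
  proof -
    have "T i j a = (\<Sigma> p q. \<Gamma> x p a k * (\<Gamma> x q j p * \<Gamma> x m i q))" for i j a
      unfolding T_def by (subst sum.swap) (simp add: mult_ac)
    then show ?thesis unfolding curvature_op_def B_def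
      by (simp add: distrib_left right_diff_distrib sum.distrib sum_subtractf sum_distrib_left)
  qed
  have e4: "(\<Sigma> p. \<Gamma> x p a j * curvature_op G x m i p k) = - W a j i" for a i j
    unfolding W_def by (simp add: curvature_op_antisym[of x m _ i] sum_negf)
  have N: "nabla_op x m a i j k = P a i j - P a j i + A i a j + B j a i - A j a i - B i a j
      + (A a i j - A a j i + T a i j - T a j i) - W a i j + W a j i - (B a i j - B a j i + T i j a - T j i a)" for a i j
    unfolding nabla_op_def e1 e2 e3 e4 W_def[of a i j] by simp
  have W: "W a i j = W i a j" for a i j unfolding W_def by (simp add: \<Gamma>_sym[OF x, of _ a i])
  have P: "P a i j = P i a j" for a i j unfolding P_def by (rule pd_commute[OF open_S x smooth_\<Gamma>])
  show ?thesis unfolding N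
    using W[of a i j] W[of i j a] W[of j a i] P[of a i j] P[of i j a] P[of j a i] by linarith
qed

abbreviation "DR \<equiv> nabla G (curvature G)"
abbreviation "DDR \<equiv> nabla G (nabla G (curvature G))"

lemma smooth_DR: "smooth_on (\<lambda>y. DR y is) S"
  by (rule smooth_nabla[OF smooth_curvature])

lemma bianchi2:
  assumes x: "x \<in> S"
  shows "DR x [a, i, j, k, l] + DR x [i, j, a, k, l] + DR x [j, a, i, k, l] = 0"
  unfolding nabla_curvature[OF x] sum.distrib[symmetric] distrib_right[symmetric]
  by (simp add: nabla_op_cyclic[OF x])

lemma nabla_curvature_relation:
  assumes x: "x \<in> S"
    and perms: "distinct ps2" "set ps2 = {..<4}" "distinct ps3" "set ps3 = {..<4}"
    and rel: "\<And>y is. y \<in> S \<Longrightarrow> length is = 4 \<Longrightarrow>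
      curvature G y is + k2 * curvature G y (map ((!) is) ps2) + k3 * curvature G y (map ((!) is) ps3) = 0"
    and len: "length is = 4"
  shows "DR x (a # is) + k2 * DR x (a # map ((!) is) ps2) + k3 * DR x (a # map ((!) is) ps3) = 0"
proof -
  have id: "map ((!) js) [0..<4] = js" if "length js = 4" for js :: "'n list"
    using that by (metis map_nth)
  show ?thesis
    using nabla_relation[OF open_S x, of "curvature G" "[0..<4]" 4 ps2 ps3 k2 k3 "is" G a]
      perms rel len smooth_on_differentiable[OF smooth_curvature x]
    by (simp add: id atLeast0LessThan del: nabla.simps)
qed

lemma curvature_like_DR:
  assumes x: "x \<in> S"
  shows "curvature_like (\<lambda>i j k l. DR x [a, i, j, k, l])"
proof -
  have s4: "{..<4} = {0, 1, 2, 3 :: nat}" by auto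
  note K = curvature_like_curvature[unfolded curvature_like_def]
  have K1: "curvature G y [i, j, k, l] + curvature G y [j, i, k, l] = 0"
    and K2: "curvature G y [i, j, k, l] + curvature G y [i, j, l, k] = 0"
    and K3: "curvature G y [i, j, k, l] + curvature G y [j, k, i, l] + curvature G y [k, i, j, l] = 0"
    if "y \<in> S" for y i j k l using K[OF that] by blast+
  have "DR x (a # [i, j, k, l]) + 1 * DR x (a # map ((!) [i, j, k, l]) [1,0,2,3])
      + 0 * DR x (a # map ((!) [i, j, k, l]) [1,0,2,3]) = 0" for i j k l
    by (rule nabla_curvature_relation[OF x]) (auto simp: s4 K1 simp del: nabla.simps dest!: list4)
  moreover have "DR x (a # [i, j, k, l]) + 1 * DR x (a # map ((!) [i, j, k, l]) [0,1,3,2])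
      + 0 * DR x (a # map ((!) [i, j, k, l]) [0,1,3,2]) = 0" for i j k l
    by (rule nabla_curvature_relation[OF x]) (auto simp: s4 K2 simp del: nabla.simps dest!: list4)
  moreover have "DR x (a # [i, j, k, l]) + 1 * DR x (a # map ((!) [i, j, k, l]) [1,2,0,3])
      + 1 * DR x (a # map ((!) [i, j, k, l]) [2,0,1,3]) = 0" for i j k l
    by (rule nabla_curvature_relation[OF x]) (auto simp: s4 K3 simp del: nabla.simps dest!: list4)
  ultimately show ?thesis unfolding curvature_like_def by (simp del: nabla.simps)
qed

lemma nabla2_curvature_relation:
  assumes x: "x \<in> S"
    and perms: "distinct ps2" "set ps2 = {..<5}" "distinct ps3" "set ps3 = {..<5}"
    and rel: "\<And>y is. y \<in> S \<Longrightarrow> length is = 5 \<Longrightarrow>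
      DR y is + k2 * DR y (map ((!) is) ps2) + k3 * DR y (map ((!) is) ps3) = 0"
    and len: "length is = 5"
  shows "DDR x (a # is) + k2 * DDR x (a # map ((!) is) ps2) + k3 * DDR x (a # map ((!) is) ps3) = 0"
proof -
  have id: "map ((!) js) [0..<5] = js" if "length js = 5" for js :: "'n list"
    using that by (metis map_nth)
  show ?thesis
    using nabla_relation[OF open_S x, of DR "[0..<5]" 5 ps2 ps3 k2 k3 "is" G a]
      perms rel len smooth_on_differentiable[OF smooth_DR x]
    by (simp add: id atLeast0LessThan del: nabla.simps)
qed

lemma curvature_like_DDR:
  assumes x: "x \<in> S"
  shows "curvature_like (\<lambda>i j k l. DDR x [b, a, i, j, k, l])"
proof -
  have s5: "{..<5} = {0, 1, 2, 3, 4 :: nat}" by auto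
  note K = curvature_like_DR[unfolded curvature_like_def]
  have K1: "DR y [a, i, j, k, l] + DR y [a, j, i, k, l] = 0"
    and K2: "DR y [a, i, j, k, l] + DR y [a, i, j, l, k] = 0"
    and K3: "DR y [a, i, j, k, l] + DR y [a, j, k, i, l] + DR y [a, k, i, j, l] = 0"
    if "y \<in> S" for y a i j k l using K[OF that] by blast+
  have "DDR x (b # [a, i, j, k, l]) + 1 * DDR x (b # map ((!) [a, i, j, k, l]) [0,2,1,3,4])
      + 0 * DDR x (b # map ((!) [a, i, j, k, l]) [0,2,1,3,4]) = 0" for i j k l
    by (rule nabla2_curvature_relation[OF x]) (auto simp: s5 K1 simp del: nabla.simps dest!: list5)
  moreover have "DDR x (b # [a, i, j, k, l]) + 1 * DDR x (b # map ((!) [a, i, j, k, l]) [0,1,2,4,3])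
      + 0 * DDR x (b # map ((!) [a, i, j, k, l]) [0,1,2,4,3]) = 0" for i j k l
    by (rule nabla2_curvature_relation[OF x]) (auto simp: s5 K2 simp del: nabla.simps dest!: list5)
  moreover have "DDR x (b # [a, i, j, k, l]) + 1 * DDR x (b # map ((!) [a, i, j, k, l]) [0,2,3,1,4])
      + 1 * DDR x (b # map ((!) [a, i, j, k, l]) [0,3,1,2,4]) = 0" for i j k l
    by (rule nabla2_curvature_relation[OF x]) (auto simp: s5 K3 simp del: nabla.simps dest!: list5)
  ultimately show ?thesis unfolding curvature_like_def by (simp del: nabla.simps)
qed

lemma bianchi2_DDR:
  assumes x: "x \<in> S"
  shows "DDR x [b, a, i, j, k, l] + DDR x [b, i, j, a, k, l] + DDR x [b, j, a, i, k, l] = 0"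
proof -
  have s5: "{..<5} = {0, 1, 2, 3, 4 :: nat}" by auto
  have "DDR x (b # [a, i, j, k, l]) + 1 * DDR x (b # map ((!) [a, i, j, k, l]) [1,2,0,3,4])
      + 1 * DDR x (b # map ((!) [a, i, j, k, l]) [2,0,1,3,4]) = 0"
    by (rule nabla2_curvature_relation[OF x]) (auto simp: s5 bianchi2 simp del: nabla.simps dest!: list5)
  then show ?thesis by (simp del: nabla.simps)
qed

end

section \<open>Polarization\<close>

lemma sum_axis: "(\<Sigma> a. (axis i 1 :: real^'n::finite) $ a * q a) = (q i :: real)"
  by (simp add: axis_def if_distrib[of "\<lambda>z. z * _"] cong: if_cong)

text \<open>A form of degree \<open>d\<close> that vanishes on the diagonal has vanishing symmetrization. The linear part of
  the form in one direction is isolated by finite differences; it is a form of degree \<open>d - 1\<close> in the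
  remaining argument.\<close>

lemma polarize_quadratic:
  fixes K :: "'n::finite \<Rightarrow> 'n \<Rightarrow> real"
  assumes "\<And>v::real^'n. (\<Sigma> a. v $ a * (\<Sigma> b. v $ b * K a b)) = 0"
  shows "K a b + K b a = 0"
proof -
  define Q where "Q v w = (\<Sigma> a. v $ a * (\<Sigma> b. w $ b * K a b))" for v w :: "real^'n"
  have add: "Q (x + y) b = Q x b + Q y b" "Q a (x + y) = Q a x + Q a y" for x y a b
    unfolding Q_def by (simp_all add: distrib_left distrib_right sum.distrib)
  have "Q (axis a 1 + axis b 1) (axis a 1 + axis b 1) = 0" "Q (axis a 1) (axis a 1) = 0" "Q (axis b 1) (axis b 1) = 0"
    unfolding Q_def by (rule assms)+
  then have "Q (axis a 1) (axis b 1) + Q (axis b 1) (axis a 1) = 0" by (simp add: add)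
  then show ?thesis by (simp add: Q_def sum_axis)
qed

lemma polarize_cubic:
  fixes K :: "'n::finite \<Rightarrow> 'n \<Rightarrow> 'n \<Rightarrow> real"
  assumes "\<And>v::real^'n. (\<Sigma> a. v $ a * (\<Sigma> b. v $ b * (\<Sigma> c. v $ c * K a b c))) = 0"
  shows "K a b c + K a c b + K b a c + K b c a + K c a b + K c b a = 0"
proof -
  define Q where "Q u v w = (\<Sigma> a. u $ a * (\<Sigma> b. v $ b * (\<Sigma> c. w $ c * K a b c)))" for u v w :: "real^'n"
  have add: "Q (x + y) b c = Q x b c + Q y b c" "Q a (x + y) c = Q a x c + Q a y c" "Q a b (x + y) = Q a b x + Q a b y"
    for x y a b c
    unfolding Q_def by (simp_all add: distrib_left distrib_right sum.distrib)
  have diff: "Q (x - y) b c = Q x b c - Q y b c" "Q a (x - y) c = Q a x c - Q a y c" "Q a b (x - y) = Q a b x - Q a b y"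
    for x y a b c
    unfolding Q_def by (simp_all add: right_diff_distrib left_diff_distrib sum_subtractf)
  have Q0: "Q v v v = 0" for v unfolding Q_def by (rule assms)
  have lin: "Q w u u + Q u w u + Q u u w = 0" for u w
    using Q0[of "u + w"] Q0[of "u - w"] Q0[of u] Q0[of w] by (simp add: add diff)
  have "Q w u v + Q w v u + Q u w v + Q v w u + Q u v w + Q v u w = 0" for u v w
    using lin[of w "u + v"] lin[of w u] lin[of w v] by (simp add: add)
  from this[of "axis a 1" "axis b 1" "axis c 1"] show ?thesis by (simp add: Q_def sum_axis)
qed

lemma polarize_quartic:
  fixes K :: "'n::finite \<Rightarrow> 'n \<Rightarrow> 'n \<Rightarrow> 'n \<Rightarrow> real"
  assumes "\<And>v::real^'n. (\<Sigma> a. v $ a * (\<Sigma> b. v $ b * (\<Sigma> c. v $ c * (\<Sigma> d. v $ d * K a b c d)))) = 0"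
  shows "K a b c d + K a b d c + K a c b d + K a c d b + K a d b c + K a d c b
       + K b a c d + K b a d c + K b c a d + K b c d a + K b d a c + K b d c a
       + K c a b d + K c a d b + K c b a d + K c b d a + K c d a b + K c d b a
       + K d a b c + K d a c b + K d b a c + K d b c a + K d c a b + K d c b a = 0"
proof -
  define Q where "Q t u v w = (\<Sigma> a. t $ a * (\<Sigma> b. u $ b * (\<Sigma> c. v $ c * (\<Sigma> d. w $ d * K a b c d))))"
    for t u v w :: "real^'n"
  have add: "Q (x + y) b c d = Q x b c d + Q y b c d" "Q a (x + y) c d = Q a x c d + Q a y c d"
    "Q a b (x + y) d = Q a b x d + Q a b y d" "Q a b c (x + y) = Q a b c x + Q a b c y" for x y a b c d
    unfolding Q_def by (simp_all add: distrib_left distrib_right sum.distrib)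
  have diff: "Q (x - y) b c d = Q x b c d - Q y b c d" "Q a (x - y) c d = Q a x c d - Q a y c d"
    "Q a b (x - y) d = Q a b x d - Q a b y d" "Q a b c (x - y) = Q a b c x - Q a b c y" for x y a b c d
    unfolding Q_def by (simp_all add: right_diff_distrib left_diff_distrib sum_subtractf)
  have scale: "Q (s *\<^sub>R x) b c d = s * Q x b c d" "Q a (s *\<^sub>R x) c d = s * Q a x c d"
    "Q a b (s *\<^sub>R x) d = s * Q a b x d" "Q a b c (s *\<^sub>R x) = s * Q a b c x" for s x a b c d
    unfolding Q_def by (simp_all add: sum_distrib_left mult_ac)
  have Q0: "Q v v v v = 0" for v unfolding Q_def by (rule assms)
  \<comment> \<open>The difference \<open>Q(u + s w) - Q(u - s w)\<close> is odd in \<open>s\<close>; \<open>s = 1\<close> and \<open>s = 2\<close> separate its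
    linear from its cubic part.\<close>
  have "Q w u u u + Q u w u u + Q u u w u + Q u u u w + (Q u w w w + Q w u w w + Q w w u w + Q w w w u) = 0" for u w
    using Q0[of "u + w"] Q0[of "u - w"] by (simp add: add diff)
  note odd = this
  have lin: "Q w u u u + Q u w u u + Q u u w u + Q u u u w = 0" for u w
    using odd[of w u] odd[of "2 *\<^sub>R w" u] by (simp add: scale)
  have bil: "Q w z u u + Q w u z u + Q w u u z + Q z w u u + Q u w z u + Q u w u z
     + Q z u w u + Q u z w u + Q u u w z + Q z u u w + Q u z u w + Q u u z w = 0" for u w z
    using lin[of w "u + z"] lin[of w "u - z"] lin[of w u] lin[of w z] by (simp add: add diff)
  have "Q w z u v + Q w z v u + Q w u z v + Q w v z u + Q w u v z + Q w v u z
     + Q z w u v + Q z w v u + Q u w z v + Q v w z u + Q u w v z + Q v w u z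
     + Q z u w v + Q z v w u + Q u z w v + Q v z w u + Q u v w z + Q v u w z
     + Q z u v w + Q z v u w + Q u z v w + Q v z u w + Q u v z w + Q v u z w = 0" for u v w z
    using bil[of w z "u + v"] bil[of w z u] bil[of w z v] by (simp add: add)
  from this[of "axis a 1" "axis b 1" "axis c 1" "axis d 1"] show ?thesis by (simp add: Q_def sum_axis)
qed

section \<open>The pointwise identity on an Einstein manifold\<close>

context metric_on
begin

definition tr :: "real^'n \<Rightarrow> ('n \<Rightarrow> 'n \<Rightarrow> real) \<Rightarrow> real" where
  "tr x f = (\<Sigma> p q. h x p q * f p q)"

lemma tr_add: "tr x (\<lambda>p q. f p q + k p q) = tr x f + tr x k"
  unfolding tr_def by (simp add: distrib_left sum.distrib)

lemma tr_diff: "tr x (\<lambda>p q. f p q - k p q) = tr x f - tr x k"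
  unfolding tr_def by (simp add: right_diff_distrib sum_subtractf)

lemma tr_minus: "tr x (\<lambda>p q. - f p q) = - tr x f"
  unfolding tr_def by (simp add: sum_negf)

lemma tr_cmult: "tr x (\<lambda>p q. c * f p q) = c * tr x f"
  unfolding tr_def by (simp add: sum_distrib_left mult_ac)

lemma tr_zero: "tr x (\<lambda>p q. 0) = 0"
  unfolding tr_def by simp

lemmas tr_linear = tr_add tr_diff tr_minus tr_cmult tr_zero

lemma tr_flip: "x \<in> S \<Longrightarrow> tr x (\<lambda>p q. f q p) = tr x f"
  unfolding tr_def by (subst sum.swap) (simp add: h_sym)

lemma tr_antisym:
  assumes x: "x \<in> S" and f: "\<And>p q. f q p = - f p q"
  shows "tr x f = 0"
proof -
  have "tr x (\<lambda>p q. f q p) = tr x (\<lambda>p q. - f p q)"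
    by (intro arg_cong[where f = "tr x"] ext f)
  then have "tr x f = - tr x f"
    unfolding tr_flip[OF x, of f] tr_minus .
  then show ?thesis by simp
qed

lemma tr_g_left:
  assumes x: "x \<in> S"
  shows "tr x (\<lambda>p q. g x p i * f q) = f i"
proof -
  have "tr x (\<lambda>p q. g x p i * f q) = (\<Sigma> p q. f q * h x q p * g x p i)"
    unfolding tr_def using h_sym[OF x] by (simp add: mult_ac)
  then show ?thesis using contract_hg[OF x] by simp
qed

lemma tr_g_right:
  assumes x: "x \<in> S"
  shows "tr x (\<lambda>p q. g x i p * f q) = f i"
  unfolding g_sym[OF x, of i] by (rule tr_g_left[OF x])

lemma tr_g:
  assumes x: "x \<in> S"
  shows "tr x (\<lambda>p q. g x p q) = real CARD('n)"
proof -
  have "tr x (\<lambda>p q. g x p q) = (\<Sigma> p q. h x p q * g x q p)"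
    unfolding tr_def using g_sym[OF x] by (intro sum.cong refl) simp
  then show ?thesis by (simp add: hg[OF x])
qed

lemma tr_curvature:
  assumes x: "x \<in> S"
  shows "tr x (\<lambda>p q. curvature G x [p, j, k, q]) = ricci G x j k"
proof -
  have "tr x (\<lambda>p q. curvature G x [p, j, k, q])
      = (\<Sigma> p q m. curvature_op G x m p j k * g x m q * h x q p)"
    unfolding tr_def curvature4 using h_sym[OF x] by (simp add: sum_distrib_left mult_ac)
  also have "\<dots> = (\<Sigma> p. curvature_op G x p p j k)"
    by (simp add: contract_gh[OF x])
  finally show ?thesis by (simp add: ricci_def)
qed

lemma tr_nabla:
  assumes x: "x \<in> S" and T: "\<And>is. smooth_on (\<lambda>y. T y is) S"
    and zero: "\<And>y js. y \<in> S \<Longrightarrow> length js = length is \<Longrightarrow> tr y (\<lambda>p q. T y (p # q # js)) = 0"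
  shows "tr x (\<lambda>p q. nabla G T x (a # p # q # is)) = 0"
proof -
  have "tr x (\<lambda>p q. nabla G T x (a # p # q # is))
     = nabla G (\<lambda>y is. \<Sigma> p q. h y p q * T y (p # q # is)) x (a # is)"
    unfolding tr_def using nabla_contract[OF x, of T a "is"] smooth_on_differentiable[OF T x] by presburger
  also have "\<dots> = nabla G (\<lambda>y is. 0) x (a # is)"
    by (rule nabla_cong[OF open_S x]) (use zero in \<open>simp add: tr_def\<close>)
  finally show ?thesis by simp
qed

lemma nabla_g:
  assumes x: "x \<in> S"
  shows "nabla G (\<lambda>y js. k * g y (js ! 0) (js ! 1)) x [a, i, j] = 0"
proof -
  have "pd a (\<lambda>y. k * g y i j) x = k * (\<Gamma>1 x a i j + \<Gamma>1 x a j i)"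
    using pd_g[OF x, of a i j] smooth_on_differentiable[OF smooth_g x] by (simp add: pd_cmult)
  moreover have "(\<Sigma> m. \<Gamma> x m a i * (k * g x m j)) = k * \<Gamma>1 x a i j"
    unfolding \<Gamma>1_def sum_distrib_left by (simp only: mult.left_commute)
  moreover have "(\<Sigma> m. \<Gamma> x m a j * (k * g x i m)) = k * \<Gamma>1 x a j i"
    unfolding \<Gamma>1_def sum_distrib_left g_sym[OF x, of i] by (simp only: mult.left_commute)
  ultimately show ?thesis by (simp add: distrib_left)
qed

end

locale einstein_on = metric_on +
  fixes r :: real
  assumes ricci: "x \<in> S \<Longrightarrow> ricci G x i j = r * G x $ i $ j"
begin

lemma tr_curvature_einstein: "x \<in> S \<Longrightarrow> tr x (\<lambda>p q. curvature G x [p, j, k, q]) = r * g x j k"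
  by (simp add: tr_curvature ricci)

text \<open>The Ricci tensor is a constant multiple of the parallel metric, and traces commute with \<open>\<nabla>\<close>.\<close>

lemma tr_DR:
  assumes x: "x \<in> S"
  shows "tr x (\<lambda>p q. DR x [a, p, j, k, q]) = 0"
proof -
  let ?T = "\<lambda>y is. curvature G y (map ((!) is) [0, 2, 3, 1])"
  have s4: "{..<4} = {0, 1, 2, 3 :: nat}" by auto
  have "nabla G ?T x (a # [p, q, j, k]) = DR x (a # map ((!) [p, q, j, k]) [0, 2, 3, 1])" for p q
    by (rule nabla_permute) (auto simp: s4)
  then have perm: "nabla G ?T x (a # p # q # [j, k]) = DR x [a, p, j, k, q]" for p q
    by (simp del: nabla.simps)
  have "tr x (\<lambda>p q. DR x [a, p, j, k, q])
     = nabla G (\<lambda>y is. \<Sigma> p q. h y p q * ?T y (p # q # is)) x (a # [j, k])"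
    using nabla_contract[OF x, of ?T a "[j, k]"] smooth_on_differentiable[OF smooth_curvature x]
    unfolding perm tr_def by presburger
  also have "\<dots> = nabla G (\<lambda>y js. r * g y (js ! 0) (js ! 1)) x (a # [j, k])"
  proof (rule nabla_cong[OF open_S x])
    fix y and js :: "'a list" assume y: "y \<in> S" and "length js = length [j, k]"
    then obtain b d where "js = [b, d]" by (auto simp: length_Suc_conv)
    then show "(\<Sigma> p q. h y p q * ?T y (p # q # js)) = r * g y (js ! 0) (js ! 1)"
      using tr_curvature_einstein[OF y, of b d] by (simp add: tr_def numeral_eq_Suc)
  qed
  finally show ?thesis using nabla_g[OF x] by simp
qed

text \<open>The contracted second Bianchi identity: an Einstein metric has divergence free curvature.\<close>

lemma div_DR:
  assumes x: "x \<in> S"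
  shows "tr x (\<lambda>p q. DR x [p, q, i, j, k]) = 0"
proof -
  note K = curvature_like_DR[OF x]
  have "DR x [p, q, i, j, k] = DR x [k, p, j, i, q] - DR x [j, p, k, i, q]" for p q
    using bianchi2[OF x, of j p k i q] curvature_like_antisym12[OF K, of k j p i q]
      curvature_like_pair[OF K, of p i q k j] curvature_like_antisym12[OF K, of p i q k j]
      curvature_like_antisym34[OF K, of p q i j k]
    by linarith
  then show ?thesis using tr_DR[OF x] by (simp add: tr_linear del: nabla.simps)
qed

lemma tr_DDR:
  assumes x: "x \<in> S"
  shows "tr x (\<lambda>p q. DDR x [b, a, p, j, k, q]) = 0"
proof -
  let ?T = "\<lambda>y is. DR y (map ((!) is) [2, 0, 3, 4, 1])"
  have s5: "{..<5} = {0, 1, 2, 3, 4 :: nat}" by auto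
  have "nabla G ?T x (b # [p, q, a, j, k]) = DDR x (b # map ((!) [p, q, a, j, k]) [2, 0, 3, 4, 1])" for p q
    by (rule nabla_permute) (auto simp: s5)
  then have perm: "nabla G ?T x (b # p # q # [a, j, k]) = DDR x [b, a, p, j, k, q]" for p q
    by (simp del: nabla.simps)
  have "tr x (\<lambda>p q. nabla G ?T x (b # p # q # [a, j, k])) = 0"
  proof (rule tr_nabla[OF x smooth_DR])
    fix y and js :: "'a list" assume y: "y \<in> S" and "length js = length [a, j, k]"
    then obtain d e f where "js = [d, e, f]" by (auto simp: length_Suc_conv)
    then show "tr y (\<lambda>p q. ?T y (p # q # js)) = 0"
      using tr_DR[OF y, of d e f] by (simp del: nabla.simps add: numeral_eq_Suc)
  qed
  then show ?thesis unfolding perm .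
qed

lemma div_DDR:
  assumes x: "x \<in> S"
  shows "tr x (\<lambda>p q. DDR x [b, p, q, i, j, k]) = 0"
proof (rule tr_nabla[OF x smooth_DR])
  fix y and js :: "'a list" assume y: "y \<in> S" and "length js = length [i, j, k]"
  then obtain d e f where "js = [d, e, f]" by (auto simp: length_Suc_conv)
  then show "tr y (\<lambda>p q. DR y (p # q # js)) = 0"
    using div_DR[OF y, of d e f] by simp
qed

end

context einstein_on
begin

text \<open>The heart of the first assertion. Notation in the proof: \<open>K\<close> is the tensor whose quartic form
  vanishes, \<open>L\<close> is the Laplacian of the curvature, and \<open>E\<close> is the trace of the outer derivative index
  with the first index of \<open>R\<close>. The facts \<open>t1\<close> to \<open>t7\<close> and \<open>r0\<close> to \<open>r3\<close> evaluate all traces that occur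
  when two polarized slots are traced (\<open>I\<close>), or one polarized slot against the index \<open>i\<close> (\<open>II\<close>). The
  second Bianchi identity gives \<open>III\<close>, the first one \<open>IV\<close>.\<close>

theorem laplacian_of_quartic:
  fixes k :: real
  assumes x: "x \<in> S"
    and hyp: "\<And>(v :: real^'a) i j. (\<Sigma> a. v $ a * (\<Sigma> b. v $ b * (\<Sigma> c. v $ c * (\<Sigma> d. v $ d *
      (DDR x [a, b, i, c, d, j] - k * (g x a b * curvature G x [i, c, d, j])))))) = 0"
  shows "tr x (\<lambda>p q. DDR x [p, q, i, j, l, m]) = (real CARD('a) + 4) * k / 2 * curvature G x [i, j, l, m]"
proof -
  define N where "N a b i j k l = DDR x [a, b, i, j, k, l]" for a b i j k l
  define R where "R i j k l = curvature G x [i, j, k, l]" for i j k l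
  define K where "K i j a b c d = N a b i c d j - k * (g x a b * R i c d j)" for i j a b c d
  define L where "L i j k l = tr x (\<lambda>p q. N p q i j k l)" for i j k l
  define E where "E a i j k = tr x (\<lambda>p q. N p a q i j k)" for a i j k
  define n where "n = real CARD('a)"
  have tr0: "tr x f = 0" if "\<And>p q. f p q = 0" for f unfolding tr_def using that by simp
  have n: "n > 0" unfolding n_def by simp
  note pol = polarize_quartic[of "K _ _", unfolded K_def N_def R_def, OF hyp, folded N_def R_def, folded K_def]

  have cN: "curvature_like (N a b)" for a b
    unfolding N_def[abs_def] by (rule curvature_like_DDR[OF x])
  have cR: "curvature_like R"
    unfolding R_def[abs_def] by (rule curvature_like_curvature[OF x])
  note N12 = curvature_like_antisym12[OF cN] and N34 = curvature_like_antisym34[OF cN]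
    and Np = curvature_like_pair[OF cN] and Nc = curvature_like_cyclic[OF cN]
  note R12 = curvature_like_antisym12[OF cR] and R34 = curvature_like_antisym34[OF cR]
    and Rp = curvature_like_pair[OF cR]

  have cL: "curvature_like L"
    unfolding curvature_like_def
  proof (intro conjI allI)
    show "L i j k l + L j i k l = 0" for i j k l
      using tr_add[of x "\<lambda>p q. N p q i j k l" "\<lambda>p q. N p q j i k l"] N12[of _ _ j i k l]
      by (simp add: L_def tr_linear)
    show "L i j k l + L i j l k = 0" for i j k l
      using tr_add[of x "\<lambda>p q. N p q i j k l" "\<lambda>p q. N p q i j l k"] N34[of _ _ i j l k]
      by (simp add: L_def tr_linear)
    show "L i j k l + L j k i l + L k i j l = 0" for i j k l
      unfolding L_def tr_add[symmetric] Nc tr_zero ..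
  qed

  have B2: "tr x (\<lambda>p q. N b p q i j k) = 0" for b i j k
    unfolding N_def by (rule div_DDR[OF x])
  have A2: "tr x (\<lambda>p q. N a b p i j q) = 0" for a b i j
    unfolding N_def by (rule tr_DDR[OF x])
  have A2': "tr x (\<lambda>p q. N a b q i j p) = 0" for a b i j
    using tr_flip[OF x, of "\<lambda>p q. N a b p i j q"] A2 by simp

  have t1: "tr x (\<lambda>p q. N p u i q w j) = - E u i w j" for u i w j
    unfolding E_def tr_minus[symmetric] by (intro arg_cong[where f = "tr x"] ext N12)
  have t2: "tr x (\<lambda>p q. N p u i w q j) = E u j i w" for u i w j
    unfolding E_def by (intro arg_cong[where f = "tr x"] ext Np[symmetric])
  have t3: "tr x (\<lambda>p q. N u p i q w j) = 0" for u i w j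
  proof -
    have "tr x (\<lambda>p q. N u p i q w j) = - tr x (\<lambda>p q. N u p q i w j)"
      unfolding tr_minus[symmetric] by (intro arg_cong[where f = "tr x"] ext N12)
    then show ?thesis using B2 by simp
  qed
  have t4: "tr x (\<lambda>p q. N u p i w q j) = 0" for u i w j
  proof -
    have "tr x (\<lambda>p q. N u p i w q j) = tr x (\<lambda>p q. N u p q j i w)"
      by (intro arg_cong[where f = "tr x"] ext Np[symmetric])
    then show ?thesis using B2 by simp
  qed
  have t5: "tr x (\<lambda>p q. N u w i p q j) = 0" for u i w j
  proof -
    have "tr x (\<lambda>p q. N u w i p q j) = tr x (\<lambda>p q. N u w q j i p)"
      by (intro arg_cong[where f = "tr x"] ext Np[symmetric])
    then show ?thesis using A2' by simp
  qed
  have t6: "tr x (\<lambda>p q. N u v q p w j) = 0" for u v w j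
    by (rule tr_antisym[OF x]) (rule N12)
  have t7: "tr x (\<lambda>p q. N u v q w p j) = 0" for u v w j
  proof -
    have "tr x (\<lambda>p q. N u v q w p j) = - tr x (\<lambda>p q. N u v q w j p)"
      unfolding tr_minus[symmetric] by (intro arg_cong[where f = "tr x"] ext N34)
    then show ?thesis using A2' by simp
  qed
  have r0: "tr x (\<lambda>p q. R p i j q) = r * g x i j" for i j
    unfolding R_def by (rule tr_curvature_einstein[OF x])
  have r0': "tr x (\<lambda>p q. R q i j p) = r * g x i j" for i j
    using tr_flip[OF x, of "\<lambda>p q. R p i j q"] r0 by simp
  have r1: "tr x (\<lambda>p q. R i p q j) = r * g x i j" for i j
  proof -
    have "tr x (\<lambda>p q. R i p q j) = tr x (\<lambda>p q. R q j i p)"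
      by (intro arg_cong[where f = "tr x"] ext Rp[symmetric])
    then show ?thesis using r0' g_sym[OF x, of i j] by simp
  qed
  have r2: "tr x (\<lambda>p q. R q p w j) = 0" for w j
    by (rule tr_antisym[OF x]) (rule R12)
  have r3: "tr x (\<lambda>p q. R q w p j) = - (r * g x w j)" for w j
  proof -
    have "tr x (\<lambda>p q. R q w p j) = - tr x (\<lambda>p q. R q w j p)"
      unfolding tr_minus[symmetric] by (intro arg_cong[where f = "tr x"] ext R34)
    then show ?thesis using r0' by simp
  qed
  have trn: "tr x (\<lambda>p q. g x p q * f) = n * f" for f
    using tr_cmult[of x f "\<lambda>p q. g x p q"] tr_g[OF x] unfolding n_def by (simp add: mult.commute)
  note gl = tr_g_left[OF x] and gr = tr_g_right[OF x]
  note trs = tr_add tr_diff tr_cmult t1 t2 t3 t4 t5 t6 t7 r0 r1 r2 r3 trn gl gr A2 B2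
    L_def[symmetric] E_def[symmetric]

  \<comment> \<open>Tracing the identity completely: a multiple of the scalar curvature vanishes.\<close>
  have kr: "k * r = 0"
  proof -
    have KK: "tr x (\<lambda>i j. K i j a b c d) = - (k * (g x a b * (r * g x c d)))" for a b c d
      unfolding K_def trs by simp
    have "k * r * (g x a b * g x c d + g x a c * g x b d + g x a d * g x b c) = 0" for a b c d
    proof -
      have "tr x (\<lambda>i j. K i j a b c d + K i j a b d c + K i j a c b d + K i j a c d b + K i j a d b c + K i j a d c b
       + K i j b a c d + K i j b a d c + K i j b c a d + K i j b c d a + K i j b d a c + K i j b d c a
       + K i j c a b d + K i j c a d b + K i j c b a d + K i j c b d a + K i j c d a b + K i j c d b a
       + K i j d a b c + K i j d a c b + K i j d b a c + K i j d b c a + K i j d c a b + K i j d c b a) = 0"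
        unfolding pol tr_zero ..
      then show ?thesis unfolding tr_add KK
        using g_sym[OF x, of a b] g_sym[OF x, of a c] g_sym[OF x, of a d] g_sym[OF x, of b c]
          g_sym[OF x, of b d] g_sym[OF x, of c d]
        by (simp add: algebra_simps)
    qed
    then have "tr x (\<lambda>a b. k * r * (g x a b * g x c d + (g x a c * g x b d + g x a d * g x b c))) = 0" for c d
      by (intro tr0) (simp only: add.assoc)
    then have "k * r * (n * g x c d + (g x c d + g x d c)) = 0" for c d
      unfolding trs .
    then have "k * r * (n + 2) * g x c d = 0" for c d
    proof -
      have "n * g x c d + (g x c d + g x d c) = (n + 2) * g x c d"
        using g_sym[OF x, of d c] by (simp add: distrib_right)
      then show ?thesis
        using \<open>\<And>d c. k * r * (n * g x c d + (g x c d + g x d c)) = 0\<close>[of c d] by (simp only: mult.assoc)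
    qed
    then have "tr x (\<lambda>c d. k * r * (n + 2) * g x c d) = 0"
      by (rule tr0)
    then have "k * r * (n + 2) * n = 0"
      unfolding tr_cmult tr_g[OF x] n_def by simp
    then show ?thesis using n by simp
  qed
  then have kr': "k = 0 \<or> r = 0" by simp

  have I: "L i u w j + L i w u j - E u i w j - E w i u j + E u j i w + E w j i u
     = k * (n + 4) * (R i u w j + R i w u j)" for i u w j
  proof -
    \<comment> \<open>Half of the 24 terms, those in which \<open>p\<close> precedes \<open>q\<close>; the others have the same trace.\<close>
    define H where "H p q = K i j p q u w + K i j p q w u + K i j p u q w + K i j p w q u + K i j p u w q + K i j p w u q
      + K i j u p q w + K i j w p q u + K i j u p w q + K i j w p u q + K i j u w p q + K i j w u p q" for p q
    have "H p q + H q p = 0" for p q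
      using pol[of i j p q u w] unfolding H_def by linarith
    then have "tr x (\<lambda>p q. H p q + H q p) = 0" by (rule tr0)
    then have "tr x (\<lambda>p q. H p q) = 0"
      using tr_flip[OF x, of H] unfolding tr_add by simp
    then show ?thesis unfolding H_def K_def trs
      using kr' by (auto simp: algebra_simps)
  qed
  have II: "E u v w j + E u w v j + E v u w j + E v w u j + E w u v j + E w v u j = 0" for u v w j
  proof -
    \<comment> \<open>The four positions of the traced argument \<open>p\<close>.\<close>
    define H where "H u v w p q = K q j p u v w + K q j u p v w + K q j u v p w + K q j u v w p" for u v w p q
    have trH: "tr x (\<lambda>p q. H u v w p q) = E u v w j - k * (2 * R u v w j)" for u v w
      unfolding H_def K_def trs using kr' by (auto simp: algebra_simps)
    have "tr x (\<lambda>p q. H u v w p q + H u w v p q + H v u w p q + H v w u p q + H w u v p q + H w v u p q) = tr x (\<lambda>p q. 0)"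
      by (intro arg_cong[where f = "tr x"] ext) (use pol in \<open>simp add: H_def algebra_simps\<close>)
    then have "E u v w j + E u w v j + E v u w j + E v w u j + E w u v j + E w v u j
      - k * 2 * (R u v w j + R u w v j + R v u w j + R v w u j + R w u v j + R w v u j) = 0"
      unfolding tr_add trH tr_zero by (simp add: algebra_simps)
    then show ?thesis using R12[of v u w j] R12[of w u v j] R12[of w v u j] by simp
  qed
  have III: "E u i w j = E i u w j - L i u w j" for u i w j
  proof -
    have "N p u q i w j + N p q i u w j - N p i q u w j = 0" for p q
      using bianchi2_DDR[OF x, of p u q i w j] N12[of p i u q w j] unfolding N_def[symmetric] by simp
    then have "tr x (\<lambda>p q. N p u q i w j + N p q i u w j - N p i q u w j) = 0"
      by (rule tr0)
    then show ?thesis unfolding trs by simp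
  qed
  have IV: "E a i c d + E a d i c - E a c i d = 0" for a i c d
  proof -
    have "N p a q i c d + N p a q d i c - N p a q c i d = 0" for p q
      using Nc[of p a q i c d] Np[of p a q d i c] N12[of p a c q i d] by simp
    then have "tr x (\<lambda>p q. N p a q i c d + N p a q d i c - N p a q c i d) = 0"
      by (rule tr0)
    then show ?thesis unfolding trs by simp
  qed
  have V: "E a i d c = - E a i c d" for a i c d
    unfolding E_def tr_minus[symmetric] by (intro arg_cong[where f = "tr x"] ext N34)

  have Lrev: "L j u w i = L i w u j" for i j u w
    using curvature_like_pair[OF cL, of j u w i] curvature_like_antisym12[OF cL, of w i j u]
      curvature_like_antisym34[OF cL, of i w j u] by linarith
  \<comment> \<open>Polarized form of \<open>3 E(i;u,u,j) - E(j;u,u,i) = L(i,u,u,j)\<close>. Exchanging \<open>i\<close> and \<open>j\<close> yields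
    \<open>E(i;u,u,j) = L(i,u,u,j) / 2\<close>.\<close>
  define F where "F i j u w = E i u w j + E i w u j" for i j u w
  have F1: "3 * F i j u w - F j i u w = L i u w j + L i w u j" for i j u w
    using II[of i u w j] III[of u i w j] III[of w i u j]
      IV[of u w i j] III[of u j w i] IV[of w u i j] III[of w j u i]
      Lrev[of j u w i] Lrev[of j w u i]
    unfolding F_def by argo
  have Q: "L i u w j + L i w u j = (n + 4) * k / 2 * (R i u w j + R i w u j)" for i u w j
  proof -
    have "L j u w i + L j w u i = L i u w j + L i w u j"
      using Lrev[of j u w i] Lrev[of j w u i] by linarith
    then have "2 * (L i u w j + L i w u j) = k * (n + 4) * (R i u w j + R i w u j)"
      using F1[of i j u w] F1[of j i u w] I[of i u w j] III[of u i w j] III[of w i u j]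
        V[of u j w i] III[of u j w i] V[of w j u i] III[of w j u i]
      unfolding F_def by argo
    then show ?thesis by (simp add: field_simps)
  qed
  have "L i u w j - (n + 4) * k / 2 * R i u w j + (L i w u j - (n + 4) * k / 2 * R i w u j) = 0" for i u w j
    using Q[of i u w j] unfolding distrib_left by linarith
  from curvature_like_zero[OF curvature_like_diff_scale[OF cL cR, of "(n + 4) * k / 2"] this]
  have "L i j l m - (n + 4) * k / 2 * R i j l m = 0" .
  then show ?thesis unfolding L_def N_def R_def n_def by simp
qed

end

section \<open>The rough Laplacian and the Jacobi operator\<close>

context metric_on
begin

text \<open>If \<open>F\<close> is the matrix of the frame and \<open>D\<close> the diagonal matrix of signs, then \<open>F\<^sup>T G F = D\<close> and
  \<open>D\<^sup>2 = 1\<close>, so \<open>G\<close> has the inverse \<open>F D F\<^sup>T\<close>.\<close>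

lemma frame_inverse_metric:
  assumes x: "x \<in> S" and e: "orthonormal_frame G x e"
  shows "(\<Sigma> i. gprod G x (e i) (e i) * (e i $ a * e i $ b)) = h x a b"
proof -
  define \<epsilon> where "\<epsilon> i = gprod G x (e i) (e i)" for i
  define F :: "real^'n^'n" where "F = (\<chi> a i. e i $ a)"
  define D :: "real^'n^'n" where "D = (\<chi> i j. if i = j then \<epsilon> i else 0)"
  have eps: "\<epsilon> i * \<epsilon> i = 1" for i
    using e unfolding orthonormal_frame_def \<epsilon>_def by (metis insert_iff mult_1 mult_minus1 minus_minus singletonD)
  have FGF: "transpose F ** (G x ** F) = D"
  proof -
    have "(transpose F ** (G x ** F)) $ i $ j = gprod G x (e i) (e j)" for i j
      by (simp add: gprod_def F_def matrix_matrix_mult_def transpose_def inner_vec_def matrix_vector_mult_def)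
    then show ?thesis
      using e unfolding orthonormal_frame_def D_def \<epsilon>_def by (simp add: vec_eq_iff)
  qed
  have "(D ** D) $ i $ j = mat 1 $ i $ j" for i j
    by (simp add: D_def matrix_matrix_mult_def mat_def eps if_distrib[of "\<lambda>z. z * _"] cong: if_cong)
  then have "D ** D = mat 1" by (simp add: vec_eq_iff)
  then have "D ** (transpose F ** (G x ** F)) = mat 1" unfolding FGF .
  then have "(D ** (transpose F ** G x)) ** F = mat 1"
    by (simp add: matrix_mul_assoc)
  then have "F ** (D ** (transpose F ** G x)) = mat 1"
    by (simp add: matrix_left_right_inverse)
  then have "(F ** (D ** transpose F)) ** G x = mat 1"
    by (simp add: matrix_mul_assoc)
  then have "G x ** (F ** (D ** transpose F)) = mat 1"
    by (simp add: matrix_left_right_inverse)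
  then have "h x a b = (F ** (D ** transpose F)) $ a $ b"
    by (simp add: matrix_inv_eqI)
  also have "\<dots> = (\<Sigma> i. e i $ a * (\<epsilon> i * e i $ b))"
    by (simp add: F_def D_def matrix_matrix_mult_def transpose_def if_distrib[of "\<lambda>z. z * _"] cong: if_cong)
  finally show ?thesis by (simp add: \<epsilon>_def mult_ac)
qed

lemma rough_laplacian_eq_tr:
  assumes x: "x \<in> S" and e: "orthonormal_frame G x e"
  shows "rough_laplacian G e T x is = - tr x (\<lambda>a b. nabla G (nabla G T) x (a # b # is))"
proof -
  let ?N = "\<lambda>a b. nabla G (nabla G T) x (a # b # is)"
  have "(\<Sigma> i. gprod G x (e i) (e i) * (\<Sigma> a b. e i $ a * e i $ b * ?N a b))
     = (\<Sigma> i a b. gprod G x (e i) (e i) * (e i $ a * e i $ b) * ?N a b)"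
    unfolding sum_distrib_left by (simp only: mult.assoc)
  also have "\<dots> = (\<Sigma> a i b. gprod G x (e i) (e i) * (e i $ a * e i $ b) * ?N a b)"
    by (rule sum.swap)
  also have "\<dots> = (\<Sigma> a b i. gprod G x (e i) (e i) * (e i $ a * e i $ b) * ?N a b)"
    by (intro sum.cong refl sum.swap)
  also have "\<dots> = tr x ?N"
    unfolding tr_def sum_distrib_right[symmetric] frame_inverse_metric[OF x e] ..
  finally show ?thesis unfolding rough_laplacian_def by simp
qed

text \<open>The Jacobi operator in direction \<open>v\<close> and its first two covariant derivatives in that
  direction.\<close>

definition J0 where "J0 x v i j = (\<Sigma> a. v $ a * (\<Sigma> b. v $ b * curvature G x [i, a, b, j]))"
definition J1 where "J1 x v i j = (\<Sigma> c. v $ c * (\<Sigma> a. v $ a * (\<Sigma> b. v $ b * DR x [c, i, a, b, j])))"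
definition J2 where "J2 x v i j = (\<Sigma> d. v $ d * (\<Sigma> c. v $ c * (\<Sigma> a. v $ a * (\<Sigma> b. v $ b * DDR x [d, c, i, a, b, j]))))"

text \<open>If \<open>\<nabla>\<^sub>vR(x,v,v,y)\<close> vanishes for all \<open>v\<close>, then \<open>\<nabla>R = 0\<close>: for
  \<open>P(w;x,y) = \<nabla>\<^sub>wR(x,u,u,y)\<close>, polarization and the second Bianchi identity give
  \<open>3P(w;x,y) = P(x;w,y) + P(y;x,w)\<close>; summing cyclically shows that the cyclic sum vanishes, and
  then \<open>4P(w;x,y) = 0\<close>.\<close>

lemma DR_eq_zero:
  assumes x: "x \<in> S" and hyp: "\<And>v i j. J1 x v i j = 0"
  shows "DR x [m, i, j, k, l] = 0"
proof -
  define D where "D c i a b j = DR x [c, i, a, b, j]" for c i a b j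
  have cD: "curvature_like (D m)" for m
    unfolding D_def[abs_def] by (rule curvature_like_DR[OF x])
  define P where "P w i j u v = D w i u v j + D w i v u j" for w i j u v
  have rev: "D w j v u i = D w i u v j" for w i j u v
    using curvature_like_pair[OF cD, of w j v u i] curvature_like_antisym12[OF cD, of w u i j v]
      curvature_like_antisym34[OF cD, of w i u j v] by linarith
  have B: "D u i w v j = D w i u v j - D i w u v j" for u i w v j
    using bianchi2[OF x, of u i w v j] curvature_like_antisym12[OF cD, of w u i v j]
      curvature_like_antisym12[OF cD, of i u w v j] unfolding D_def[symmetric] by linarith
  have eq: "3 * P w i j u v = P i w j u v + P j i w u v" for w i j u v
  proof -
    have "D w i u v j + D w i v u j + D u i w v j + D u i v w j + D v i w u j + D v i u w j = 0"
      using polarize_cubic[of "\<lambda>c a b. D c i a b j" w u v] hyp[of _ i j] unfolding J1_def D_def by blast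
    then show ?thesis
      unfolding P_def using B[of u i w v j] B[of v i w u j]
        rev[of u i v w j] B[of u j w v i] rev[of w j u v i] rev[of j w u v i]
        rev[of v i u w j] B[of v j w u i] rev[of w j v u i] rev[of j w v u i] by argo
  qed
  have sym: "P w j i u v = P w i j u v" for w i j u v
    unfolding P_def using rev[of w j u v i] rev[of w j v u i] by linarith
  have "P w i j u v = 0" for w i j u v
    using eq[of w i j u v] eq[of i w j u v] eq[of j i w u v] sym[of i w j u v] sym[of w i j u v] sym[of j w i u v]
    by argo
  then have "D w i u v j + D w i v u j = 0" for w i u v j
    unfolding P_def .
  from curvature_like_zero[OF cD this] show ?thesis unfolding D_def .
qed

lemma J0_eq_zero:
  assumes x: "x \<in> S" and hyp: "\<And>v i j. J0 x v i j = 0"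
  shows "curvature G x [i, j, k, l] = 0"
  using curvature_like_zero[OF curvature_like_curvature[OF x]]
    polarize_quadratic[of "\<lambda>a b. curvature G x [_, a, b, _]"] hyp unfolding J0_def by blast

definition ip :: "real^'n \<Rightarrow> ('n \<Rightarrow> 'n \<Rightarrow> real) \<Rightarrow> ('n \<Rightarrow> 'n \<Rightarrow> real) \<Rightarrow> real" where
  "ip x A B = tr x (\<lambda>i k. tr x (\<lambda>j l. A i j * B k l))"

lemma ip_sym:
  assumes x: "x \<in> S" shows "ip x A B = ip x B A"
  unfolding ip_def
  by (subst (2) tr_flip[OF x, symmetric], subst (2) tr_flip[OF x, symmetric]) (simp add: mult.commute)

lemma ip_cmult: "ip x (\<lambda>i j. c * A i j) B = c * ip x A B"
  unfolding ip_def by (simp add: mult.assoc tr_cmult)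

end

section \<open>Tensors along a geodesic\<close>

locale geodesic_on = metric_on +
  fixes \<eta> :: "real \<Rightarrow> real^'a" and I :: "real set"
  assumes open_I: "open I" and range: "t \<in> I \<Longrightarrow> \<eta> t \<in> S"
    and diff_\<eta>: "t \<in> I \<Longrightarrow> \<eta> differentiable (at t)"
    and diff_v: "t \<in> I \<Longrightarrow> velocity \<eta> differentiable (at t)"
    and geodesic: "t \<in> I \<Longrightarrow> covd_vector G \<eta> (velocity \<eta>) t = 0"
begin

abbreviation (input) v where "v \<equiv> velocity \<eta>"

text \<open>The matrix of the connection along the curve.\<close>

definition C :: "real \<Rightarrow> 'a \<Rightarrow> 'a \<Rightarrow> real" where
  "C t m i = (\<Sigma> a. v t $ a * \<Gamma> (\<eta> t) m a i)"

lemma deriv_\<eta>: "t \<in> I \<Longrightarrow> (\<eta> has_vector_derivative v t) (at t)"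
  unfolding velocity_def using diff_\<eta> vector_derivative_works by blast

lemma deriv_v:
  assumes "t \<in> I"
  shows "((\<lambda>s. v s $ l) has_real_derivative - (\<Sigma> j. C t l j * v t $ j)) (at t)"
proof -
  have "(v has_vector_derivative vector_derivative v (at t)) (at t)"
    using diff_v[OF assms] vector_derivative_works by blast
  then have D: "((\<lambda>s. v s $ l) has_vector_derivative vector_derivative v (at t) $ l) (at t)"
    by (rule bounded_linear.has_vector_derivative[OF bounded_linear_vec_nth])
  have "vector_derivative v (at t) $ l + (\<Sigma> i j. \<Gamma> (\<eta> t) l i j * v t $ i * v t $ j) = 0"
    using geodesic[OF assms] unfolding covd_vector_def by (simp add: vec_eq_iff)
  moreover have "(\<Sigma> i j. \<Gamma> (\<eta> t) l i j * v t $ i * v t $ j) = (\<Sigma> j. C t l j * v t $ j)"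
    unfolding C_def sum_distrib_right by (subst sum.swap) (simp add: mult_ac)
  ultimately have "vector_derivative v (at t) $ l = - (\<Sigma> j. C t l j * v t $ j)" by simp
  with D show ?thesis by (simp add: has_real_derivative_iff_has_vector_derivative)
qed

text \<open>A covariant tensor field \<open>A\<close> of degree \<open>d\<close> along the curve has the covariant derivative \<open>D\<close>
  at \<open>t\<close>.\<close>

definition has_covd :: "nat \<Rightarrow> (real \<Rightarrow> 'a list \<Rightarrow> real) \<Rightarrow> ('a list \<Rightarrow> real) \<Rightarrow> real \<Rightarrow> bool" where
  "has_covd d A D t \<longleftrightarrow> (\<forall>is. length is = d \<longrightarrow> ((\<lambda>s. A s is) has_real_derivative
     D is + (\<Sum>p<d. \<Sigma> m. C t m (is ! p) * A t (is[p := m]))) (at t))"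

text \<open>The chain rule for the restriction of a tensor field to the curve.\<close>

lemma has_covd_field:
  assumes t: "t \<in> I" and T: "\<And>is. (\<lambda>y. T y is) differentiable (at (\<eta> t))"
  shows "has_covd d (\<lambda>s. T (\<eta> s)) (\<lambda>is. \<Sigma> a. v t $ a * nabla G T (\<eta> t) (a # is)) t"
  unfolding has_covd_def
proof (intro allI impI)
  fix "is" :: "'a list" assume len: "length is = d"
  have "(\<Sum>p<d. \<Sigma> m. C t m (is ! p) * T (\<eta> t) (is[p := m]))
     = (\<Sum>p<d. \<Sigma> a m. v t $ a * (\<Gamma> (\<eta> t) m a (is ! p) * T (\<eta> t) (is[p := m])))"
    unfolding C_def sum_distrib_right mult.assoc by (intro sum.cong refl sum.swap)
  also have "\<dots> = (\<Sigma> a. v t $ a * (\<Sum>p<d. \<Sigma> m. \<Gamma> (\<eta> t) m a (is ! p) * T (\<eta> t) (is[p := m])))"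
    unfolding sum_distrib_left by (rule sum.swap)
  finally have "(\<Sigma> a. v t $ a * nabla G T (\<eta> t) (a # is)) + (\<Sum>p<d. \<Sigma> m. C t m (is ! p) * T (\<eta> t) (is[p := m]))
     = (\<Sigma> a. v t $ a * pd a (\<lambda>y. T y is) (\<eta> t))"
    by (simp add: len right_diff_distrib sum_subtractf)
  then show "((\<lambda>s. T (\<eta> s) is) has_real_derivative (\<Sigma> a. v t $ a * nabla G T (\<eta> t) (a # is))
      + (\<Sum>p<d. \<Sigma> m. C t m (is ! p) * T (\<eta> t) (is[p := m]))) (at t)"
    using has_real_derivative_along[of "\<lambda>y. T y is" \<eta> t, OF T deriv_\<eta>[OF t]] by simp
qed

text \<open>The velocity of a geodesic is parallel, so that inserting it into a tensor commutes with
  covariant differentiation.\<close>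

lemma has_covd_insert:
  assumes t: "t \<in> I" and A: "has_covd (Suc d) A D t"
  shows "has_covd d (\<lambda>s is. \<Sigma> b. v s $ b * A s (b # is)) (\<lambda>is. \<Sigma> b. v t $ b * D (b # is)) t"
  unfolding has_covd_def
proof (intro allI impI)
  fix "is" :: "'a list" assume len: "length is = d"
  let ?W = "\<lambda>b. \<Sum>p<d. \<Sigma> m. C t m (is ! p) * A t (b # is[p := m])"
  have A': "((\<lambda>s. A s (b # is)) has_real_derivative
     D (b # is) + ((\<Sigma> m. C t m b * A t (m # is)) + ?W b)) (at t)" for b
    using A[unfolded has_covd_def, rule_format, of "b # is"] len
    by (simp add: sum.lessThan_Suc_shift del: sum.lessThan_Suc)
  have "((\<lambda>s. \<Sigma> b. v s $ b * A s (b # is)) has_real_derivative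
     (\<Sigma> b. - (\<Sigma> j. C t b j * v t $ j) * A t (b # is)
       + (D (b # is) + ((\<Sigma> m. C t m b * A t (m # is)) + ?W b)) * v t $ b)) (at t)"
    by (intro DERIV_sum DERIV_mult deriv_v[OF t] A')
  moreover have "(\<Sigma> b. (\<Sigma> j. C t b j * v t $ j) * A t (b # is))
      = (\<Sigma> b. (\<Sigma> m. C t m b * A t (m # is)) * v t $ b)"
    unfolding sum_distrib_right by (subst sum.swap) (simp add: mult_ac)
  moreover have "(\<Sum>p<d. \<Sigma> m. C t m (is ! p) * (\<Sigma> b. v t $ b * A t (b # is[p := m])))
      = (\<Sigma> b. ?W b * v t $ b)"
  proof -
    have "(\<Sigma> b. ?W b * v t $ b) = (\<Sum>p<d. \<Sigma> b m. C t m (is ! p) * A t (b # is[p := m]) * v t $ b)"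
      unfolding sum_distrib_right by (rule sum.swap)
    also have "\<dots> = (\<Sum>p<d. \<Sigma> m b. C t m (is ! p) * A t (b # is[p := m]) * v t $ b)"
      by (intro sum.cong refl sum.swap)
    finally show ?thesis by (simp add: sum_distrib_left mult_ac)
  qed
  ultimately show "((\<lambda>s. \<Sigma> b. v s $ b * A s (b # is)) has_real_derivative
      (\<Sigma> b. v t $ b * D (b # is)) + (\<Sum>p<d. \<Sigma> m. C t m (is ! p) *
        (\<Sigma> b. v t $ b * A t (b # is[p := m])))) (at t)"
    by (simp add: sum.distrib sum_negf sum_subtractf distrib_right mult.commute[of "v t $ _" "D _"])
qed

lemma covd_tensor_eq:
  assumes t: "t \<in> I" and A: "has_covd 2 A D t" and B: "\<And>s i j. s \<in> I \<Longrightarrow> B s i j = A s [i, j]"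
  shows "covd_tensor G \<eta> B t i j = D [i, j]"
proof -
  have "((\<lambda>s. A s [i, j]) has_real_derivative D [i, j]
     + ((\<Sigma> m. C t m i * A t [m, j]) + (\<Sigma> m. C t m j * A t [i, m]))) (at t)"
    using A[unfolded has_covd_def, rule_format, of "[i, j]"] by (simp add: numeral_eq_Suc)
  then have "((\<lambda>s. B s i j) has_real_derivative D [i, j]
     + ((\<Sigma> m. C t m i * A t [m, j]) + (\<Sigma> m. C t m j * A t [i, m]))) (at t)"
    using has_field_derivative_transform_within_open[of "\<lambda>s. A s [i, j]" _ t I "\<lambda>s. B s i j"] open_I t B by auto
  then have vd: "vector_derivative (\<lambda>s. B s i j) (at t) = D [i, j]
     + ((\<Sigma> m. C t m i * A t [m, j]) + (\<Sigma> m. C t m j * A t [i, m]))"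
    by (intro vector_derivative_at) (simp add: has_real_derivative_iff_has_vector_derivative)
  have "(\<Sigma> a m. v t $ a * (\<Gamma> (\<eta> t) m a i * B t m j + \<Gamma> (\<eta> t) m a j * B t i m))
     = (\<Sigma> m a. v t $ a * (\<Gamma> (\<eta> t) m a i * A t [m, j] + \<Gamma> (\<eta> t) m a j * A t [i, m]))"
    by (subst sum.swap) (simp add: B[OF t])
  also have "\<dots> = (\<Sigma> m. C t m i * A t [m, j]) + (\<Sigma> m. C t m j * A t [i, m])"
    unfolding C_def by (simp add: sum_distrib_right distrib_left sum.distrib mult.assoc)
  finally show ?thesis unfolding covd_tensor_def vd by simp
qed

end

lemma sum_rotate3:
  fixes x :: "'a::finite \<Rightarrow> real"
  shows "(\<Sigma> a. x a * (\<Sigma> b. x b * (\<Sigma> c. x c * f c a b)))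
     = (\<Sigma> c. x c * (\<Sigma> a. x a * (\<Sigma> b. x b * f c a b)))"
proof -
  have "(\<Sigma> a. x a * (\<Sigma> b. x b * (\<Sigma> c. x c * f c a b)))
     = (\<Sigma> a c b. x a * (x b * (x c * f c a b)))"
    unfolding sum_distrib_left by (intro sum.cong refl sum.swap)
  also have "\<dots> = (\<Sigma> c a b. x a * (x b * (x c * f c a b)))"
    by (rule sum.swap)
  finally show ?thesis by (simp add: sum_distrib_left mult_ac)
qed

lemma sum_swap_weighted:
  fixes x y :: "'a::finite \<Rightarrow> real"
  shows "(\<Sigma> c. x c * (\<Sigma> d. y d * k c d)) = (\<Sigma> d. y d * (\<Sigma> c. x c * k c d))"
proof -
  have "(\<Sigma> c. x c * (\<Sigma> d. y d * k c d)) = (\<Sigma> c d. x c * (y d * k c d))"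
    by (simp add: sum_distrib_left)
  also have "\<dots> = (\<Sigma> d c. x c * (y d * k c d))"
    by (rule sum.swap)
  also have "\<dots> = (\<Sigma> d c. y d * (x c * k c d))"
    by (intro sum.cong refl mult.left_commute)
  finally show ?thesis by (simp add: sum_distrib_left)
qed

lemma sum_rotate4:
  fixes x :: "'a::finite \<Rightarrow> real"
  shows "(\<Sigma> a. x a * (\<Sigma> b. x b * (\<Sigma> c. x c * (\<Sigma> d. x d * f d c a b))))
     = (\<Sigma> d. x d * (\<Sigma> c. x c * (\<Sigma> a. x a * (\<Sigma> b. x b * f d c a b))))"
proof -
  have "(\<Sigma> a. x a * (\<Sigma> b. x b * (\<Sigma> c. x c * (\<Sigma> d. x d * f d c a b))))
     = (\<Sigma> c. x c * (\<Sigma> a. x a * (\<Sigma> b. x b * (\<Sigma> d. x d * f d c a b))))"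
    by (rule sum_rotate3)
  also have "\<dots> = (\<Sigma> c. x c * (\<Sigma> d. x d * (\<Sigma> a. x a * (\<Sigma> b. x b * f d c a b))))"
    by (rule sum.cong[OF refl]) (rule arg_cong2[where f = "(*)", OF refl sum_rotate3])
  also have "\<dots> = (\<Sigma> d. x d * (\<Sigma> c. x c * (\<Sigma> a. x a * (\<Sigma> b. x b * f d c a b))))"
    by (rule sum_swap_weighted[of x x "\<lambda>c d. \<Sigma> a. x a * (\<Sigma> b. x b * f d c a b)"])
  finally show ?thesis .
qed

lemma gprod_eq: "gprod G x u w = (\<Sigma> a. u $ a * (\<Sigma> b. w $ b * G x $ a $ b))"
  unfolding gprod_def inner_vec_def matrix_vector_mult_def by (simp add: mult.commute)

context geodesic_on
begin

text \<open>The curvature with the indices of the Jacobi operator moved to the end, so that insertions of the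
  velocity act on the head of the index list, where \<open>\<nabla>\<close> puts the direction of differentiation.\<close>

definition T :: "real^'a \<Rightarrow> 'a list \<Rightarrow> real" where
  "T y is = curvature G y (map ((!) is) [2, 1, 0, 3])"

lemma smooth_T: "smooth_on (\<lambda>y. T y is) S"
  unfolding T_def by (rule smooth_curvature)

lemma T_eq: "T y [b, a, i, j] = curvature G y [i, a, b, j]"
  by (simp add: T_def numeral_eq_Suc)

lemma nabla_T: "length is = 4 \<Longrightarrow> nabla G T y (c # is) = DR y (c # map ((!) is) [2, 1, 0, 3])"
  unfolding T_def[abs_def] by (rule nabla_permute) (auto simp: numeral_eq_Suc lessThan_Suc)

lemma nabla_T_eq: "nabla G T y [c, b, a, i, j] = DR y [c, i, a, b, j]"
  by (subst nabla_T) (simp_all add: numeral_eq_Suc del: nabla.simps)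

lemma nabla2_T_eq:
  assumes "y \<in> S"
  shows "nabla G (nabla G T) y [d, c, b, a, i, j] = DDR y [d, c, i, a, b, j]"
proof -
  have "nabla G (nabla G T) y (d # [c, b, a, i, j]) = nabla G (\<lambda>y is. DR y (map ((!) is) [0, 3, 2, 1, 4])) y (d # [c, b, a, i, j])"
  proof (rule nabla_cong[OF open_S assms])
    fix y and js :: "'a list" assume "length js = length [c, b, a, i, j]"
    then obtain c b a i j where "js = [c, b, a, i, j]" by (auto simp: length_Suc_conv)
    then show "nabla G T y js = DR y (map ((!) js) [0, 3, 2, 1, 4])"
      using nabla_T_eq[of y c b a i j] by (simp add: numeral_eq_Suc del: nabla.simps)
  qed
  also have "\<dots> = DDR y (d # map ((!) [c, b, a, i, j]) [0, 3, 2, 1, 4])"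
    by (rule nabla_permute) (auto simp: numeral_eq_Suc lessThan_Suc)
  finally show ?thesis by (simp add: numeral_eq_Suc del: nabla.simps)
qed

lemmas T_diff = smooth_on_differentiable[OF smooth_T range]
lemmas T1_diff = smooth_on_differentiable[OF smooth_nabla[OF smooth_T] range]

text \<open>The Jacobi operator along the curve and its covariant derivatives, as iterated insertions of the
  velocity.\<close>

definition A0 :: "real \<Rightarrow> 'a list \<Rightarrow> real" where
  "A0 s is = (\<Sigma> a. v s $ a * (\<Sigma> b. v s $ b * T (\<eta> s) (b # a # is)))"
definition A1 :: "real \<Rightarrow> 'a list \<Rightarrow> real" where
  "A1 s is = (\<Sigma> a. v s $ a * (\<Sigma> b. v s $ b * (\<Sigma> c. v s $ c * nabla G T (\<eta> s) (c # b # a # is))))"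
definition A2 :: "real \<Rightarrow> 'a list \<Rightarrow> real" where
  "A2 s is = (\<Sigma> a. v s $ a * (\<Sigma> b. v s $ b * (\<Sigma> c. v s $ c * (\<Sigma> d. v s $ d *
     nabla G (nabla G T) (\<eta> s) (d # c # b # a # is)))))"

lemma has_covd_A0: "t \<in> I \<Longrightarrow> has_covd 2 A0 (A1 t) t"
  unfolding A0_def[abs_def] A1_def[abs_def] numeral_2_eq_2
  by (rule has_covd_insert, assumption, rule has_covd_insert, assumption, rule has_covd_field, assumption, rule T_diff)

lemma has_covd_A1: "t \<in> I \<Longrightarrow> has_covd 2 A1 (A2 t) t"
  unfolding A1_def[abs_def] A2_def[abs_def] numeral_2_eq_2
  by (rule has_covd_insert, assumption, rule has_covd_insert, assumption, rule has_covd_insert, assumption,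
      rule has_covd_field, assumption, rule T1_diff)

lemma A0_eq: "A0 s [i, j] = J0 (\<eta> s) (v s) i j"
  unfolding A0_def J0_def T_eq ..

lemma A1_eq: "A1 s [i, j] = J1 (\<eta> s) (v s) i j"
  unfolding A1_def J1_def nabla_T_eq by (rule sum_rotate3)

lemma A2_eq: "s \<in> I \<Longrightarrow> A2 s [i, j] = J2 (\<eta> s) (v s) i j"
  unfolding A2_def J2_def nabla2_T_eq[OF range] by (rule sum_rotate4)

lemma jacobi_op_eq: "jacobi_op G \<eta> s i j = A0 s [i, j]"
  unfolding A0_eq jacobi_op_def J0_def by (simp add: sum_distrib_left mult_ac)

theorem jacobi_op2_eq:
  assumes t: "t \<in> I"
  shows "jacobi_op2 G \<eta> t i j = J2 (\<eta> t) (v t) i j"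
proof -
  have "covd_tensor G \<eta> (jacobi_op G \<eta>) s i j = A1 s [i, j]" if "s \<in> I" for s i j
    by (rule covd_tensor_eq[OF that has_covd_A0[OF that]]) (rule jacobi_op_eq)
  then have "jacobi_op2 G \<eta> t i j = A2 t [i, j]"
    unfolding jacobi_op2_def by (rule covd_tensor_eq[OF t has_covd_A1[OF t]])
  then show ?thesis using A2_eq[OF t] by simp
qed

subsection \<open>The derivative of inner products\<close>

lemma deriv_h:
  assumes t: "t \<in> I"
  shows "((\<lambda>s. h (\<eta> s) p q) has_real_derivative
     - (\<Sigma> m. C t p m * h (\<eta> t) m q) - (\<Sigma> m. C t q m * h (\<eta> t) p m)) (at t)"
proof -
  have "(\<Sigma> a. v t $ a * pd a (\<lambda>y. h y p q) (\<eta> t))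
    = - (\<Sigma> a m. v t $ a * \<Gamma> (\<eta> t) p a m * h (\<eta> t) m q)
      - (\<Sigma> a m. v t $ a * \<Gamma> (\<eta> t) q a m * h (\<eta> t) p m)"
    unfolding pd_h[OF range[OF t]]
    by (simp add: sum_distrib_left sum_negf distrib_left sum.distrib mult.assoc right_diff_distrib sum_subtractf)
  also have "\<dots> = - (\<Sigma> m. C t p m * h (\<eta> t) m q) - (\<Sigma> m. C t q m * h (\<eta> t) p m)"
    unfolding C_def sum_distrib_right by (subst (1 2) sum.swap) simp
  finally show ?thesis
    using has_real_derivative_along[of "\<lambda>y. h y p q" \<eta> t, OF diff(2)[OF range[OF t]] deriv_\<eta>[OF t]] by simp
qed

lemma has_covd_contract:
  assumes t: "t \<in> I" and A: "has_covd (Suc (Suc d)) A D t"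
  shows "has_covd d (\<lambda>s is. \<Sigma> p q. h (\<eta> s) p q * A s (p # q # is)) (\<lambda>is. \<Sigma> p q. h (\<eta> t) p q * D (p # q # is)) t"
  unfolding has_covd_def
proof (intro allI impI)
  fix "is" :: "'a list" assume d: "length is = d"
  let ?E = "\<lambda>p q. (- (\<Sigma> m. C t p m * h (\<eta> t) m q) - (\<Sigma> m. C t q m * h (\<eta> t) p m)) * A t (p # q # is)
       + h (\<eta> t) p q * (D (p # q # is) + (\<Sum>r<Suc (Suc d). \<Sigma> m. C t m ((p # q # is) ! r) * A t ((p # q # is)[r := m])))"
  have A': "((\<lambda>s. A s (p # q # is)) has_real_derivative
      D (p # q # is) + (\<Sum>r<Suc (Suc d). \<Sigma> m. C t m ((p # q # is) ! r) * A t ((p # q # is)[r := m]))) (at t)" for p q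
    using A[unfolded has_covd_def, rule_format, of "p # q # is"] d by (simp only: length_Cons)
  have "((\<lambda>s. h (\<eta> s) p q * A s (p # q # is)) has_real_derivative ?E p q) (at t)" for p q
    by (rule DERIV_cong[OF DERIV_mult[OF deriv_h[OF t] A']]) (simp only: mult.commute)
  then have "((\<lambda>s. \<Sigma> p q. h (\<eta> s) p q * A s (p # q # is)) has_real_derivative (\<Sigma> p q. ?E p q)) (at t)"
    by (intro DERIV_sum)
  then show "((\<lambda>s. \<Sigma> p q. h (\<eta> s) p q * A s (p # q # is)) has_real_derivative (\<Sigma> p q. h (\<eta> t) p q * D (p # q # is))
      + (\<Sum>r<d. \<Sigma> m. C t m (is ! r) * (\<Sigma> p q. h (\<eta> t) p q * A t (p # q # is[r := m])))) (at t)"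
    unfolding contraction_leibniz[OF d, of "C t" "h (\<eta> t)" "A t" D] .
qed

text \<open>The tensor product \<open>A(i,j) B(k,l)\<close> with the index order \<open>[j, l, i, k]\<close>: two contractions of the
  leading index pair turn it into the inner product of \<open>A\<close> and \<open>B\<close>.\<close>

lemma has_covd_mult:
  assumes A: "has_covd 2 A DA t" and B: "has_covd 2 B DB t"
  shows "has_covd 4 (\<lambda>s is. A s [is ! 2, is ! 0] * B s [is ! 3, is ! 1])
    (\<lambda>is. DA [is ! 2, is ! 0] * B t [is ! 3, is ! 1] + A t [is ! 2, is ! 0] * DB [is ! 3, is ! 1]) t"
  unfolding has_covd_def
proof (intro allI impI)
  fix "is" :: "'a list" assume "length is = 4"
  then obtain j l i k where is4: "is = [j, l, i, k]" by (auto dest: list4)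
  have A': "((\<lambda>s. A s [i, j]) has_real_derivative DA [i, j] + ((\<Sigma> m. C t m i * A t [m, j]) + (\<Sigma> m. C t m j * A t [i, m]))) (at t)"
    using A[unfolded has_covd_def, rule_format, of "[i, j]"] by (simp add: numeral_eq_Suc)
  have B': "((\<lambda>s. B s [k, l]) has_real_derivative DB [k, l] + ((\<Sigma> m. C t m k * B t [m, l]) + (\<Sigma> m. C t m l * B t [k, m]))) (at t)"
    using B[unfolded has_covd_def, rule_format, of "[k, l]"] by (simp add: numeral_eq_Suc)
  have "((\<lambda>s. A s [i, j] * B s [k, l]) has_real_derivative DA [i, j] * B t [k, l] + A t [i, j] * DB [k, l]
     + ((\<Sigma> m. C t m j * (A t [i, m] * B t [k, l])) + (\<Sigma> m. C t m l * (A t [i, j] * B t [k, m]))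
     + (\<Sigma> m. C t m i * (A t [m, j] * B t [k, l])) + (\<Sigma> m. C t m k * (A t [i, j] * B t [m, l])))) (at t)"
    by (rule DERIV_cong[OF DERIV_mult[OF A' B']])
      (simp add: sum_distrib_left sum_distrib_right algebra_simps)
  then show "((\<lambda>s. A s [is ! 2, is ! 0] * B s [is ! 3, is ! 1]) has_real_derivative
     DA [is ! 2, is ! 0] * B t [is ! 3, is ! 1] + A t [is ! 2, is ! 0] * DB [is ! 3, is ! 1]
     + (\<Sum>p<4. \<Sigma> m. C t m (is ! p) * (A t [is[p := m] ! 2, is[p := m] ! 0] * B t [is[p := m] ! 3, is[p := m] ! 1]))) (at t)"
    unfolding is4 by (simp add: numeral_eq_Suc)
qed

lemma deriv_ip:
  assumes t: "t \<in> I" and A: "has_covd 2 A DA t" and B: "has_covd 2 B DB t"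
  shows "((\<lambda>s. ip (\<eta> s) (\<lambda>i j. A s [i, j]) (\<lambda>i j. B s [i, j])) has_real_derivative
     ip (\<eta> t) (\<lambda>i j. DA [i, j]) (\<lambda>i j. B t [i, j]) + ip (\<eta> t) (\<lambda>i j. A t [i, j]) (\<lambda>i j. DB [i, j])) (at t)"
proof -
  have "has_covd (Suc (Suc (Suc (Suc 0)))) (\<lambda>s is. A s [is ! 2, is ! 0] * B s [is ! 3, is ! 1])
    (\<lambda>is. DA [is ! 2, is ! 0] * B t [is ! 3, is ! 1] + A t [is ! 2, is ! 0] * DB [is ! 3, is ! 1]) t"
    using has_covd_mult[OF A B] by (simp add: numeral_eq_Suc)
  from has_covd_contract[OF t has_covd_contract[OF t this], unfolded has_covd_def, rule_format, of "[]"]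
  show ?thesis unfolding ip_def tr_def
    by (simp add: numeral_eq_Suc distrib_left sum.distrib sum_distrib_left)
qed

lemma deriv_J0_J0:
  assumes t: "t \<in> I"
  shows "((\<lambda>s. ip (\<eta> s) (J0 (\<eta> s) (v s)) (J0 (\<eta> s) (v s))) has_real_derivative
     2 * ip (\<eta> t) (J1 (\<eta> t) (v t)) (J0 (\<eta> t) (v t))) (at t)"
  using deriv_ip[OF t has_covd_A0[OF t] has_covd_A0[OF t]] ip_sym[OF range[OF t], of "J0 (\<eta> t) (v t)" "J1 (\<eta> t) (v t)"]
  by (simp add: A0_eq A1_eq)

lemma deriv_J1_J0:
  assumes t: "t \<in> I"
  shows "((\<lambda>s. ip (\<eta> s) (J1 (\<eta> s) (v s)) (J0 (\<eta> s) (v s))) has_real_derivative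
     ip (\<eta> t) (J2 (\<eta> t) (v t)) (J0 (\<eta> t) (v t)) + ip (\<eta> t) (J1 (\<eta> t) (v t)) (J1 (\<eta> t) (v t))) (at t)"
  using deriv_ip[OF t has_covd_A1[OF t] has_covd_A0[OF t]] t
  by (simp add: A0_eq A1_eq A2_eq)

lemma deriv_J1_J1:
  assumes t: "t \<in> I"
  shows "((\<lambda>s. ip (\<eta> s) (J1 (\<eta> s) (v s)) (J1 (\<eta> s) (v s))) has_real_derivative
     2 * ip (\<eta> t) (J2 (\<eta> t) (v t)) (J1 (\<eta> t) (v t))) (at t)"
  using deriv_ip[OF t has_covd_A1[OF t] has_covd_A1[OF t]] ip_sym[OF range[OF t], of "J1 (\<eta> t) (v t)" "J2 (\<eta> t) (v t)"] t
  by (simp add: A1_eq A2_eq)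

lemma deriv_gprod:
  assumes t: "t \<in> I"
  shows "((\<lambda>s. gprod G (\<eta> s) (v s) (v s)) has_real_derivative 0) (at t)"
proof -
  let ?T = "\<lambda>y js. 1 * g y (js ! 0) (js ! 1)"
  have "has_covd (Suc (Suc 0)) (\<lambda>s. ?T (\<eta> s)) (\<lambda>is. \<Sigma> a. v t $ a * nabla G ?T (\<eta> t) (a # is)) t"
    by (rule has_covd_field[OF t]) (use diff(1)[OF range[OF t]] in simp)
  from has_covd_insert[OF t has_covd_insert[OF t this], unfolded has_covd_def, rule_format, of "[]"]
  have "((\<lambda>s. \<Sigma> a. v s $ a * (\<Sigma> b. v s $ b * g (\<eta> s) b a)) has_real_derivative 0) (at t)"
    using nabla_g[OF range[OF t], of 1] by (simp del: nabla.simps)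
  then show ?thesis
    by (rule has_field_derivative_transform_within_open[OF _ open_I t])
      (simp add: gprod_eq g_sym[OF range])
qed

end

section \<open>Existence of geodesics\<close>

text \<open>Picard iteration as a contraction of the complete space of bounded continuous functions on the line.
  The upper limit of integration is clamped to \<open>[-\<delta>, \<delta>]\<close>, and the integral starts at \<open>-\<delta>\<close>, which
  makes the fundamental theorem of calculus applicable on both sides of \<open>0\<close>.\<close>

lemma picard_lindelof:
  fixes f :: "'a::euclidean_space \<Rightarrow> 'a"
  assumes L: "0 \<le> L" and lip: "\<And>x y. dist (f x) (f y) \<le> L * dist x y"
  shows "\<exists>\<delta> \<phi>. 0 < \<delta> \<and> \<phi> 0 = x0 \<and> (\<forall>t\<in>{-\<delta><..<\<delta>}. (\<phi> has_vector_derivative f (\<phi> t)) (at t))"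
proof -
  define \<delta> where "\<delta> = 1 / (8 * (L + 1))"
  have \<delta>: "0 < \<delta>" "8 * (L * \<delta>) \<le> 1" using L by (auto simp: \<delta>_def field_simps)
  define clamp where "clamp t = max (- \<delta>) (min \<delta> t)" for t :: real
  have clamp_in: "clamp t \<in> {-\<delta>..\<delta>}" for t using \<delta> by (auto simp: clamp_def)
  have clamp_cont: "continuous_on UNIV clamp" unfolding clamp_def by (intro continuous_intros)
  have f_cont: "continuous_on UNIV f"
    by (rule lipschitz_on_continuous_on[of L]) (use L lip in \<open>auto simp: lipschitz_on_def\<close>)
  have ff_cont: "continuous_on T (\<lambda>s. f (apply_bcontfun \<phi> s))" for T and \<phi> :: "real \<Rightarrow>\<^sub>C 'a"
    by (rule continuous_on_compose2[OF f_cont continuous_on_apply_bcontfun]) auto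
  define P where "P \<phi> t = x0 + (integral {-\<delta>..clamp t} (\<lambda>s. f (apply_bcontfun \<phi> s))
      - integral {-\<delta>..0} (\<lambda>s. f (apply_bcontfun \<phi> s)))" for \<phi> :: "real \<Rightarrow>\<^sub>C 'a" and t
  have P_in: "P \<phi> \<in> bcontfun" for \<phi>
  proof -
    define F where "F u = x0 + (integral {-\<delta>..u} (\<lambda>s. f (apply_bcontfun \<phi> s))
      - integral {-\<delta>..0} (\<lambda>s. f (apply_bcontfun \<phi> s)))" for u
    have F: "continuous_on {-\<delta>..\<delta>} F"
      unfolding F_def
      by (intro continuous_intros indefinite_integral_continuous_1 integrable_continuous_real ff_cont)
    have P: "P \<phi> = (\<lambda>t. F (clamp t))" unfolding P_def F_def ..
    have "continuous_on UNIV (P \<phi>)" unfolding P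
      by (rule continuous_on_compose2[OF F clamp_cont]) (use clamp_in in auto)
    moreover have "bounded (F ` {-\<delta>..\<delta>})"
      by (rule compact_imp_bounded[OF compact_continuous_image[OF F compact_Icc]])
    then have "bounded (range (P \<phi>))"
      by (rule bounded_subset) (use clamp_in P in auto)
    ultimately show ?thesis unfolding bcontfun_def by simp
  qed
  define Q where "Q \<phi> = Bcontfun (P \<phi>)" for \<phi>
  have Q: "apply_bcontfun (Q \<phi>) t = P \<phi> t" for \<phi> t
    unfolding Q_def using Bcontfun_inverse[OF P_in] by simp
  have contr: "dist (Q \<phi>) (Q \<psi>) \<le> 1 / 2 * dist \<phi> \<psi>" for \<phi> \<psi>
  proof (rule dist_bound)
    fix t
    let ?d = "\<lambda>s. f (apply_bcontfun \<phi> s) - f (apply_bcontfun \<psi> s)"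
    have cont: "continuous_on {-\<delta>..u} ?d" for u by (intro continuous_intros ff_cont)
    have int: "(\<lambda>s. f (apply_bcontfun \<phi> s)) integrable_on {-\<delta>..u}" for u and \<phi> :: "real \<Rightarrow>\<^sub>C 'a"
      by (rule integrable_continuous_real[OF ff_cont])
    have bd: "norm (integral {-\<delta>..u} ?d) \<le> L * dist \<phi> \<psi> * (2 * \<delta>)" if u: "u \<in> {-\<delta>..\<delta>}" for u
    proof -
      have "norm (?d s) \<le> L * dist \<phi> \<psi>" for s
        using lip[of "apply_bcontfun \<phi> s" "apply_bcontfun \<psi> s"] mult_left_mono[OF dist_bounded[of \<phi> s \<psi>] L]
        by (simp add: dist_norm[of "f _"])
      then have "norm (integral {-\<delta>..u} ?d) \<le> L * dist \<phi> \<psi> * (u - - \<delta>)"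
        using u by (intro integral_bound cont) auto
      also have "\<dots> \<le> L * dist \<phi> \<psi> * (2 * \<delta>)"
        using u L by (intro mult_left_mono) auto
      finally show ?thesis .
    qed
    have "P \<phi> t - P \<psi> t = integral {-\<delta>..clamp t} ?d - integral {-\<delta>..0} ?d"
      unfolding P_def by (simp add: integral_diff int)
    then have "dist (P \<phi> t) (P \<psi> t) \<le> norm (integral {-\<delta>..clamp t} ?d) + norm (integral {-\<delta>..0} ?d)"
      unfolding dist_norm by (metis norm_triangle_ineq4)
    also have "\<dots> \<le> L * dist \<phi> \<psi> * (2 * \<delta>) + L * dist \<phi> \<psi> * (2 * \<delta>)"
      using \<delta> clamp_in[of t] by (intro add_mono bd) auto
    also have "\<dots> = (4 * (L * \<delta>)) * dist \<phi> \<psi>" by simp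
    also have "\<dots> \<le> 1 / 2 * dist \<phi> \<psi>"
      using \<delta> by (intro mult_right_mono) auto
    finally show "dist (apply_bcontfun (Q \<phi>) t) (apply_bcontfun (Q \<psi>) t) \<le> 1 / 2 * dist \<phi> \<psi>"
      unfolding Q .
  qed
  then obtain \<phi> where \<phi>: "Q \<phi> = \<phi>"
    using banach_fix_type[of "1 / 2" Q] by auto
  have fixpt: "apply_bcontfun \<phi> t = P \<phi> t" for t using Q[of \<phi> t] \<phi> by simp
  show ?thesis
  proof (intro exI[of _ \<delta>] exI[of _ "apply_bcontfun \<phi>"] conjI ballI)
    show "0 < \<delta>" using \<delta> by simp
    show "apply_bcontfun \<phi> 0 = x0" unfolding fixpt[of 0] P_def clamp_def using \<delta> by simp
    fix t assume t: "t \<in> {-\<delta><..<\<delta>}"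
    have "((\<lambda>u. integral {-\<delta>..u} (\<lambda>s. f (apply_bcontfun \<phi> s))) has_vector_derivative f (apply_bcontfun \<phi> t)) (at t within {-\<delta>..\<delta>})"
      using t by (intro integral_has_vector_derivative ff_cont) auto
    then have "((\<lambda>u. integral {-\<delta>..u} (\<lambda>s. f (apply_bcontfun \<phi> s))) has_vector_derivative f (apply_bcontfun \<phi> t)) (at t)"
      using t by (metis at_within_Icc_at greaterThanLessThan_iff)
    then have "((\<lambda>u. x0 + (integral {-\<delta>..u} (\<lambda>s. f (apply_bcontfun \<phi> s)) - integral {-\<delta>..0} (\<lambda>s. f (apply_bcontfun \<phi> s))))
        has_vector_derivative 0 + (f (apply_bcontfun \<phi> t) - 0)) (at t)"
      by (intro has_vector_derivative_add has_vector_derivative_diff has_vector_derivative_const)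
    then have D: "((\<lambda>u. x0 + (integral {-\<delta>..u} (\<lambda>s. f (apply_bcontfun \<phi> s)) - integral {-\<delta>..0} (\<lambda>s. f (apply_bcontfun \<phi> s))))
        has_vector_derivative f (apply_bcontfun \<phi> t)) (at t)" by simp
    show "(apply_bcontfun \<phi> has_vector_derivative f (apply_bcontfun \<phi> t)) (at t)"
    proof (rule has_vector_derivative_transform_within_open[OF D, of "{-\<delta><..<\<delta>}"])
      fix u assume u: "u \<in> {-\<delta><..<\<delta>}"
      then have "clamp u = u" by (auto simp: clamp_def)
      then show "x0 + (integral {-\<delta>..u} (\<lambda>s. f (apply_bcontfun \<phi> s)) - integral {-\<delta>..0} (\<lambda>s. f (apply_bcontfun \<phi> s)))
          = apply_bcontfun \<phi> u"
        using fixpt[of u] unfolding P_def by simp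
    qed (use t in auto)
  qed
qed

text \<open>Lipschitz functions with an unspecified constant form an algebra on bounded sets; this covers the
  right hand side of the geodesic equation, a polynomial in the velocity with smooth coefficients.\<close>

definition lipschitz_fun :: "('a::metric_space \<Rightarrow> real) \<Rightarrow> 'a set \<Rightarrow> bool" where
  "lipschitz_fun f K \<longleftrightarrow> (\<exists>L. \<forall>x\<in>K. \<forall>y\<in>K. \<bar>f x - f y\<bar> \<le> L * dist x y)"

lemma lipschitz_funD:
  assumes "lipschitz_fun f K"
  shows "\<exists>L\<ge>0. \<forall>x\<in>K. \<forall>y\<in>K. \<bar>f x - f y\<bar> \<le> L * dist x y"
proof -
  from assms obtain L where L: "\<forall>x\<in>K. \<forall>y\<in>K. \<bar>f x - f y\<bar> \<le> L * dist x y" unfolding lipschitz_fun_def by blast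
  have "\<bar>f x - f y\<bar> \<le> \<bar>L\<bar> * dist x y" if "x \<in> K" "y \<in> K" for x y
    using L[rule_format, OF that] mult_right_mono[OF abs_ge_self zero_le_dist, of L x y] by linarith
  then show ?thesis by (intro exI[of _ "\<bar>L\<bar>"]) simp
qed

lemma lipschitz_fun_bounded:
  assumes "lipschitz_fun f K" "bounded K"
  shows "\<exists>B\<ge>0. \<forall>x\<in>K. \<bar>f x\<bar> \<le> B"
proof (cases "K = {}")
  case True
  then show ?thesis by auto
next
  case False
  then obtain z where z: "z \<in> K" by blast
  obtain L where L: "L \<ge> 0" "\<forall>x\<in>K. \<forall>y\<in>K. \<bar>f x - f y\<bar> \<le> L * dist x y"
    using lipschitz_funD[OF assms(1)] by blast
  obtain D where D: "\<forall>x\<in>K. dist z x \<le> D" using assms(2) unfolding bounded_any_center[of _ z] by blast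
  have "\<bar>f x\<bar> \<le> \<bar>f z\<bar> + L * D" if "x \<in> K" for x
    using L(2)[rule_format, OF that z] mult_left_mono[OF D[rule_format, OF that] L(1)] by (simp add: dist_commute)
  moreover have "\<bar>f z\<bar> + L * D \<ge> 0" using L(1) D[rule_format, OF z] by simp
  ultimately show ?thesis by blast
qed

lemma lipschitz_fun_add:
  assumes "lipschitz_fun f K" "lipschitz_fun h K" shows "lipschitz_fun (\<lambda>x. f x + h x) K"
proof -
  obtain L where L: "L \<ge> 0" "\<forall>x\<in>K. \<forall>y\<in>K. \<bar>f x - f y\<bar> \<le> L * dist x y" using lipschitz_funD[OF assms(1)] by blast
  obtain M where M: "M \<ge> 0" "\<forall>x\<in>K. \<forall>y\<in>K. \<bar>h x - h y\<bar> \<le> M * dist x y" using lipschitz_funD[OF assms(2)] by blast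
  have "\<bar>f x + h x - (f y + h y)\<bar> \<le> (L + M) * dist x y" if "x \<in> K" "y \<in> K" for x y
    using L(2)[rule_format, OF that] M(2)[rule_format, OF that] unfolding distrib_right by linarith
  then show ?thesis unfolding lipschitz_fun_def by blast
qed

lemma lipschitz_fun_const: "lipschitz_fun (\<lambda>x. c) K"
  unfolding lipschitz_fun_def by (intro exI[of _ 0]) simp

lemma lipschitz_fun_minus: "lipschitz_fun f K \<Longrightarrow> lipschitz_fun (\<lambda>x. - f x) K"
  unfolding lipschitz_fun_def by (simp add: abs_minus_commute)

lemma lipschitz_fun_sum:
  assumes "\<And>i. i \<in> A \<Longrightarrow> lipschitz_fun (f i) K" shows "lipschitz_fun (\<lambda>x. \<Sum>i\<in>A. f i x) K"
  using assms by (induction A rule: infinite_finite_induct) (simp_all add: lipschitz_fun_const lipschitz_fun_add)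

lemma lipschitz_fun_mult:
  assumes "lipschitz_fun f K" "lipschitz_fun h K" "bounded K" shows "lipschitz_fun (\<lambda>x. f x * h x) K"
proof -
  obtain L where L: "L \<ge> 0" "\<forall>x\<in>K. \<forall>y\<in>K. \<bar>f x - f y\<bar> \<le> L * dist x y" using lipschitz_funD[OF assms(1)] by blast
  obtain M where M: "M \<ge> 0" "\<forall>x\<in>K. \<forall>y\<in>K. \<bar>h x - h y\<bar> \<le> M * dist x y" using lipschitz_funD[OF assms(2)] by blast
  obtain A where A: "A \<ge> 0" "\<forall>x\<in>K. \<bar>f x\<bar> \<le> A" using lipschitz_fun_bounded[OF assms(1,3)] by blast
  obtain B where B: "B \<ge> 0" "\<forall>x\<in>K. \<bar>h x\<bar> \<le> B" using lipschitz_fun_bounded[OF assms(2,3)] by blast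
  have "\<bar>f x * h x - f y * h y\<bar> \<le> (L * B + A * M) * dist x y" if xy: "x \<in> K" "y \<in> K" for x y
  proof -
    have "f x * h x - f y * h y = (f x - f y) * h x + f y * (h x - h y)" by (simp add: algebra_simps)
    then have "\<bar>f x * h x - f y * h y\<bar> \<le> \<bar>f x - f y\<bar> * \<bar>h x\<bar> + \<bar>f y\<bar> * \<bar>h x - h y\<bar>"
      using abs_triangle_ineq[of "(f x - f y) * h x" "f y * (h x - h y)"] by (simp add: abs_mult)
    also have "\<dots> \<le> (L * dist x y) * B + A * (M * dist x y)"
      using L M A B xy by (intro add_mono mult_mono) auto
    finally show ?thesis by (simp add: algebra_simps)
  qed
  then show ?thesis unfolding lipschitz_fun_def by blast
qed

lemma lipschitz_fun_smooth:
  fixes f :: "real^'n::finite \<Rightarrow> real"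
  assumes sm: "smooth_on f S" and K: "cball x r \<subseteq> S"
  shows "lipschitz_fun f (cball x r)"
proof -
  define c where "c y = (\<Sigma> i. \<bar>pd i f y\<bar>)" for y
  have "continuous_on (cball x r) c"
    unfolding c_def
    by (intro continuous_intros continuous_on_subset[OF smooth_on_continuous[OF smooth_on_pd[OF sm]] K])
  then have "bounded (c ` cball x r)"
    by (intro compact_imp_bounded compact_continuous_image compact_cball)
  then obtain B where B0: "\<forall>a\<in>c ` cball x r. norm a \<le> B"
    unfolding bounded_iff by blast
  then have B: "\<bar>c y\<bar> \<le> B" if "y \<in> cball x r" for y using that by simp
  have "norm (f y - f z) \<le> B * norm (y - z)" if "y \<in> cball x r" "z \<in> cball x r" for y z
  proof (rule differentiable_bound[OF convex_cball _ _ that, where f' = "\<lambda>y w. \<Sigma> i. w $ i *\<^sub>R pd i f y"])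
    fix y assume y: "y \<in> cball x r"
    show "(f has_derivative (\<lambda>w. \<Sigma> i. w $ i *\<^sub>R pd i f y)) (at y within cball x r)"
      using has_derivative_pd[OF smooth_on_differentiable[OF sm]] y K has_derivative_at_withinI by blast
    show "onorm (\<lambda>w. \<Sigma> i. w $ i *\<^sub>R pd i f y) \<le> B"
    proof (rule onorm_le)
      fix w :: "real^'n"
      have "norm (\<Sigma> i. w $ i *\<^sub>R pd i f y) \<le> (\<Sigma> i. norm w * \<bar>pd i f y\<bar>)"
        by (rule sum_norm_le) (simp add: abs_mult mult_right_mono component_le_norm_cart)
      also have "\<dots> = norm w * c y" by (simp add: c_def sum_distrib_left)
      also have "\<dots> \<le> norm w * B" using B[OF y] by (intro mult_left_mono) auto
      finally show "norm (\<Sigma> i. w $ i *\<^sub>R pd i f y) \<le> B * norm w" by (simp add: mult.commute)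
    qed
  qed
  then show ?thesis unfolding lipschitz_fun_def dist_norm real_norm_def by blast
qed

context metric_on
begin

text \<open>The geodesic equation is an autonomous equation for the pair of position and velocity.
  Composing its right hand side with the projection to a closed ball makes it globally Lipschitz
  without changing it near the initial value.\<close>

theorem geodesic_exists:
  assumes x0: "x0 \<in> S"
  shows "\<exists>\<delta> \<eta>. 0 < \<delta> \<and> \<eta> 0 = x0 \<and> velocity \<eta> 0 = v0 \<and> geodesic_on G S \<eta> {-\<delta><..<\<delta>}"
proof -
  obtain r where r: "r > 0" "cball x0 r \<subseteq> S" using open_S x0 open_contains_cball by blast
  define acc where "acc z = (\<chi> l. - (\<Sigma> i j. \<Gamma> (fst z) l i j * snd z $ i * snd z $ j))" for z :: "(real^'n) \<times> (real^'n)"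
  define f where "f z = (snd z, acc z)" for z :: "(real^'n) \<times> (real^'n)"
  define K where "K = cball (x0, v0) r"
  have K: "convex K" "closed K" "K \<noteq> {}" "bounded K" using r by (auto simp: K_def)
  have fstK: "fst z \<in> cball x0 r" if "z \<in> K" for z
    using that dist_fst_le[of "(x0, v0)" z] by (auto simp: K_def)
  have l\<Gamma>: "lipschitz_fun (\<lambda>z. \<Gamma> (fst z) l i j) K" for l i j
  proof -
    obtain L where L: "L \<ge> 0" "\<forall>x\<in>cball x0 r. \<forall>y\<in>cball x0 r. \<bar>\<Gamma> x l i j - \<Gamma> y l i j\<bar> \<le> L * dist x y"
      using lipschitz_funD[OF lipschitz_fun_smooth[OF smooth_\<Gamma> r(2)]] by blast
    have "\<bar>\<Gamma> (fst z) l i j - \<Gamma> (fst w) l i j\<bar> \<le> L * dist z w" if "z \<in> K" "w \<in> K" for z w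
      using L(2)[rule_format, OF fstK[OF that(1)] fstK[OF that(2)]] mult_left_mono[OF dist_fst_le[of z w] L(1)] by linarith
    then show ?thesis unfolding lipschitz_fun_def by blast
  qed
  have lv: "lipschitz_fun (\<lambda>z. snd z $ i) K" for i
  proof -
    have "\<bar>snd z $ i - snd w $ i\<bar> \<le> 1 * dist z w" for z w :: "(real^'n) \<times> (real^'n)"
      using dist_snd_le[of z w] component_le_norm_cart[of "snd z - snd w" i] by (simp add: dist_norm)
    then show ?thesis unfolding lipschitz_fun_def by blast
  qed
  have lacc: "lipschitz_fun (\<lambda>z. acc z $ l) K" for l
    unfolding acc_def by (simp, intro lipschitz_fun_minus lipschitz_fun_sum lipschitz_fun_mult l\<Gamma> lv K(4))
  have "\<exists>L\<ge>0. \<forall>z\<in>K. \<forall>w\<in>K. \<bar>acc z $ l - acc w $ l\<bar> \<le> L * dist z w" for l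
    using lipschitz_funD[OF lacc[of l]] .
  then obtain M where M: "\<And>l. M l \<ge> 0" "\<And>l z w. z \<in> K \<Longrightarrow> w \<in> K \<Longrightarrow> \<bar>acc z $ l - acc w $ l\<bar> \<le> M l * dist z w"
    by metis
  have lipf: "dist (f z) (f w) \<le> (1 + (\<Sigma> l. M l)) * dist z w" if zw: "z \<in> K" "w \<in> K" for z w
  proof -
    have "dist (f z) (f w) = norm ((snd z - snd w, acc z - acc w))" by (simp add: f_def dist_norm)
    also have "\<dots> \<le> norm (snd z - snd w) + norm (acc z - acc w)" by (rule norm_Pair_le)
    also have "norm (acc z - acc w) \<le> (\<Sigma> l. \<bar>(acc z - acc w) $ l\<bar>)" by (rule norm_le_l1_cart)
    also have "\<dots> \<le> (\<Sigma> l. M l * dist z w)" by (rule sum_mono) (use M(2)[OF zw] in simp)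
    also have "norm (snd z - snd w) \<le> dist z w" using dist_snd_le[of z w] by (simp add: dist_norm)
    finally show ?thesis by (simp add: distrib_right sum_distrib_right)
  qed
  define F where "F z = f (closest_point K z)" for z
  have LF: "0 \<le> 1 + (\<Sigma> l. M l)" using M(1) by (simp add: sum_nonneg add_nonneg_nonneg)
  have lipF: "dist (F z) (F w) \<le> (1 + (\<Sigma> l. M l)) * dist z w" for z w
    unfolding F_def
    using lipf[OF closest_point_in_set[OF K(2,3)] closest_point_in_set[OF K(2,3)], of z w]
      mult_left_mono[OF closest_point_lipschitz[OF K(1-3), of z w] LF] by linarith
  obtain \<delta>0 \<phi> where \<delta>0: "0 < \<delta>0" "\<phi> 0 = (x0, v0)"
    and \<phi>: "\<And>t. t \<in> {-\<delta>0<..<\<delta>0} \<Longrightarrow> (\<phi> has_vector_derivative F (\<phi> t)) (at t)"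
    using picard_lindelof[OF LF lipF, of "(x0, v0)"] by blast
  have "isCont \<phi> 0" using \<phi>[of 0] \<delta>0 has_vector_derivative_continuous by fastforce
  then obtain d where d: "d > 0" "\<And>t. dist t 0 < d \<Longrightarrow> dist (\<phi> t) (\<phi> 0) < r"
    using r(1) unfolding continuous_at_eps_delta by blast
  define \<delta> where "\<delta> = min d \<delta>0"
  have \<delta>: "0 < \<delta>" using d \<delta>0 by (simp add: \<delta>_def)
  have inK: "\<phi> t \<in> K" if "t \<in> {-\<delta><..<\<delta>}" for t
  proof -
    have "- \<delta> < t" "t < \<delta>" "\<delta> \<le> d" using that by (auto simp: \<delta>_def)
    then have "dist t 0 < d" by (simp add: dist_real_def)
    then have "dist (\<phi> t) (x0, v0) < r" using d(2)[of t] \<delta>0(2) by simp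
    then show ?thesis by (simp add: K_def dist_commute)
  qed
  have D: "(\<phi> has_vector_derivative f (\<phi> t)) (at t)" if "t \<in> {-\<delta><..<\<delta>}" for t
    using \<phi>[of t] that closest_point_self[OF inK[OF that]] by (auto simp: F_def \<delta>_def)
  define \<eta> where "\<eta> t = fst (\<phi> t)" for t
  define v where "v t = snd (\<phi> t)" for t
  have D\<eta>: "(\<eta> has_vector_derivative v t) (at t)" if "t \<in> {-\<delta><..<\<delta>}" for t
    using bounded_linear.has_vector_derivative[OF bounded_linear_fst D[OF that]]
    by (simp add: \<eta>_def[abs_def] v_def f_def)
  have Dv: "(v has_vector_derivative acc (\<phi> t)) (at t)" if "t \<in> {-\<delta><..<\<delta>}" for t
    using bounded_linear.has_vector_derivative[OF bounded_linear_snd D[OF that]]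
    by (simp add: v_def[abs_def] f_def)
  have vel: "velocity \<eta> t = v t" if "t \<in> {-\<delta><..<\<delta>}" for t
    unfolding velocity_def by (rule vector_derivative_at[OF D\<eta>[OF that]])
  have Dvel: "(velocity \<eta> has_vector_derivative acc (\<phi> t)) (at t)" if "t \<in> {-\<delta><..<\<delta>}" for t
    by (rule has_vector_derivative_transform_within_open[OF Dv[OF that], of "{-\<delta><..<\<delta>}"]) (use that vel in auto)
  have "geodesic_on G S \<eta> {-\<delta><..<\<delta>}"
  proof unfold_locales
    show "open {-\<delta><..<\<delta>}" by simp
    fix t assume t: "t \<in> {-\<delta><..<\<delta>}"
    show "\<eta> t \<in> S" using fstK[OF inK[OF t]] r(2) by (auto simp: \<eta>_def)
    show "\<eta> differentiable at t" using D\<eta>[OF t] by (rule differentiableI_vector)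
    show "velocity \<eta> differentiable at t" using Dvel[OF t] by (rule differentiableI_vector)
    show "covd_vector G \<eta> (velocity \<eta>) t = 0"
      unfolding covd_vector_def vector_derivative_at[OF Dvel[OF t]]
      by (simp add: vec_eq_iff acc_def vel[OF t] \<eta>_def v_def)
  qed
  moreover have "\<eta> 0 = x0" "velocity \<eta> 0 = v0" using \<delta> \<delta>0(2) vel[of 0] by (auto simp: \<eta>_def v_def)
  ultimately show ?thesis using \<delta> by blast
qed

end

section \<open>Change of charts\<close>

lemma jacobian_entry: "jacobian \<tau> (at x) $ k $ i = pd i \<tau> x $ k"
  by (simp add: jacobian_def matrix_def pd_def)

text \<open>A smooth map \<open>\<tau>\<close> that pulls the metric \<open>H\<close> back to \<open>G\<close>, such as a transition map between two charts.
  It is a local isometry, as nondegeneracy of \<open>G\<close> makes its Jacobian invertible.\<close>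

locale chart_change = A: metric_on G S + B: metric_on H S' for G :: "real^'n::finite \<Rightarrow> real^'n^'n" and S and H :: "real^'n \<Rightarrow> real^'n^'n" and S' +
  fixes \<tau> :: "real^'n \<Rightarrow> real^'n"
  assumes smooth_\<tau>: "smooth_on \<tau> S" and \<tau>_range: "x \<in> S \<Longrightarrow> \<tau> x \<in> S'"
    and transforms: "x \<in> S \<Longrightarrow> G x = transpose (jacobian \<tau> (at x)) ** H (\<tau> x) ** jacobian \<tau> (at x)"
begin

definition j :: "real^'n \<Rightarrow> 'n \<Rightarrow> 'n \<Rightarrow> real" where "j x k i = pd i \<tau> x $ k"

text \<open>The derivative of the Jacobian matrix, that is the second partial derivatives of \<open>\<tau>\<close>.\<close>

definition jj :: "real^'n \<Rightarrow> 'n \<Rightarrow> 'n \<Rightarrow> 'n \<Rightarrow> real" where "jj x l k i = pd l (\<lambda>y. j y k i) x"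

lemma smooth_j: "smooth_on (\<lambda>y. j y k i) S"
  unfolding j_def by (intro smooth_on_nth A.open_S smooth_on_pd smooth_\<tau>)

lemma diff_\<tau>: "x \<in> S \<Longrightarrow> \<tau> differentiable (at x)"
  by (rule smooth_on_differentiable[OF smooth_\<tau>])

lemma diff_j: "x \<in> S \<Longrightarrow> (\<lambda>y. j y k i) differentiable (at x)"
  by (rule smooth_on_differentiable[OF smooth_j])

lemma j_eq: "x \<in> S \<Longrightarrow> pd i (\<lambda>y. \<tau> y $ k) x = j x k i"
  unfolding j_def by (rule pd_linear[OF diff_\<tau> bounded_linear_vec_nth])

lemma jj_sym:
  assumes x: "x \<in> S" shows "jj x l k i = jj x i k l"
proof -
  have "jj x l k i = pd l (pd i (\<lambda>y. \<tau> y $ k)) x" for l i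
    unfolding jj_def by (rule pd_cong[OF A.open_S x]) (simp add: j_eq)
  then show ?thesis
    using pd_commute[OF A.open_S x smooth_on_nth[OF A.open_S smooth_\<tau>], of l i k] by simp
qed

lemma pd_compose_\<tau>:
  assumes "x \<in> S" "f differentiable (at (\<tau> x))"
  shows "pd i (\<lambda>y. f (\<tau> y)) x = (\<Sigma> a. j x a i * pd a f (\<tau> x))"
  unfolding j_def by (rule pd_compose[OF assms(2) diff_\<tau>[OF assms(1)]])

lemma g_eq:
  assumes "x \<in> S"
  shows "G x $ i $ k = (\<Sigma> a b. j x a i * H (\<tau> x) $ a $ b * j x b k)"
proof -
  have "G x $ i $ k = (\<Sigma> b. (\<Sigma> a. j x a i * H (\<tau> x) $ a $ b) * j x b k)"
    unfolding transforms[OF assms]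
    by (simp add: matrix_matrix_mult_def transpose_def jacobian_entry j_def)
  then show ?thesis unfolding sum_distrib_right by (subst sum.swap) simp
qed

text \<open>From \<open>G = J\<^sup>T H J\<close> one gets \<open>H\<^sup>-\<^sup>1 = J G\<^sup>-\<^sup>1 J\<^sup>T\<close>.\<close>

lemma h_eq:
  assumes x: "x \<in> S"
  shows "matrix_inv (H (\<tau> x)) $ p $ r = (\<Sigma> k. (\<Sigma> i. j x p i * matrix_inv (G x) $ i $ k) * j x r k)"
proof -
  let ?J = "jacobian \<tau> (at x)"
  have "(transpose ?J ** H (\<tau> x)) ** (?J ** matrix_inv (G x)) = mat 1"
    using matrix_inv_mult(1)[OF A.invertible_G[OF x]] transforms[OF x] by (simp add: matrix_mul_assoc)
  then have "(?J ** matrix_inv (G x)) ** (transpose ?J ** H (\<tau> x)) = mat 1"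
    by (simp add: matrix_left_right_inverse)
  then have "(?J ** matrix_inv (G x) ** transpose ?J) ** H (\<tau> x) = mat 1"
    by (simp add: matrix_mul_assoc)
  then have "H (\<tau> x) ** (?J ** matrix_inv (G x) ** transpose ?J) = mat 1"
    by (simp add: matrix_left_right_inverse)
  then have "matrix_inv (H (\<tau> x)) = ?J ** matrix_inv (G x) ** transpose ?J"
    by (rule matrix_inv_eqI)
  then show ?thesis
    by (simp add: matrix_matrix_mult_def transpose_def jacobian_entry j_def)
qed

subsection \<open>The Christoffel symbols\<close>

lemma pd_g_eq:
  assumes x: "x \<in> S"
  shows "pd l (\<lambda>y. G y $ i $ k) x
    = (\<Sigma> a b. jj x l a i * H (\<tau> x) $ a $ b * j x b k)
    + (\<Sigma> a b c. j x a i * j x b k * (j x c l * pd c (\<lambda>y. H y $ a $ b) (\<tau> x)))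
    + (\<Sigma> a b. jj x l a k * H (\<tau> x) $ a $ b * j x b i)"
proof -
  have DH: "(\<lambda>y. H y $ a $ b) differentiable (at (\<tau> x))" for a b
    using B.diff(1)[OF \<tau>_range[OF x]] .
  have DHt: "(\<lambda>y. H (\<tau> y) $ a $ b) differentiable (at x)" for a b
    using differentiable_chain_at[OF diff_\<tau>[OF x] DH[of a b]] by (simp add: o_def)
  have "pd l (\<lambda>y. G y $ i $ k) x = pd l (\<lambda>y. \<Sigma> a b. j y a i * H (\<tau> y) $ a $ b * j y b k) x"
    by (rule pd_cong[OF A.open_S x]) (rule g_eq)
  also have "\<dots> = (\<Sigma> a b. (jj x l a i * H (\<tau> x) $ a $ b
      + j x a i * (\<Sigma> c. j x c l * pd c (\<lambda>y. H y $ a $ b) (\<tau> x))) * j x b k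
      + (j x a i * H (\<tau> x) $ a $ b) * jj x l b k)"
    using diff_j[OF x] DHt
    by (simp add: pd_sum pd_mult jj_def[symmetric] pd_compose_\<tau>[OF x DH])
  also have "\<dots> = (\<Sigma> a b. jj x l a i * H (\<tau> x) $ a $ b * j x b k)
    + (\<Sigma> a b c. j x a i * j x b k * (j x c l * pd c (\<lambda>y. H y $ a $ b) (\<tau> x)))
    + (\<Sigma> a b. j x a i * H (\<tau> x) $ a $ b * jj x l b k)"
    by (simp add: distrib_left distrib_right sum.distrib sum_distrib_left sum_distrib_right mult_ac)
  also have "(\<Sigma> a b. j x a i * H (\<tau> x) $ a $ b * jj x l b k)
      = (\<Sigma> a b. jj x l a k * H (\<tau> x) $ a $ b * j x b i)"
    by (subst sum.swap) (simp add: B.g_sym[OF \<tau>_range[OF x]] mult_ac)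
  finally show ?thesis .
qed

text \<open>The derivative of the metric splits into a part \<open>M\<close> with the derivative of \<open>H\<close> and parts \<open>N\<close> with
  second derivatives of \<open>\<tau>\<close>. In the combination that defines the Christoffel symbols, all but one of
  the six terms \<open>N\<close> cancel by the symmetry of the second derivatives.\<close>

lemma \<Gamma>1_transform:
  assumes x: "x \<in> S"
  shows "A.\<Gamma>1 x i k l = (\<Sigma> c. ((\<Sigma> a b. B.\<Gamma>1 (\<tau> x) a b c * j x a i * j x b k)
     + (\<Sigma> a. jj x i a k * H (\<tau> x) $ a $ c)) * j x c l)"
proof -
  define N where "N l i k = (\<Sigma> a b. jj x l a i * H (\<tau> x) $ a $ b * j x b k)" for l i k
  define M where "M l i k = (\<Sigma> a b c. j x a i * j x b k * (j x c l * pd c (\<lambda>y. H y $ a $ b) (\<tau> x)))" for l i k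
  have N_sym: "N l i k = N i l k" for l i k unfolding N_def by (simp add: jj_sym[OF x, of l])
  have P: "pd l (\<lambda>y. G y $ i $ k) x = N l i k + M l i k + N l k i" for l i k
    unfolding pd_g_eq[OF x] N_def M_def ..
  have G1: "A.\<Gamma>1 x i k l = N i k l + (M i l k + M k l i - M l i k) / 2"
    unfolding A.\<Gamma>1_eq[OF x] P using N_sym[of i k l] N_sym[of i l k] N_sym[of k l i] by (simp add: field_simps)
  have M1: "M i l k = (\<Sigma> c a b. pd a (\<lambda>y. H y $ c $ b) (\<tau> x) * (j x a i * j x b k * j x c l))"
    unfolding M_def
  proof (rule sum.cong[OF refl])
    fix c
    show "(\<Sigma> b a. j x c l * j x b k * (j x a i * pd a (\<lambda>y. H y $ c $ b) (\<tau> x)))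
      = (\<Sigma> a b. pd a (\<lambda>y. H y $ c $ b) (\<tau> x) * (j x a i * j x b k * j x c l))"
      by (subst sum.swap) (simp add: mult_ac)
  qed
  have M2: "M k l i = (\<Sigma> c a b. pd b (\<lambda>y. H y $ c $ a) (\<tau> x) * (j x a i * j x b k * j x c l))"
    unfolding M_def by (simp add: mult_ac)
  have M3: "M l i k = (\<Sigma> c a b. pd c (\<lambda>y. H y $ a $ b) (\<tau> x) * (j x a i * j x b k * j x c l))"
  proof -
    have "M l i k = (\<Sigma> a c b. j x a i * j x b k * (j x c l * pd c (\<lambda>y. H y $ a $ b) (\<tau> x)))"
      unfolding M_def by (intro sum.cong refl sum.swap)
    also have "\<dots> = (\<Sigma> c a b. j x a i * j x b k * (j x c l * pd c (\<lambda>y. H y $ a $ b) (\<tau> x)))"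
      by (rule sum.swap)
    finally show ?thesis by (simp add: mult_ac)
  qed
  have "(M i l k + M k l i - M l i k) / 2
      = (\<Sigma> c a b. B.\<Gamma>1 (\<tau> x) a b c * (j x a i * j x b k * j x c l))"
    unfolding M1 M2 M3 B.\<Gamma>1_eq[OF \<tau>_range[OF x]]
    by (simp add: sum.distrib[symmetric] sum_subtractf[symmetric] sum_divide_distrib distrib_right[symmetric] left_diff_distrib[symmetric])
  moreover have "N i k l = (\<Sigma> c. (\<Sigma> a. jj x i a k * H (\<tau> x) $ a $ c) * j x c l)"
    unfolding N_def sum_distrib_right by (rule sum.swap)
  ultimately show ?thesis unfolding G1
    by (simp add: distrib_right sum.distrib sum_distrib_right mult.assoc)
qed

theorem christoffel_transform:
  assumes x: "x \<in> S"
  shows "(\<Sigma> m. j x p m * christoffel G x m i k)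
    = (\<Sigma> a b. christoffel H (\<tau> x) p a b * j x a i * j x b k) + jj x i p k"
proof -
  define Z where "Z c = (\<Sigma> a b. B.\<Gamma>1 (\<tau> x) a b c * j x a i * j x b k)
     + (\<Sigma> a. jj x i a k * H (\<tau> x) $ a $ c)" for c
  have "(\<Sigma> m. j x p m * christoffel G x m i k)
      = (\<Sigma> m l c. Z c * (j x c l * matrix_inv (G x) $ l $ m * j x p m))"
    unfolding A.raise_\<Gamma>1[OF x, symmetric] \<Gamma>1_transform[OF x] Z_def[symmetric]
    by (simp add: sum_distrib_left sum_distrib_right mult_ac)
  also have "\<dots> = (\<Sigma> m c l. Z c * (j x c l * matrix_inv (G x) $ l $ m * j x p m))"
    by (intro sum.cong refl sum.swap)
  also have "\<dots> = (\<Sigma> c m l. Z c * (j x c l * matrix_inv (G x) $ l $ m * j x p m))"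
    by (rule sum.swap)
  also have "\<dots> = (\<Sigma> c. Z c * matrix_inv (H (\<tau> x)) $ c $ p)"
    unfolding h_eq[OF x] by (simp add: sum_distrib_left sum_distrib_right)
  also have "\<dots> = (\<Sigma> c a b. B.\<Gamma>1 (\<tau> x) a b c * matrix_inv (H (\<tau> x)) $ c $ p * (j x a i * j x b k))
      + (\<Sigma> c a. jj x i a k * H (\<tau> x) $ a $ c * matrix_inv (H (\<tau> x)) $ c $ p)"
    unfolding Z_def by (simp add: distrib_left distrib_right sum.distrib sum_distrib_left sum_distrib_right mult_ac)
  also have "(\<Sigma> c a. jj x i a k * H (\<tau> x) $ a $ c * matrix_inv (H (\<tau> x)) $ c $ p) = jj x i p k"
    by (rule B.contract_gh[OF \<tau>_range[OF x]])
  also have "(\<Sigma> c a b. B.\<Gamma>1 (\<tau> x) a b c * matrix_inv (H (\<tau> x)) $ c $ p * (j x a i * j x b k))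
      = (\<Sigma> a b c. B.\<Gamma>1 (\<tau> x) a b c * matrix_inv (H (\<tau> x)) $ c $ p * (j x a i * j x b k))"
    by (subst sum.swap) (intro sum.cong refl sum.swap)
  also have "\<dots> = (\<Sigma> a b. christoffel H (\<tau> x) p a b * j x a i * j x b k)"
    unfolding B.raise_\<Gamma>1[OF \<tau>_range[OF x], symmetric] by (simp add: sum_distrib_right mult.assoc)
  finally show ?thesis .
qed

text \<open>The differential of \<open>\<tau>\<close>.\<close>

definition push :: "real^'n \<Rightarrow> real^'n \<Rightarrow> real^'n" where
  "push x u = (\<chi> k. \<Sigma> i. u $ i * j x k i)"

theorem geodesic_transform:
  assumes geo: "geodesic_on G S \<eta> I"
  shows "geodesic_on H S' (\<lambda>t. \<tau> (\<eta> t)) I"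
    and "t \<in> I \<Longrightarrow> velocity (\<lambda>t. \<tau> (\<eta> t)) t = push (\<eta> t) (velocity \<eta> t)"
proof -
  interpret geodesic_on G S \<eta> I by (rule geo)
  define w where "w t = push (\<eta> t) (velocity \<eta> t)" for t
  have D\<zeta>: "((\<lambda>t. \<tau> (\<eta> t)) has_vector_derivative w t) (at t)" if t: "t \<in> I" for t
  proof -
    have "(\<Sigma> a. velocity \<eta> t $ a *\<^sub>R pd a \<tau> (\<eta> t)) = w t"
      by (simp add: vec_eq_iff w_def push_def j_def)
    then show ?thesis
      using has_vector_derivative_along[OF diff_\<tau>[OF range[OF t]] deriv_\<eta>[OF t]] by simp
  qed
  have vel: "velocity (\<lambda>t. \<tau> (\<eta> t)) t = w t" if t: "t \<in> I" for t
    unfolding velocity_def by (rule vector_derivative_at[OF D\<zeta>[OF t]])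
  then show "t \<in> I \<Longrightarrow> velocity (\<lambda>t. \<tau> (\<eta> t)) t = push (\<eta> t) (velocity \<eta> t)"
    unfolding w_def .
  define acc where "acc t = (\<chi> k. - (\<Sigma> a b. christoffel H (\<tau> (\<eta> t)) k a b * w t $ a * w t $ b))" for t
  have Dw: "((\<lambda>s. w s $ k) has_real_derivative acc t $ k) (at t)" if t: "t \<in> I" for t k
  proof -
    let ?v = "velocity \<eta> t" and ?x = "\<eta> t"
    have x: "?x \<in> S" using range[OF t] .
    have "((\<lambda>s. \<Sigma> i. velocity \<eta> s $ i * j (\<eta> s) k i) has_real_derivative
       (\<Sigma> i. - (\<Sigma> m. C t i m * ?v $ m) * j ?x k i + (\<Sigma> l. ?v $ l * jj ?x l k i) * ?v $ i)) (at t)"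
      unfolding jj_def
      by (intro DERIV_sum DERIV_mult deriv_v[OF t] has_real_derivative_along diff_j x deriv_\<eta>[OF t])
    moreover have "(\<Sigma> i. (\<Sigma> m. C t i m * ?v $ m) * j ?x k i)
        = (\<Sigma> m l. (\<Sigma> i. j ?x k i * christoffel G ?x i l m) * (?v $ l * ?v $ m))"
    proof -
      have "(\<Sigma> i. (\<Sigma> m. C t i m * ?v $ m) * j ?x k i)
         = (\<Sigma> i m l. j ?x k i * christoffel G ?x i l m * (?v $ l * ?v $ m))"
        unfolding C_def by (simp add: sum_distrib_left sum_distrib_right mult_ac)
      also have "\<dots> = (\<Sigma> m i l. j ?x k i * christoffel G ?x i l m * (?v $ l * ?v $ m))"
        by (rule sum.swap)
      also have "\<dots> = (\<Sigma> m l i. j ?x k i * christoffel G ?x i l m * (?v $ l * ?v $ m))"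
        by (intro sum.cong refl sum.swap)
      finally show ?thesis by (simp add: sum_distrib_right)
    qed
    moreover have "\<dots> = (\<Sigma> m l. \<Sigma> a b. christoffel H (\<tau> ?x) k a b * (?v $ l * j ?x a l) * (?v $ m * j ?x b m))
        + (\<Sigma> i. (\<Sigma> l. ?v $ l * jj ?x l k i) * ?v $ i)"
      unfolding christoffel_transform[OF x]
      by (simp add: distrib_left distrib_right sum.distrib sum_distrib_left sum_distrib_right mult_ac)
    moreover have "(\<Sigma> m l. \<Sigma> a b. christoffel H (\<tau> ?x) k a b * (?v $ l * j ?x a l) * (?v $ m * j ?x b m))
        = - acc t $ k"
    proof -
      let ?f = "\<lambda>m l a b. christoffel H (\<tau> ?x) k a b * (?v $ l * j ?x a l) * (?v $ m * j ?x b m)"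
      have "(\<Sigma> m l. \<Sigma> a b. ?f m l a b) = (\<Sigma> m a. \<Sigma> l b. ?f m l a b)"
        by (intro sum.cong refl sum.swap)
      also have "\<dots> = (\<Sigma> a m. \<Sigma> b l. ?f m l a b)"
        by (subst sum.swap) (intro sum.cong refl sum.swap)
      also have "\<dots> = (\<Sigma> a b. \<Sigma> m l. ?f m l a b)"
        by (intro sum.cong refl sum.swap)
      also have "\<dots> = (\<Sigma> a b. \<Sigma> l m. ?f m l a b)"
        by (intro sum.cong refl sum.swap)
      also have "\<dots> = - acc t $ k"
        unfolding acc_def w_def push_def by (simp add: sum_distrib_left sum_distrib_right mult_ac)
      finally show ?thesis .
    qed
    ultimately show ?thesis unfolding w_def push_def by (simp add: sum.distrib sum_negf sum_subtractf)
  qed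
  have Dwv: "(w has_vector_derivative acc t) (at t)" if t: "t \<in> I" for t
    unfolding has_vector_derivative_def
  proof (subst has_derivative_componentwise_within, intro ballI)
    fix b :: "real^'n" assume "b \<in> Basis"
    then obtain k where b: "b = axis k 1" by (auto simp: Basis_vec_def)
    show "((\<lambda>s. w s \<bullet> b) has_derivative (\<lambda>s. s *\<^sub>R acc t \<bullet> b)) (at t)"
      using Dw[OF t, of k] by (simp add: b inner_axis has_field_derivative_def mult_commute_abs)
  qed
  have Dvel: "(velocity (\<lambda>t. \<tau> (\<eta> t)) has_vector_derivative acc t) (at t)" if t: "t \<in> I" for t
    by (rule has_vector_derivative_transform_within_open[OF Dwv[OF t] open_I t]) (simp add: vel)
  show "geodesic_on H S' (\<lambda>t. \<tau> (\<eta> t)) I"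
  proof unfold_locales
    show "open I" by (rule open_I)
    fix t assume t: "t \<in> I"
    show "\<tau> (\<eta> t) \<in> S'" by (rule \<tau>_range[OF range[OF t]])
    show "(\<lambda>t. \<tau> (\<eta> t)) differentiable at t" using D\<zeta>[OF t] by (rule differentiableI_vector)
    show "velocity (\<lambda>t. \<tau> (\<eta> t)) differentiable at t" using Dvel[OF t] by (rule differentiableI_vector)
    show "covd_vector H (\<lambda>t. \<tau> (\<eta> t)) (velocity (\<lambda>t. \<tau> (\<eta> t))) t = 0"
      unfolding covd_vector_def vector_derivative_at[OF Dvel[OF t]]
      by (simp add: vec_eq_iff acc_def vel[OF t])
  qed
qed

end

subsection \<open>The curvature\<close>

context chart_change
begin

text \<open>The connection matrix of \<open>H\<close>, pulled back along \<open>\<tau>\<close> but still acting on the components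
  with respect to the chart of \<open>H\<close>. The transformation law of the Christoffel symbols says that it
  arises from the connection matrix of \<open>G\<close> by the gauge transformation \<open>j\<close>; so their curvatures
  are conjugate by \<open>j\<close>.\<close>

definition P :: "real^'n \<Rightarrow> 'n \<Rightarrow> 'n \<Rightarrow> 'n \<Rightarrow> real" where
  "P x i p b = (\<Sigma> a. christoffel H (\<tau> x) p a b * j x a i)"

lemma gauge:
  assumes x: "x \<in> S"
  shows "(\<Sigma> m. j x p m * christoffel G x m i k) = (\<Sigma> b. P x i p b * j x b k) + jj x i p k"
proof -
  have "(\<Sigma> b. P x i p b * j x b k) = (\<Sigma> a b. christoffel H (\<tau> x) p a b * j x a i * j x b k)"
    unfolding P_def sum_distrib_right by (rule sum.swap)
  then show ?thesis using christoffel_transform[OF x] by simp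
qed

lemma diff_christoffel_\<tau>:
  assumes x: "x \<in> S" shows "(\<lambda>y. christoffel H (\<tau> y) p a b) differentiable (at x)"
  using differentiable_chain_at[OF diff_\<tau>[OF x] B.diff(3)[OF \<tau>_range[OF x], of p a b]] by (simp add: o_def)

lemma diff_P:
  assumes x: "x \<in> S" shows "(\<lambda>y. P y i p b) differentiable (at x)"
  unfolding P_def using differentiable_mult[OF diff_christoffel_\<tau>[OF x] diff_j[OF x]]
  by (intro differentiable_sum) auto

lemma smooth_jj: "smooth_on (\<lambda>y. jj y l k i) S"
  unfolding jj_def by (intro smooth_on_pd smooth_j)

lemma diff_jj: "x \<in> S \<Longrightarrow> (\<lambda>y. jj y l k i) differentiable (at x)"
  by (rule smooth_on_differentiable[OF smooth_jj])

text \<open>The curvature of the connection matrices \<open>P\<close>.\<close>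

definition PF :: "real^'n \<Rightarrow> 'n \<Rightarrow> 'n \<Rightarrow> 'n \<Rightarrow> 'n \<Rightarrow> real" where
  "PF x i k p b = pd i (\<lambda>y. P y k p b) x - pd k (\<lambda>y. P y i p b) x
     + (\<Sigma> q. P x i p q * P x k q b) - (\<Sigma> q. P x k p q * P x i q b)"

text \<open>Differentiating the law \<open>gauge\<close> and antisymmetrizing removes the third derivatives of \<open>\<tau>\<close>; the terms
  \<open>V\<close> and \<open>W\<close> with second derivatives cancel against those that arise when \<open>gauge\<close> is inserted into
  the quadratic part of the curvature.\<close>

lemma curvature_op_gauge:
  assumes x: "x \<in> S"
  shows "(\<Sigma> m. j x p m * curvature_op G x m i k l) = (\<Sigma> b. PF x i k p b * j x b l)"
proof -
  let ?\<Gamma> = "christoffel G x"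
  define U where "U i k = (\<Sigma> m. j x p m * pd i (\<lambda>y. christoffel G y m k l) x)" for i k
  define V where "V i k = (\<Sigma> m. jj x i p m * ?\<Gamma> m k l)" for i k
  define W where "W i k = (\<Sigma> b. P x i p b * jj x k b l)" for i k
  define X where "X i k = (\<Sigma> b. pd i (\<lambda>y. P y k p b) x * j x b l)" for i k
  define Y where "Y i k = (\<Sigma> b. (\<Sigma> q. P x i p q * P x k q b) * j x b l)" for i k
  define Q where "Q i k = (\<Sigma> m. j x p m * (\<Sigma> n. ?\<Gamma> n k l * ?\<Gamma> m i n))" for i k
  have 1: "V i k + U i k = X i k + W k i + pd i (\<lambda>y. jj y k p l) x" for i k
  proof -
    have "pd i (\<lambda>y. \<Sigma> m. j y p m * christoffel G y m k l) x
       = pd i (\<lambda>y. (\<Sigma> b. P y k p b * j y b l) + jj y k p l) x"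
      by (rule pd_cong[OF A.open_S x]) (rule gauge)
    then show ?thesis
      using diff_j[OF x] diff_P[OF x] diff_jj[OF x] A.diff(3)[OF x]
      by (simp add: pd_add pd_sum pd_mult sum.distrib U_def V_def W_def X_def jj_def[symmetric])
  qed
  have 2: "pd i (\<lambda>y. jj y k p l) x = pd k (\<lambda>y. jj y i p l) x"
  proof -
    have "pd i (\<lambda>y. jj y k p l) x = pd i (pd k (\<lambda>y. j y p l)) x" for i k
      unfolding jj_def ..
    then show ?thesis using pd_commute[OF A.open_S x smooth_j, of i k p l] by simp
  qed
  have 3: "Q i k = Y i k + W i k + V i k" for i k
  proof -
    have "Q i k = (\<Sigma> n. (\<Sigma> m. j x p m * ?\<Gamma> m i n) * ?\<Gamma> n k l)"
      unfolding Q_def sum_distrib_left sum_distrib_right by (subst sum.swap) (simp add: mult_ac)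
    also have "\<dots> = (\<Sigma> n b. P x i p b * (j x b n * ?\<Gamma> n k l)) + V i k"
      unfolding gauge[OF x] V_def by (simp add: distrib_right sum.distrib sum_distrib_right mult.assoc)
    also have "(\<Sigma> n b. P x i p b * (j x b n * ?\<Gamma> n k l)) = (\<Sigma> b. P x i p b * (\<Sigma> n. j x b n * ?\<Gamma> n k l))"
      by (subst sum.swap) (simp add: sum_distrib_left)
    also have "\<dots> = (\<Sigma> b q. P x i p b * P x k b q * j x q l) + W i k"
      unfolding gauge[OF x] W_def by (simp add: distrib_left sum.distrib sum_distrib_left mult.assoc)
    also have "(\<Sigma> b q. P x i p b * P x k b q * j x q l) = Y i k"
      unfolding Y_def sum_distrib_right by (rule sum.swap)
    finally show ?thesis .
  qed
  have "(\<Sigma> m. j x p m * curvature_op G x m i k l) = U i k - U k i + Q i k - Q k i"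
    unfolding curvature_op_def U_def Q_def
    by (simp add: distrib_left right_diff_distrib sum.distrib sum_subtractf)
  also have "\<dots> = X i k - X k i + Y i k - Y k i"
    using 1[of i k] 1[of k i] 2 3[of i k] 3[of k i] by linarith
  also have "\<dots> = (\<Sigma> b. PF x i k p b * j x b l)"
    unfolding PF_def X_def Y_def by (simp add: distrib_right left_diff_distrib sum.distrib sum_subtractf)
  finally show ?thesis .
qed

lemma PF_eq:
  assumes x: "x \<in> S"
  shows "PF x i k p b = (\<Sigma> a d. curvature_op H (\<tau> x) p a d b * j x a i * j x d k)"
proof -
  let ?\<Gamma> = "christoffel H (\<tau> x)"
  define Z where "Z i k = (\<Sigma> a d. pd a (\<lambda>y. christoffel H y p d b) (\<tau> x) * j x a i * j x d k)" for i k
  define Y where "Y i k = (\<Sigma> a. ?\<Gamma> p a b * jj x i a k)" for i k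
  define Q where "Q i k = (\<Sigma> a d. (\<Sigma> q. ?\<Gamma> q d b * ?\<Gamma> p a q) * j x a i * j x d k)" for i k
  have 1: "pd i (\<lambda>y. P y k p b) x = Z i k + Y i k" for i k
  proof -
    have "pd i (\<lambda>y. P y k p b) x = (\<Sigma> d. (\<Sigma> a. j x a i * pd a (\<lambda>y. christoffel H y p d b) (\<tau> x)) * j x d k) + Y i k"
      unfolding P_def Y_def using diff_christoffel_\<tau>[OF x] diff_j[OF x]
      by (simp add: pd_sum pd_mult pd_compose_\<tau>[OF x B.diff(3)[OF \<tau>_range[OF x]]] sum.distrib jj_def[symmetric])
    also have "(\<Sigma> d. (\<Sigma> a. j x a i * pd a (\<lambda>y. christoffel H y p d b) (\<tau> x)) * j x d k) = Z i k"
      unfolding Z_def sum_distrib_right by (subst sum.swap) (simp add: mult_ac)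
    finally show ?thesis .
  qed
  have 2: "(\<Sigma> q. P x i p q * P x k q b) = Q i k" for i k
  proof -
    have "(\<Sigma> q. P x i p q * P x k q b) = (\<Sigma> q a d. ?\<Gamma> q d b * ?\<Gamma> p a q * j x a i * j x d k)"
      unfolding P_def by (simp add: sum_product mult_ac)
    also have "\<dots> = (\<Sigma> a d q. ?\<Gamma> q d b * ?\<Gamma> p a q * j x a i * j x d k)"
      by (subst sum.swap) (intro sum.cong refl sum.swap)
    finally show ?thesis unfolding Q_def by (simp add: sum_distrib_right)
  qed
  have 3: "Y i k = Y k i" unfolding Y_def by (simp add: jj_sym[OF x, of i])
  have 4: "Z k i = (\<Sigma> a d. pd d (\<lambda>y. christoffel H y p a b) (\<tau> x) * j x a i * j x d k)"
    unfolding Z_def by (subst sum.swap) (simp add: mult_ac)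
  have 5: "Q k i = (\<Sigma> a d. (\<Sigma> q. ?\<Gamma> q a b * ?\<Gamma> p d q) * j x a i * j x d k)"
    unfolding Q_def by (subst sum.swap) (simp add: mult_ac)
  have "PF x i k p b = Z i k - Z k i + Q i k - Q k i"
    unfolding PF_def 1 2 using 3 by simp
  also have "\<dots> = (\<Sigma> a d. curvature_op H (\<tau> x) p a d b * j x a i * j x d k)"
    unfolding 4 5 unfolding Z_def Q_def curvature_op_def
    by (simp add: sum.distrib sum_subtractf distrib_right left_diff_distrib)
  finally show ?thesis .
qed

theorem curvature_transform:
  assumes x: "x \<in> S"
  shows "curvature G x [i, a, b, k]
    = (\<Sigma> p. j x p i * (\<Sigma> c. j x c a * (\<Sigma> d. j x d b * (\<Sigma> q. j x q k * curvature H (\<tau> x) [p, c, d, q]))))"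
proof -
  let ?h = "\<lambda>r q. H (\<tau> x) $ r $ q"
  have "curvature G x [i, a, b, k] = (\<Sigma> m r q. j x r m * curvature_op G x m i a b * (?h r q * j x q k))"
    unfolding A.curvature4 g_eq[OF x] by (simp add: sum_distrib_left mult_ac)
  also have "\<dots> = (\<Sigma> r q m. j x r m * curvature_op G x m i a b * (?h r q * j x q k))"
    by (subst sum.swap) (intro sum.cong refl sum.swap)
  also have "\<dots> = (\<Sigma> r q. (\<Sigma> d. PF x i a r d * j x d b) * (?h r q * j x q k))"
    unfolding curvature_op_gauge[OF x, symmetric] by (simp add: sum_distrib_right)
  also have "\<dots> = (\<Sigma> r q. \<Sigma> d p. \<Sigma> c.
      curvature_op H (\<tau> x) r p c d * ?h r q * (j x p i * j x c a * j x d b * j x q k))"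
    unfolding PF_eq[OF x] by (simp add: sum_distrib_left sum_distrib_right mult_ac)
  also have "\<dots> = (\<Sigma> q d. \<Sigma> r p. \<Sigma> c.
      curvature_op H (\<tau> x) r p c d * ?h r q * (j x p i * j x c a * j x d b * j x q k))"
    by (subst sum.swap) (intro sum.cong refl sum.swap)
  also have "\<dots> = (\<Sigma> q d. \<Sigma> p c. \<Sigma> r.
      curvature_op H (\<tau> x) r p c d * ?h r q * (j x p i * j x c a * j x d b * j x q k))"
  proof (rule sum.cong[OF refl], rule sum.cong[OF refl])
    fix q d
    show "(\<Sigma> r p c. curvature_op H (\<tau> x) r p c d * ?h r q * (j x p i * j x c a * j x d b * j x q k))
      = (\<Sigma> p c r. curvature_op H (\<tau> x) r p c d * ?h r q * (j x p i * j x c a * j x d b * j x q k))"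
      by (subst sum.swap) (intro sum.cong refl sum.swap)
  qed
  also have "\<dots> = (\<Sigma> q d. \<Sigma> p c. curvature H (\<tau> x) [p, c, d, q] * (j x p i * j x c a * j x d b * j x q k))"
    unfolding B.curvature4 by (simp add: sum_distrib_right)
  also have "\<dots> = (\<Sigma> q p. \<Sigma> c d. curvature H (\<tau> x) [p, c, d, q] * (j x p i * j x c a * j x d b * j x q k))"
  proof (rule sum.cong[OF refl])
    fix q
    show "(\<Sigma> d p c. curvature H (\<tau> x) [p, c, d, q] * (j x p i * j x c a * j x d b * j x q k))
      = (\<Sigma> p c d. curvature H (\<tau> x) [p, c, d, q] * (j x p i * j x c a * j x d b * j x q k))"
      by (subst sum.swap) (intro sum.cong refl sum.swap)
  qed
  also have "\<dots> = (\<Sigma> p c. \<Sigma> q d. curvature H (\<tau> x) [p, c, d, q] * (j x p i * j x c a * j x d b * j x q k))"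
    by (subst sum.swap) (intro sum.cong refl sum.swap)
  also have "\<dots> = (\<Sigma> p c. \<Sigma> d q. curvature H (\<tau> x) [p, c, d, q] * (j x p i * j x c a * j x d b * j x q k))"
    by (intro sum.cong refl sum.swap)
  finally show ?thesis by (simp add: sum_distrib_left mult_ac)
qed

lemma sum_push:
  "(\<Sigma> a. v $ a * (\<Sigma> c. j x c a * f c)) = (\<Sigma> c. push x v $ c * f c)"
proof -
  have "(\<Sigma> a. v $ a * (\<Sigma> c. j x c a * f c)) = (\<Sigma> c a. v $ a * (j x c a * f c))"
    unfolding sum_distrib_left by (rule sum.swap)
  then show ?thesis by (simp add: push_def sum_distrib_right mult.assoc)
qed

lemma J0_transform:
  assumes x: "x \<in> S"
  shows "A.J0 x v i k = (\<Sigma> p. j x p i * (\<Sigma> q. j x q k * B.J0 (\<tau> x) (push x v) p q))"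
proof -
  let ?R = "\<lambda>p c d q. curvature H (\<tau> x) [p, c, d, q]"
  have a: "(\<Sigma> p. j x p i * (\<Sigma> c. j x c a * f p c)) = (\<Sigma> c. j x c a * (\<Sigma> p. j x p i * f p c))" for f i a
    by (rule sum_swap_weighted)
  have "A.J0 x v i k = (\<Sigma> a. v $ a * (\<Sigma> b. v $ b *
     (\<Sigma> c. j x c a * (\<Sigma> d. j x d b * (\<Sigma> p. j x p i * (\<Sigma> q. j x q k * ?R p c d q))))))"
  proof -
    have "curvature G x [i, a, b, k] = (\<Sigma> c. j x c a * (\<Sigma> d. j x d b * (\<Sigma> p. j x p i * (\<Sigma> q. j x q k * ?R p c d q))))" for a b
      unfolding curvature_transform[OF x]
      by (subst a, rule sum.cong[OF refl], rule arg_cong2[where f = "(*)", OF refl], rule a)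
    then show ?thesis unfolding A.J0_def by simp
  qed
  also have "\<dots> = (\<Sigma> c. push x v $ c * (\<Sigma> d. push x v $ d * (\<Sigma> p. j x p i * (\<Sigma> q. j x q k * ?R p c d q))))"
  proof -
    have "(\<Sigma> b. v $ b * (\<Sigma> c. j x c a * (\<Sigma> d. j x d b * f c d)))
       = (\<Sigma> c. j x c a * (\<Sigma> d. push x v $ d * f c d))" for a f
      by (subst sum_swap_weighted) (simp only: sum_push)
    then show ?thesis by (simp only: sum_push)
  qed
  also have "\<dots> = (\<Sigma> p. j x p i * (\<Sigma> q. j x q k * B.J0 (\<tau> x) (push x v) p q))"
  proof -
    have "(\<Sigma> d. push x v $ d * (\<Sigma> p. j x p i * (\<Sigma> q. j x q k * f d p q)))
       = (\<Sigma> p. j x p i * (\<Sigma> q. j x q k * (\<Sigma> d. push x v $ d * f d p q)))" for f :: "'n \<Rightarrow> 'n \<Rightarrow> 'n \<Rightarrow> real"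
      by (subst sum_swap_weighted, rule sum.cong[OF refl], rule arg_cong2[where f = "(*)", OF refl], rule sum_swap_weighted)
    then show ?thesis unfolding B.J0_def by (simp only:)
  qed
  finally show ?thesis .
qed

lemma tr_transform:
  assumes x: "x \<in> S"
  shows "A.tr x (\<lambda>i k. \<Sigma> p. j x p i * (\<Sigma> r. j x r k * f p r)) = B.tr (\<tau> x) f"
proof -
  let ?h = "\<lambda>i k. matrix_inv (G x) $ i $ k"
  let ?t = "\<lambda>i k p r. j x p i * ?h i k * j x r k * f p r"
  have "A.tr x (\<lambda>i k. \<Sigma> p. j x p i * (\<Sigma> r. j x r k * f p r)) = (\<Sigma> i k. \<Sigma> p r. ?t i k p r)"
    unfolding A.tr_def by (simp add: sum_distrib_left mult_ac)
  also have "\<dots> = (\<Sigma> i p. \<Sigma> k r. ?t i k p r)"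
    by (intro sum.cong refl sum.swap)
  also have "\<dots> = (\<Sigma> p i. \<Sigma> r k. ?t i k p r)"
    by (subst sum.swap) (intro sum.cong refl sum.swap)
  also have "\<dots> = (\<Sigma> p r. \<Sigma> i k. ?t i k p r)"
    by (intro sum.cong refl sum.swap)
  also have "\<dots> = (\<Sigma> p r. \<Sigma> k i. ?t i k p r)"
    by (intro sum.cong refl sum.swap)
  also have "\<dots> = B.tr (\<tau> x) f"
    unfolding B.tr_def h_eq[OF x] by (simp add: sum_distrib_right)
  finally show ?thesis .
qed

text \<open>The norm of the Jacobi operator is a function of the tangent vector alone: the factors \<open>j\<close> of the two
  Jacobi operators are absorbed by the two inverse metrics.\<close>

theorem ip_transform:
  assumes x: "x \<in> S"
  shows "A.ip x (A.J0 x v) (A.J0 x v) = B.ip (\<tau> x) (B.J0 (\<tau> x) (push x v)) (B.J0 (\<tau> x) (push x v))"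
proof -
  let ?K = "B.J0 (\<tau> x) (push x v)"
  define L where "L q i = (\<Sigma> p. j x p i * ?K p q)" for q i
  have J: "A.J0 x v i k = (\<Sigma> q. j x q k * L q i)" for i k
    unfolding J0_transform[OF x] L_def by (rule sum_swap_weighted)
  have 1: "A.tr x (\<lambda>k l. A.J0 x v i k * A.J0 x v m l) = B.tr (\<tau> x) (\<lambda>q s. L q i * L s m)" for i m
  proof -
    have "A.J0 x v i k * A.J0 x v m l = (\<Sigma> q. j x q k * (\<Sigma> s. j x s l * (L q i * L s m)))" for k l
      unfolding J sum_product by (simp add: sum_distrib_left mult_ac)
    then show ?thesis using tr_transform[OF x, of "\<lambda>q s. L q i * L s m"] by simp
  qed
  have 2: "B.tr (\<tau> x) (\<lambda>q s. L q i * L s m)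
     = (\<Sigma> p. j x p i * (\<Sigma> r. j x r m * B.tr (\<tau> x) (\<lambda>q s. ?K p q * ?K r s)))" for i m
  proof -
    let ?h = "\<lambda>q s. matrix_inv (H (\<tau> x)) $ q $ s"
    let ?t = "\<lambda>q s p r. j x p i * (j x r m * (?h q s * (?K p q * ?K r s)))"
    have "B.tr (\<tau> x) (\<lambda>q s. L q i * L s m) = (\<Sigma> q s. \<Sigma> p r. ?t q s p r)"
      unfolding B.tr_def L_def sum_product by (simp add: sum_distrib_left mult_ac)
    also have "\<dots> = (\<Sigma> q p. \<Sigma> s r. ?t q s p r)"
      by (intro sum.cong refl sum.swap)
    also have "\<dots> = (\<Sigma> p q. \<Sigma> r s. ?t q s p r)"
      by (subst sum.swap) (intro sum.cong refl sum.swap)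
    also have "\<dots> = (\<Sigma> p r. \<Sigma> q s. ?t q s p r)"
      by (intro sum.cong refl sum.swap)
    finally show ?thesis unfolding B.tr_def by (simp add: sum_distrib_left)
  qed
  show ?thesis unfolding A.ip_def B.ip_def 1 2 by (rule tr_transform[OF x])
qed

lemma gprod_transform:
  assumes x: "x \<in> S"
  shows "gprod G x u w = gprod H (\<tau> x) (push x u) (push x w)"
proof -
  have "G x $ a $ b = (\<Sigma> c. j x c a * (\<Sigma> d. j x d b * H (\<tau> x) $ c $ d))" for a b
    unfolding g_eq[OF x] by (simp add: sum_distrib_left mult_ac)
  then have "gprod G x u w = (\<Sigma> a. u $ a * (\<Sigma> b. w $ b * (\<Sigma> c. j x c a * (\<Sigma> d. j x d b * H (\<tau> x) $ c $ d))))"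
    unfolding gprod_eq by simp
  also have "\<dots> = (\<Sigma> a. u $ a * (\<Sigma> c. j x c a * (\<Sigma> d. push x w $ d * H (\<tau> x) $ c $ d)))"
  proof -
    have "(\<Sigma> b. w $ b * (\<Sigma> c. j x c a * (\<Sigma> d. j x d b * H (\<tau> x) $ c $ d)))
      = (\<Sigma> c. j x c a * (\<Sigma> d. push x w $ d * H (\<tau> x) $ c $ d))" for a
      by (subst sum_swap_weighted) (simp only: sum_push)
    then show ?thesis by (simp only:)
  qed
  also have "\<dots> = gprod H (\<tau> x) (push x u) (push x w)"
    unfolding gprod_eq by (rule sum_push)
  finally show ?thesis .
qed

end

section \<open>Geodesics on a manifold\<close>

lemma metric_on_subset: "metric_on G S \<Longrightarrow> open T \<Longrightarrow> T \<subseteq> S \<Longrightarrow> metric_on G T"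
  unfolding metric_on_def using smooth_on_subset by blast

lemma geodesic_on_subset:
  assumes "geodesic_on G S \<eta> I" "metric_on G T" "open I'" "I' \<subseteq> I" "\<And>t. t \<in> I' \<Longrightarrow> \<eta> t \<in> T"
  shows "geodesic_on G T \<eta> I'"
  using assms unfolding geodesic_on_def geodesic_on_axioms_def by blast

lemma velocity_cong:
  assumes "open I" "t \<in> I" "\<And>s. s \<in> I \<Longrightarrow> \<zeta> s = \<eta> s" "\<eta> differentiable (at t)"
  shows "velocity \<zeta> t = velocity \<eta> t"
proof -
  have "(\<eta> has_vector_derivative velocity \<eta> t) (at t)"
    unfolding velocity_def using assms(4) vector_derivative_works by blast
  then have "(\<zeta> has_vector_derivative velocity \<eta> t) (at t)"
    by (rule has_vector_derivative_transform_within_open[OF _ assms(1,2)]) (simp add: assms(3))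
  then show ?thesis unfolding velocity_def[of \<zeta>] by (rule vector_derivative_at)
qed

context pseudo_riemannian_manifold
begin

lemma chart_inv_in: "C \<in> \<A> \<Longrightarrow> x \<in> chart_image C \<Longrightarrow> chart_inv C x \<in> dom_of C"
  using chart[of C] unfolding homeomorphism_def by blast

lemma coord_chart_inv: "C \<in> \<A> \<Longrightarrow> x \<in> chart_image C \<Longrightarrow> coord C (chart_inv C x) = x"
  using chart[of C] unfolding homeomorphism_def by blast

lemma chart_inv_coord: "C \<in> \<A> \<Longrightarrow> p \<in> dom_of C \<Longrightarrow> chart_inv C (coord C p) = p"
  using chart[of C] unfolding homeomorphism_def by blast

lemma metric_on_chart: "C \<in> \<A> \<Longrightarrow> metric_on (g C) (chart_image C)"
  using chart metric_smooth metric_symmetric metric_nondegenerate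
  unfolding metric_on_def by blast

definition overlap :: "('a, 'b) chart \<Rightarrow> ('a, 'b) chart \<Rightarrow> (real^'b) set" where
  "overlap C D = coord C ` (dom_of C \<inter> dom_of D)"

lemma overlap_eq:
  assumes C: "C \<in> \<A>" shows "overlap C D = chart_image C \<inter> chart_inv C -` dom_of D"
proof
  show "overlap C D \<subseteq> chart_image C \<inter> chart_inv C -` dom_of D"
    unfolding overlap_def chart_image_def using chart_inv_coord[OF C] by auto
  show "chart_image C \<inter> chart_inv C -` dom_of D \<subseteq> overlap C D"
  proof
    fix x assume "x \<in> chart_image C \<inter> chart_inv C -` dom_of D"
    then show "x \<in> overlap C D"
      using chart_inv_in[OF C, of x] coord_chart_inv[OF C, of x] unfolding overlap_def by (metis IntD1 IntD2 IntI imageI vimageE)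
  qed
qed

lemma open_overlap:
  assumes C: "C \<in> \<A>" and D: "D \<in> \<A>" shows "open (overlap C D)"
  unfolding overlap_eq[OF C]
  using chart[OF C] chart[OF D] by (intro continuous_open_preimage) (auto simp: homeomorphism_def)

lemma chart_change:
  assumes C: "C \<in> \<A>" and D: "D \<in> \<A>"
  shows "chart_change (g C) (overlap C D) (g D) (chart_image D) (transition C D)"
proof -
  have "metric_on (g C) (overlap C D)"
    by (rule metric_on_subset[OF metric_on_chart[OF C] open_overlap[OF C D]]) (auto simp: overlap_eq[OF C])
  moreover have "transition C D x \<in> chart_image D" if "x \<in> overlap C D" for x
    using that unfolding overlap_eq[OF C] transition_def chart_image_def by auto
  ultimately show ?thesis
    unfolding chart_change_def chart_change_axioms_def
    using metric_on_chart[OF D] compatible[OF C D] metric_transforms[OF C D] overlap_def[of C D] by auto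
qed

text \<open>Restricted to the times at which a geodesic of the manifold lies in a chart, its coordinate
  expression is a geodesic.\<close>

lemma geodesic_in_chart:
  assumes geo: "geodesic \<A> g I \<gamma>" and C: "C \<in> \<A>"
  shows "geodesic_on (g C) (chart_image C) (coord C \<circ> \<gamma>) (I \<inter> \<gamma> -` dom_of C)"
proof -
  interpret metric_on "g C" "chart_image C" by (rule metric_on_chart[OF C])
  show ?thesis
  proof unfold_locales
    show "open (I \<inter> \<gamma> -` dom_of C)"
      using geo chart[OF C] unfolding geodesic_def by (intro continuous_open_preimage) auto
  qed (use geo C in \<open>auto simp: geodesic_def chart_image_def\<close>)
qed

text \<open>A geodesic of one chart is a geodesic of the manifold, since the geodesic equation is
  independent of the chart.\<close>

lemma geodesic_of_chart:
  assumes C: "C \<in> \<A>" and geo: "geodesic_on (g C) (chart_image C) \<eta> I" and I: "is_interval I"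
  shows "geodesic \<A> g I (chart_inv C \<circ> \<eta>)"
proof -
  interpret geodesic_on "g C" "chart_image C" \<eta> I by (rule geo)
  define \<gamma> where "\<gamma> = chart_inv C \<circ> \<eta>"
  have cont_\<eta>: "continuous_on I \<eta>"
    by (intro continuous_at_imp_continuous_on ballI differentiable_imp_continuous_within diff_\<eta>)
  have cont: "continuous_on I \<gamma>"
    unfolding \<gamma>_def comp_def using chart[OF C] range
    by (intro continuous_on_compose2[of "chart_image C" "chart_inv C", OF _ cont_\<eta>]) (auto simp: homeomorphism_def)
  have pts: "\<gamma> ` I \<subseteq> points \<A>"
    using chart_inv_in[OF C range] C by (auto simp: \<gamma>_def points_def)
  have "(coord D \<circ> \<gamma>) differentiable (at t) \<and> velocity (coord D \<circ> \<gamma>) differentiable (at t) \<and>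
        covd_vector (g D) (coord D \<circ> \<gamma>) (velocity (coord D \<circ> \<gamma>)) t = 0"
    if D: "D \<in> \<A>" and t: "t \<in> I" "\<gamma> t \<in> dom_of D" for D t
  proof -
    interpret cc: chart_change "g C" "overlap C D" "g D" "chart_image D" "transition C D"
      by (rule chart_change[OF C D])
    define I' where "I' = I \<inter> \<gamma> -` dom_of D"
    have "open I'" unfolding I'_def
      using chart[OF D] by (intro continuous_open_preimage cont open_I) auto
    then have "geodesic_on (g C) (overlap C D) \<eta> I'"
      by (intro geodesic_on_subset[OF geo cc.A.metric_on_axioms]) (auto simp: I'_def overlap_eq[OF C] range \<gamma>_def)
    then have "geodesic_on (g D) (chart_image D) (\<lambda>t. transition C D (\<eta> t)) I'"
      by (rule cc.geodesic_transform(1))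
    moreover have "(\<lambda>t. transition C D (\<eta> t)) = coord D \<circ> \<gamma>"
      by (simp add: transition_def \<gamma>_def comp_def)
    moreover have "t \<in> I'" using t by (simp add: I'_def)
    ultimately show ?thesis
      using geodesic_on.diff_\<eta> geodesic_on.diff_v geodesic_on.geodesic by metis
  qed
  then show ?thesis
    unfolding geodesic_def \<gamma>_def[symmetric] using open_I I cont pts by blast
qed

lemma geodesic_through:
  assumes C: "C \<in> \<A>" and x: "x \<in> chart_image C"
  shows "\<exists>\<delta> \<gamma>. 0 < \<delta> \<and> geodesic \<A> g {-\<delta><..<\<delta>} \<gamma> \<and> (\<forall>t\<in>{-\<delta><..<\<delta>}. \<gamma> t \<in> dom_of C) \<and> coord C (\<gamma> 0) = x
    \<and> velocity (coord C \<circ> \<gamma>) 0 = v"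
proof -
  interpret metric_on "g C" "chart_image C" by (rule metric_on_chart[OF C])
  obtain \<delta> \<eta> where \<delta>: "0 < \<delta>" "\<eta> 0 = x" "velocity \<eta> 0 = v" and geo: "geodesic_on (g C) (chart_image C) \<eta> {-\<delta><..<\<delta>}"
    using geodesic_exists[OF x, of v] by blast
  let ?I = "{-\<delta><..<\<delta>}"
  interpret G: geodesic_on "g C" "chart_image C" \<eta> ?I by (rule geo)
  let ?\<gamma> = "chart_inv C \<circ> \<eta>"
  have eq: "(coord C \<circ> ?\<gamma>) t = \<eta> t" if "t \<in> ?I" for t
    using coord_chart_inv[OF C G.range[OF that]] by simp
  have 0: "0 \<in> ?I" using \<delta> by simp
  have "geodesic \<A> g ?I ?\<gamma>" by (rule geodesic_of_chart[OF C geo]) (simp add: is_interval_convex_1)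
  moreover have "\<forall>t\<in>?I. ?\<gamma> t \<in> dom_of C" using chart_inv_in[OF C G.range] by simp
  moreover have "coord C (?\<gamma> 0) = x" using eq[OF 0] \<delta> by simp
  moreover have "velocity (coord C \<circ> ?\<gamma>) 0 = v"
    using velocity_cong[OF G.open_I 0 eq G.diff_\<eta>[OF 0]] \<delta>(3) by (rule trans)
  ultimately show ?thesis using \<delta>(1) by blast
qed

abbreviation "Jac0 C \<equiv> metric_on.J0 (g C)"
abbreviation "Jac1 C \<equiv> metric_on.J1 (g C)"
abbreviation "Jac2 C \<equiv> metric_on.J2 (g C)"
abbreviation "inp C \<equiv> metric_on.ip (g C)"

end

locale jacobi_manifold = pseudo_riemannian_manifold \<A> g
  for \<A> :: "('m::{t2_space, second_countable_topology}, 'n::finite) chart set" and g +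
  fixes c :: real
  assumes jacobi: "geodesic \<A> g I \<gamma> \<Longrightarrow> C \<in> \<A> \<Longrightarrow> t \<in> I \<Longrightarrow> \<gamma> t \<in> dom_of C \<Longrightarrow>
           jacobi_op2 (g C) (coord C \<circ> \<gamma>) t i j =
             c * gprod (g C) (coord C (\<gamma> t)) (velocity (coord C \<circ> \<gamma>) t) (velocity (coord C \<circ> \<gamma>) t)
               * jacobi_op (g C) (coord C \<circ> \<gamma>) t i j"
begin

text \<open>As a geodesic starts in every direction, the hypothesis is an algebraic identity between
  \<open>\<nabla>\<nabla>R\<close> and \<open>R\<close> at each point.\<close>

lemma J2_eq:
  assumes C: "C \<in> \<A>" and x: "x \<in> chart_image C"
  shows "Jac2 C x v i j = c * gprod (g C) x v v * Jac0 C x v i j"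
proof -
  obtain \<delta> \<gamma> where \<delta>: "0 < \<delta>" "coord C (\<gamma> 0) = x" "velocity (coord C \<circ> \<gamma>) 0 = v" "\<forall>t\<in>{-\<delta><..<\<delta>}. \<gamma> t \<in> dom_of C"
    and geo: "geodesic \<A> g {-\<delta><..<\<delta>} \<gamma>"
    using geodesic_through[OF C x, of v] by blast
  interpret G: geodesic_on "g C" "chart_image C" "coord C \<circ> \<gamma>" "{-\<delta><..<\<delta>} \<inter> \<gamma> -` dom_of C"
    by (rule geodesic_in_chart[OF geo C])
  have 0: "0 \<in> {-\<delta><..<\<delta>}" "\<gamma> 0 \<in> dom_of C" using \<delta> by auto
  then have "jacobi_op2 (g C) (coord C \<circ> \<gamma>) 0 i j = Jac2 C x v i j"
    using G.jacobi_op2_eq[of 0 i j] \<delta> by simp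
  moreover have "jacobi_op (g C) (coord C \<circ> \<gamma>) 0 i j = Jac0 C x v i j"
    using G.jacobi_op_eq[of 0 i j] G.A0_eq[of 0 i j] \<delta> by simp
  ultimately show ?thesis using jacobi[OF geo C 0, of i j] \<delta> by simp
qed

theorem rough_laplacian_curvature:
  assumes E: "einstein \<A> g" and C: "C \<in> \<A>" and x: "x \<in> chart_image C" and e: "orthonormal_frame (g C) x e"
    and len: "length is = 4"
  shows "rough_laplacian (g C) e (curvature (g C)) x is = - ((real CARD('n) + 4) * c / 2) * curvature (g C) x is"
proof -
  obtain r where r: "\<And>C x i j. C \<in> \<A> \<Longrightarrow> x \<in> chart_image C \<Longrightarrow> ricci (g C) x i j = r * g C x $ i $ j"
    using E unfolding einstein_def by blast
  interpret einstein_on "g C" "chart_image C" r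
    using metric_on_chart[OF C] r[OF C] by (simp add: einstein_on_def einstein_on_axioms_def)
  obtain i j k l where is4: "is = [i, j, k, l]" using list4[OF len] by blast
  have "tr x (\<lambda>p q. DDR x [p, q, i, j, k, l]) = (real CARD('n) + 4) * c / 2 * curvature (g C) x [i, j, k, l]"
  proof (rule laplacian_of_quartic[OF x])
    fix v :: "real^'n" and i j
    have 1: "(\<Sigma> d. v $ d * (\<Sigma> f. v $ f * (c * (g C x $ a $ b * curvature (g C) x [i, d, f, j]))))
        = c * (g C x $ a $ b * Jac0 C x v i j)" for a b
      unfolding J0_def by (simp add: sum_distrib_left mult_ac)
    have 2: "(\<Sigma> a. v $ a * (\<Sigma> b. v $ b * (c * (g C x $ a $ b * Jac0 C x v i j))))
        = c * gprod (g C) x v v * Jac0 C x v i j"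
      unfolding gprod_eq by (simp add: sum_distrib_left sum_distrib_right mult_ac)
    have "(\<Sigma> a. v $ a * (\<Sigma> b. v $ b * (\<Sigma> d. v $ d * (\<Sigma> f. v $ f *
      (DDR x [a, b, i, d, f, j] - c * (g C x $ a $ b * curvature (g C) x [i, d, f, j]))))))
      = Jac2 C x v i j - c * gprod (g C) x v v * Jac0 C x v i j"
      unfolding J2_def right_diff_distrib sum_subtractf 1 2 ..
    then show "(\<Sigma> a. v $ a * (\<Sigma> b. v $ b * (\<Sigma> d. v $ d * (\<Sigma> f. v $ f *
      (DDR x [a, b, i, d, f, j] - c * (g C x $ a $ b * curvature (g C) x [i, d, f, j])))))) = 0"
      using J2_eq[OF C x, of v i j] by simp
  qed
  then show ?thesis
    unfolding rough_laplacian_eq_tr[OF x e] is4 by simp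
qed

end

section \<open>Positive definite metrics\<close>

lemma gprod_add_left: "gprod G x (u + w) z = gprod G x u z + gprod G x w z"
  by (simp add: gprod_def inner_add_left)

lemma gprod_scale_left: "gprod G x (s *\<^sub>R u) z = s * gprod G x u z"
  by (simp add: gprod_def)

lemma gprod_sum_left: "gprod G x (\<Sum>u\<in>B. f u) z = (\<Sum>u\<in>B. gprod G x (f u) z)"
  by (simp add: gprod_def inner_sum_left)

lemma gprod_sym:
  assumes "transpose (G x) = G x" shows "gprod G x u w = gprod G x w u"
  unfolding gprod_def by (metis assms dot_lmul_matrix inner_commute vector_transpose_matrix)

text \<open>Gram-Schmidt: an orthonormal set with fewer than \<open>n\<close> elements does not span, and a vector outside its
  span provides a further element.\<close>

lemma orthonormal_frame_exists:
  fixes G :: "real^'n::finite \<Rightarrow> real^'n^'n"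
  assumes tr: "transpose (G x) = G x" and pos: "\<forall>v. v \<noteq> 0 \<longrightarrow> 0 < gprod G x v v"
  shows "\<exists>e. orthonormal_frame G x e"
proof -
  let ?b = "gprod G x"
  note sym = gprod_sym[of G x, OF tr]
  have "\<exists>B. finite B \<and> card B = k \<and> (\<forall>u\<in>B. ?b u u = 1) \<and> (\<forall>u\<in>B. \<forall>w\<in>B. u \<noteq> w \<longrightarrow> ?b u w = 0)"
    if "k \<le> CARD('n)" for k
    using that
  proof (induction k)
    case 0
    then show ?case by (intro exI[of _ "{}"]) simp
  next
    case (Suc k)
    then obtain B where B: "finite B" "card B = k" "\<forall>u\<in>B. ?b u u = 1" "\<forall>u\<in>B. \<forall>w\<in>B. u \<noteq> w \<longrightarrow> ?b u w = 0"
      by auto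
    have "\<not> UNIV \<subseteq> span B"
    proof
      assume "UNIV \<subseteq> span B"
      then have "dim (UNIV :: (real^'n) set) \<le> card B" by (rule dim_le_card[OF _ B(1)])
      then show False using Suc.prems B(2) by simp
    qed
    then obtain v where v: "v \<notin> span B" by blast
    define w where "w = v - (\<Sum>u\<in>B. ?b v u *\<^sub>R u)"
    have w: "w \<notin> span B"
    proof
      assume "w \<in> span B"
      moreover have "(\<Sum>u\<in>B. ?b v u *\<^sub>R u) \<in> span B" by (intro span_sum span_scale span_base)
      ultimately have "w + (\<Sum>u\<in>B. ?b v u *\<^sub>R u) \<in> span B" by (rule span_add)
      then show False using v by (simp add: w_def)
    qed
    have w0: "w \<noteq> 0" using w span_zero by metis
    have orth: "?b w z = 0" if z: "z \<in> B" for z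
    proof -
      have "?b v z = ?b w z + (\<Sum>u\<in>B. ?b v u * ?b u z)"
        using gprod_add_left[of G x w "\<Sum>u\<in>B. ?b v u *\<^sub>R u" z]
        by (simp add: w_def gprod_sum_left gprod_scale_left)
      moreover have "(\<Sum>u\<in>B. ?b v u * ?b u z) = (\<Sum>u\<in>B. if u = z then ?b v u else 0)"
        using B(3,4) z by (intro sum.cong refl) auto
      ultimately show ?thesis using z B(1) by simp
    qed
    define s where "s = 1 / sqrt (?b w w)"
    define e where "e = s *\<^sub>R w"
    have s: "s > 0" "s * (s * ?b w w) = 1"
      using pos[rule_format, OF w0] by (auto simp: s_def field_simps)
    have "?b e e = 1"
      using s(2) sym[of w e] gprod_scale_left[of G x s w w] gprod_scale_left[of G x s w e] by (simp add: e_def)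
    moreover have "?b e z = 0" "?b z e = 0" if "z \<in> B" for z
      using orth[OF that] sym[of z e] by (simp_all add: e_def gprod_scale_left)
    moreover have "e \<notin> B"
    proof
      assume "e \<in> B"
      then have "(1 / s) *\<^sub>R e \<in> span B" by (intro span_scale span_base)
      then show False using w s(1) by (simp add: e_def)
    qed
    ultimately show ?case
      using B by (intro exI[of _ "insert e B"]) auto
  qed
  then obtain B where B: "finite B" "card B = CARD('n)" "\<forall>u\<in>B. ?b u u = 1" "\<forall>u\<in>B. \<forall>w\<in>B. u \<noteq> w \<longrightarrow> ?b u w = 0"
    by blast
  then obtain e where e: "bij_betw e (UNIV :: 'n set) B"
    using finite_same_card_bij[of "UNIV :: 'n set" B] by auto
  have "e i \<in> B" for i using e bij_betwE by blast
  moreover have "e i \<noteq> e k" if "i \<noteq> k" for i k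
    using that bij_betw_imp_inj_on[OF e] by (simp add: inj_eq)
  ultimately have "orthonormal_frame G x e"
    unfolding orthonormal_frame_def using B(3,4) by simp
  then show ?thesis by blast
qed

lemma second_derivative_at_max:
  fixes \<theta> \<theta>1 :: "real \<Rightarrow> real"
  assumes d: "d > 0" and max: "\<And>t. \<bar>t\<bar> < d \<Longrightarrow> \<theta> t \<le> \<theta> 0"
    and D1: "\<And>t. \<bar>t\<bar> < d \<Longrightarrow> (\<theta> has_real_derivative \<theta>1 t) (at t)"
    and D2: "(\<theta>1 has_real_derivative D) (at 0)"
  shows "D \<le> 0"
proof (rule ccontr)
  assume "\<not> D \<le> 0"
  then have D: "D > 0" by simp
  have "\<theta>1 0 = 0"
    by (rule DERIV_local_max[OF D1[of 0] d]) (use d max in auto)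
  obtain d' where d': "d' > 0" "\<And>h. 0 < h \<Longrightarrow> h < d' \<Longrightarrow> \<theta>1 0 < \<theta>1 (0 + h)"
    using DERIV_pos_inc_right[OF D2 D] by blast
  define b where "b = min d d' / 2"
  have b: "0 < b" "b < d" "b < d'" using d d' by (auto simp: b_def)
  obtain z where z: "0 < z" "z < b" "\<theta> b - \<theta> 0 = (b - 0) * \<theta>1 z"
    using MVT2[of 0 b \<theta> \<theta>1] b D1 by auto
  have "\<theta>1 z > 0" using d'(2)[of z] z b \<open>\<theta>1 0 = 0\<close> by simp
  then have "(b - 0) * \<theta>1 z > 0" using b by simp
  then show False using z(3) max[of b] b by simp
qed

context metric_on
begin

lemma tr_frame:
  assumes x: "x \<in> S" and e: "orthonormal_frame G x e" and pos: "\<forall>v. v \<noteq> 0 \<longrightarrow> 0 < gprod G x v v"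
  shows "tr x f = (\<Sigma> p i k. e p $ i * e p $ k * f i k)"
proof -
  have "gprod G x (e p) (e p) = 1" for p
  proof -
    have "gprod G x (e p) (e p) \<in> {1, -1}" using e unfolding orthonormal_frame_def by blast
    then show ?thesis using pos by (cases "e p = 0") (auto simp: gprod_def)
  qed
  then have "tr x f = (\<Sigma> i k p. e p $ i * e p $ k * f i k)"
    unfolding tr_def frame_inverse_metric[OF x e, symmetric] by (simp add: sum_distrib_right)
  also have "\<dots> = (\<Sigma> i p k. e p $ i * e p $ k * f i k)"
    by (intro sum.cong refl sum.swap)
  also have "\<dots> = (\<Sigma> p i k. e p $ i * e p $ k * f i k)"
    by (rule sum.swap)
  finally show ?thesis .
qed

text \<open>In an orthonormal frame the inner product is the Frobenius norm, which shows that it is positive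
  definite.\<close>

lemma ip_frame:
  assumes x: "x \<in> S" and e: "orthonormal_frame G x e" and pos: "\<forall>v. v \<noteq> 0 \<longrightarrow> 0 < gprod G x v v"
  shows "ip x A A = (\<Sigma> p q. (\<Sigma> i. e p $ i * (\<Sigma> j. e q $ j * A i j))\<^sup>2)"
proof -
  define X where "X q i = (\<Sigma> j. e q $ j * A i j)" for q i
  have "tr x (\<lambda>j l. A i j * A k l) = (\<Sigma> q. X q i * X q k)" for i k
    unfolding tr_frame[OF assms] X_def by (simp add: sum_product mult_ac)
  then have "ip x A A = (\<Sigma> p i. \<Sigma> k q. e p $ i * X q i * (e p $ k * X q k))"
    unfolding ip_def tr_frame[OF assms] by (simp add: sum_distrib_left mult_ac)
  also have "\<dots> = (\<Sigma> p i. \<Sigma> q k. e p $ i * X q i * (e p $ k * X q k))"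
    by (intro sum.cong refl sum.swap)
  also have "\<dots> = (\<Sigma> p q. \<Sigma> i k. e p $ i * X q i * (e p $ k * X q k))"
    by (intro sum.cong refl sum.swap)
  also have "\<dots> = (\<Sigma> p q. (\<Sigma> i. e p $ i * X q i)\<^sup>2)"
    by (simp add: power2_eq_square sum_product)
  finally show ?thesis unfolding X_def .
qed

lemma frame_separates:
  assumes x: "x \<in> S" and e: "orthonormal_frame G x e" and zero: "\<And>p. (\<Sigma> i. e p $ i * f i) = 0"
  shows "f k = 0"
proof -
  have "(\<Sigma> m. f m * h x m a) = (\<Sigma> m p. gprod G x (e p) (e p) * (e p $ a) * (e p $ m * f m))" for a
    unfolding frame_inverse_metric[OF x e, symmetric] by (simp add: sum_distrib_left mult_ac)
  also have "\<dots> a = (\<Sigma> p. gprod G x (e p) (e p) * (e p $ a) * (\<Sigma> m. e p $ m * f m))" for a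
    by (subst sum.swap) (simp add: sum_distrib_left)
  finally have "(\<Sigma> m. f m * h x m a) = 0" for a by (simp add: zero)
  then have "(\<Sigma> a. (\<Sigma> m. f m * h x m a) * g x a k) = 0" by simp
  then show ?thesis using contract_hg[OF x, of f k] by (simp add: sum_distrib_right)
qed

lemma ip_nonneg:
  assumes x: "x \<in> S" and pos: "\<forall>v. v \<noteq> 0 \<longrightarrow> 0 < gprod G x v v"
  shows "0 \<le> ip x A A"
proof -
  obtain e where e: "orthonormal_frame G x e" using orthonormal_frame_exists[of G x, OF transpose_G[OF x] pos] by blast
  show ?thesis unfolding ip_frame[OF x e pos] by (intro sum_nonneg) simp
qed

lemma ip_eq_zero:
  assumes x: "x \<in> S" and pos: "\<forall>v. v \<noteq> 0 \<longrightarrow> 0 < gprod G x v v" and zero: "ip x A A = 0"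
  shows "A i j = 0"
proof -
  obtain e where e: "orthonormal_frame G x e" using orthonormal_frame_exists[of G x, OF transpose_G[OF x] pos] by blast
  have "(\<Sigma> i. e p $ i * (\<Sigma> j. e q $ j * A i j)) = 0" for p q
  proof -
    have "(\<Sigma> q. (\<Sigma> i. e p $ i * (\<Sigma> j. e q $ j * A i j))\<^sup>2) = 0"
      using zero unfolding ip_frame[OF x e pos] by (subst (asm) sum_nonneg_eq_0_iff) (auto intro: sum_nonneg)
    then have "(\<Sigma> i. e p $ i * (\<Sigma> j. e q $ j * A i j))\<^sup>2 = 0"
      by (subst (asm) sum_nonneg_eq_0_iff) auto
    then show ?thesis by simp
  qed
  then have "(\<Sigma> j. e q $ j * A i j) = 0" for q i
    by (rule frame_separates[OF x e])
  then show ?thesis by (rule frame_separates[OF x e])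
qed

lemma J0_scale: "J0 x (s *\<^sub>R v) i j = s\<^sup>2 * J0 x v i j"
  unfolding J0_def by (simp add: sum_distrib_left power2_eq_square mult_ac)

lemma J1_scale: "J1 x (s *\<^sub>R v) i j = s ^ 3 * J1 x v i j"
  unfolding J1_def by (simp add: sum_distrib_left power3_eq_cube mult_ac del: nabla.simps)

lemma gprod_scale: "gprod G x (s *\<^sub>R v) (s *\<^sub>R v) = s\<^sup>2 * gprod G x v v"
  unfolding gprod_eq by (simp add: sum_distrib_left power2_eq_square mult_ac)

lemma exists_unit_multiple:
  assumes "0 < gprod G x v v"
  shows "\<exists>s. s \<noteq> 0 \<and> gprod G x (s *\<^sub>R v) (s *\<^sub>R v) = 1"
  using assms by (intro exI[of _ "1 / sqrt (gprod G x v v)"]) (simp add: gprod_scale power_divide)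

lemma continuous_on_fst_component: "continuous_on S f \<Longrightarrow> continuous_on (S \<times> UNIV) (\<lambda>z. f (fst z))"
  by (rule continuous_on_compose2[of S f]) (auto intro: continuous_intros)

lemma continuous_on_snd_component: "continuous_on T (\<lambda>z. snd z $ a)"
  by (intro continuous_intros)

lemma continuous_J0: "continuous_on (S \<times> UNIV) (\<lambda>z. J0 (fst z) (snd z) i j)"
  unfolding J0_def
  by (intro continuous_on_sum continuous_on_mult continuous_on_snd_component continuous_on_fst_component
      smooth_on_continuous smooth_curvature)

lemma continuous_J1: "continuous_on (S \<times> UNIV) (\<lambda>z. J1 (fst z) (snd z) i j)"
  unfolding J1_def
  by (intro continuous_on_sum continuous_on_mult continuous_on_snd_component continuous_on_fst_component
      smooth_on_continuous smooth_DR)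

lemma continuous_ip:
  assumes "\<And>i j. continuous_on (S \<times> UNIV) (\<lambda>z. A z i j)"
  shows "continuous_on (S \<times> UNIV) (\<lambda>z. ip (fst z) (A z) (A z))"
  unfolding ip_def tr_def
  by (intro continuous_on_sum continuous_on_mult continuous_on_fst_component smooth_on_continuous smooth_h assms)

lemma continuous_gprod: "continuous_on (S \<times> UNIV) (\<lambda>z. gprod G (fst z) (snd z) (snd z))"
  unfolding gprod_eq
  by (intro continuous_on_sum continuous_on_mult continuous_on_snd_component continuous_on_fst_component
      smooth_on_continuous smooth_g)

text \<open>A positive lower bound \<open>m\<close> of the metric on Euclidean unit vectors bounds the Euclidean length of
  metric unit vectors.\<close>

lemma compact_unit_vectors:
  assumes pos: "\<And>x v. x \<in> S \<Longrightarrow> v \<noteq> 0 \<Longrightarrow> 0 < gprod G x v v" and K: "cball x0 r \<subseteq> S" and r: "r \<ge> 0"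
  shows "compact {z. fst z \<in> cball x0 r \<and> gprod G (fst z) (snd z) (snd z) = 1}" (is "compact ?W")
proof -
  let ?q = "\<lambda>z. gprod G (fst z) (snd z) (snd z)"
  let ?K = "cball x0 r \<times> sphere (0 :: real^'n) 1"
  have "continuous_on ?K ?q"
    by (rule continuous_on_subset[OF continuous_gprod]) (use K in auto)
  moreover have "compact ?K" by (intro compact_Times compact_cball) simp
  moreover have "(x0, axis undefined 1) \<in> ?K" using r by (simp add: norm_axis_1)
  ultimately obtain z0 where z0: "z0 \<in> ?K" "\<And>z. z \<in> ?K \<Longrightarrow> ?q z0 \<le> ?q z"
    using continuous_attains_inf[of ?K ?q] by blast
  define m where "m = ?q z0"
  have m: "m > 0" unfolding m_def by (rule pos) (use z0(1) K in auto)
  define \<rho> where "\<rho> = 1 / m + 1"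
  have bound: "norm v \<le> \<rho>" if x: "x \<in> cball x0 r" and v: "gprod G x v v = 1" for x v
  proof -
    have v0: "v \<noteq> 0" using v by (auto simp: gprod_def)
    let ?u = "(1 / norm v) *\<^sub>R v"
    have "(x, ?u) \<in> ?K" using x v0 by simp
    then have "m \<le> gprod G x ?u ?u" unfolding m_def using z0(2)[of "(x, ?u)"] by simp
    then have "m \<le> (1 / norm v)\<^sup>2" unfolding gprod_scale v by simp
    then have "m * (norm v)\<^sup>2 \<le> 1" using v0 by (simp add: field_simps power_divide)
    then have "(norm v)\<^sup>2 \<le> 1 / m" using m by (simp add: field_simps)
    moreover have "norm v \<le> (norm v)\<^sup>2 + 1"
      using zero_le_power2[of "norm v - 1", unfolded power2_diff power_one mult_1_right] norm_ge_zero[of v] by linarith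
    ultimately show ?thesis unfolding \<rho>_def by linarith
  qed
  let ?B = "cball x0 r \<times> cball (0 :: real^'n) \<rho>"
  have B: "compact ?B" by (intro compact_Times compact_cball)
  have "?W = {z \<in> ?B. ?q z = 1}" using bound by (auto simp: mem_Times_iff)
  moreover have "closed {z \<in> ?B. ?q z = 1}"
    by (rule continuous_closed_preimage_constant[OF _ compact_imp_closed[OF B]])
      (rule continuous_on_subset[OF continuous_gprod], use K in auto)
  moreover have "bounded {z \<in> ?B. ?q z = 1}"
    by (rule bounded_subset[OF compact_imp_bounded[OF B]]) auto
  ultimately show ?thesis by (simp add: compact_eq_bounded_closed)
qed

end

section \<open>Compact Riemannian manifolds\<close>

context pseudo_riemannian_manifold
begin

abbreviation "unit C x v \<equiv> gprod (g C) x v v = 1"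
abbreviation "push C D \<equiv> chart_change.push (transition C D)"

text \<open>The squared norms of the Jacobi operator and of its covariant derivative, as functions on the tangent
  bundle; a tangent vector is given by a chart, a point and its components.\<close>

definition F where "F C x v = inp C x (Jac0 C x v) (Jac0 C x v)"
definition \<Psi> where "\<Psi> C x v = inp C x (Jac1 C x v) (Jac1 C x v)"

lemma unit_transform:
  assumes "C \<in> \<A>" "D \<in> \<A>" "x \<in> overlap C D"
  shows "gprod (g C) x v v = gprod (g D) (transition C D x) (push C D x v) (push C D x v)"
  by (rule chart_change.gprod_transform[OF chart_change[OF assms(1,2)] assms(3)])

lemma F_transform:
  assumes "C \<in> \<A>" "D \<in> \<A>" "x \<in> overlap C D"
  shows "F C x v = F D (transition C D x) (push C D x v)"
  unfolding F_def by (rule chart_change.ip_transform[OF chart_change[OF assms(1,2)] assms(3)])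

lemma continuous_F: "C \<in> \<A> \<Longrightarrow> continuous_on (chart_image C \<times> UNIV) (\<lambda>z. F C (fst z) (snd z))"
  unfolding F_def
  by (rule metric_on.continuous_ip[OF metric_on_chart metric_on.continuous_J0[OF metric_on_chart]])

lemma continuous_\<Psi>: "C \<in> \<A> \<Longrightarrow> continuous_on (chart_image C \<times> UNIV) (\<lambda>z. \<Psi> C (fst z) (snd z))"
  unfolding \<Psi>_def
  by (rule metric_on.continuous_ip[OF metric_on_chart metric_on.continuous_J1[OF metric_on_chart]])

text \<open>The unit tangent bundle is compact: by compactness of the manifold, it is covered by finitely many sets
  \<open>W p\<close> of unit vectors over closed coordinate balls. A function that is continuous in every chart and
  independent of the chart attains its maximum on each of them.\<close>

lemma attains_max:
  assumes comp: "compact (points \<A>)" and R: "riemannian \<A> g" and C0: "C0 \<in> \<A>" and x0: "x0 \<in> chart_image C0"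
    and cont: "\<And>C. C \<in> \<A> \<Longrightarrow> continuous_on (chart_image C \<times> UNIV) (\<lambda>z. \<Theta> C (fst z) (snd z) :: real)"
    and inv: "\<And>C D x v. C \<in> \<A> \<Longrightarrow> D \<in> \<A> \<Longrightarrow> x \<in> overlap C D \<Longrightarrow> unit C x v \<Longrightarrow>
      \<Theta> C x v = \<Theta> D (transition C D x) (push C D x v)"
  shows "\<exists>C\<in>\<A>. \<exists>x\<in>chart_image C. \<exists>v. unit C x v \<and>
    (\<forall>D\<in>\<A>. \<forall>y\<in>chart_image D. \<forall>w. unit D y w \<longrightarrow> \<Theta> D y w \<le> \<Theta> C x v)"
proof -
  have "\<exists>C r. C \<in> \<A> \<and> p \<in> dom_of C \<and> r > 0 \<and> cball (coord C p) r \<subseteq> chart_image C" if p: "p \<in> points \<A>" for p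
  proof -
    obtain C where C: "C \<in> \<A>" "p \<in> dom_of C" using p unfolding points_def by auto
    then have "coord C p \<in> chart_image C" by (simp add: chart_image_def)
    then obtain r where "r > 0" "cball (coord C p) r \<subseteq> chart_image C"
      using chart[OF C(1)] open_contains_cball by blast
    then show ?thesis using C by blast
  qed
  then obtain Ch r where Ch: "\<And>p. p \<in> points \<A> \<Longrightarrow> Ch p \<in> \<A> \<and> p \<in> dom_of (Ch p) \<and> r p > 0
      \<and> cball (coord (Ch p) p) (r p) \<subseteq> chart_image (Ch p)"
    by metis
  define N where "N p = dom_of (Ch p) \<inter> coord (Ch p) -` ball (coord (Ch p) p) (r p)" for p
  have "open (N p)" if "p \<in> points \<A>" for p
    unfolding N_def using chart[of "Ch p"] Ch[OF that]
    by (intro continuous_open_preimage) (auto simp: homeomorphism_def)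
  moreover have "points \<A> \<subseteq> (\<Union>p\<in>points \<A>. N p)" using Ch by (auto simp: N_def)
  ultimately obtain P where P: "P \<subseteq> points \<A>" "finite P" "points \<A> \<subseteq> (\<Union>p\<in>P. N p)"
    using compactE_image[OF comp, of "points \<A>" N] by metis
  define W where "W p = {z. fst z \<in> cball (coord (Ch p) p) (r p) \<and> unit (Ch p) (fst z) (snd z)}" for p
  have pos: "0 < gprod (g C) x v v" if "C \<in> \<A>" "x \<in> chart_image C" "v \<noteq> 0" for C x v
    using R that unfolding riemannian_def by blast
  have W: "compact (W p)" if "p \<in> P" for p
  proof -
    have p: "Ch p \<in> \<A>" "r p > 0" "cball (coord (Ch p) p) (r p) \<subseteq> chart_image (Ch p)" using Ch P(1) that by blast+
    interpret metric_on "g (Ch p)" "chart_image (Ch p)" by (rule metric_on_chart[OF p(1)])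
    show ?thesis unfolding W_def
      by (rule compact_unit_vectors[OF pos[OF p(1)] p(3)]) (use p(2) in auto)
  qed
  have ne: "W p \<noteq> {}" if "p \<in> P" for p
  proof -
    have p: "Ch p \<in> \<A>" "r p > 0" "cball (coord (Ch p) p) (r p) \<subseteq> chart_image (Ch p)" using Ch P(1) that by blast+
    interpret metric_on "g (Ch p)" "chart_image (Ch p)" by (rule metric_on_chart[OF p(1)])
    let ?x = "coord (Ch p) p"
    have x: "?x \<in> chart_image (Ch p)" using p by auto
    have "axis undefined 1 \<noteq> (0 :: real^'b)" by (metis norm_axis_1 norm_zero zero_neq_one)
    then obtain s where "unit (Ch p) ?x (s *\<^sub>R axis undefined 1)"
      using exists_unit_multiple[OF pos[OF p(1) x]] by blast
    then have "(?x, s *\<^sub>R axis undefined 1) \<in> W p" using p(2) by (simp add: W_def)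
    then show ?thesis by blast
  qed
  have "\<exists>z\<in>W p. \<forall>w\<in>W p. \<Theta> (Ch p) (fst w) (snd w) \<le> \<Theta> (Ch p) (fst z) (snd z)" if "p \<in> P" for p
  proof (rule continuous_attains_sup[OF W[OF that] ne[OF that]])
    have p: "Ch p \<in> \<A>" "cball (coord (Ch p) p) (r p) \<subseteq> chart_image (Ch p)" using Ch P(1) that by blast+
    show "continuous_on (W p) (\<lambda>z. \<Theta> (Ch p) (fst z) (snd z))"
      by (rule continuous_on_subset[OF cont[OF p(1)]]) (use p(2) in \<open>auto simp: W_def mem_Times_iff\<close>)
  qed
  then obtain Z where Z: "\<And>p. p \<in> P \<Longrightarrow> Z p \<in> W p"
    "\<And>p w. p \<in> P \<Longrightarrow> w \<in> W p \<Longrightarrow> \<Theta> (Ch p) (fst w) (snd w) \<le> \<Theta> (Ch p) (fst (Z p)) (snd (Z p))"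
    by metis
  define M where "M p = \<Theta> (Ch p) (fst (Z p)) (snd (Z p))" for p
  have "chart_inv C0 x0 \<in> points \<A>" using chart_inv_in[OF C0 x0] C0 by (auto simp: points_def)
  then have "P \<noteq> {}" using P(3) by blast
  then have fin: "finite (M ` P)" "M ` P \<noteq> {}" using P(2) by auto
  obtain p where p: "p \<in> P" "M p = Max (M ` P)" using Max_in[OF fin] by auto
  have pA: "Ch p \<in> \<A>" "cball (coord (Ch p) p) (r p) \<subseteq> chart_image (Ch p)" using Ch P(1) p(1) by blast+
  have zW: "fst (Z p) \<in> chart_image (Ch p)" "unit (Ch p) (fst (Z p)) (snd (Z p))"
    using Z(1)[OF p(1)] pA(2) by (auto simp: W_def)
  have "\<Theta> D y w \<le> M p" if D: "D \<in> \<A>" and y: "y \<in> chart_image D" and w: "unit D y w" for D y w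
  proof -
    let ?q = "chart_inv D y"
    have "?q \<in> points \<A>" using chart_inv_in[OF D y] D by (auto simp: points_def)
    then obtain p' where p': "p' \<in> P" "?q \<in> N p'" using P(3) by blast
    have pA': "Ch p' \<in> \<A>" using Ch P(1) p'(1) by blast
    have o: "y \<in> overlap D (Ch p')" using y p'(2) unfolding overlap_eq[OF D] N_def by simp
    have "(transition D (Ch p') y, push D (Ch p') y w) \<in> W p'"
      using p'(2) w unit_transform[OF D pA' o, of w] by (simp add: W_def N_def transition_def)
    from Z(2)[OF p'(1) this] have "\<Theta> D y w \<le> M p'"
      using inv[OF D pA' o w] by (simp add: M_def)
    also have "\<dots> \<le> M p" unfolding p(2) using fin p'(1) by simp
    finally show ?thesis .
  qed
  then show ?thesis using pA(1) zW unfolding M_def by blast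
qed

end

context jacobi_manifold
begin

text \<open>Functions of a tangent vector, evaluated at the velocity of a curve that is given in a chart.\<close>

abbreviation (input) speed where "speed C \<eta> t \<equiv> gprod (g C) (\<eta> t) (velocity \<eta> t) (velocity \<eta> t)"
abbreviation (input) F_at where "F_at C \<eta> t \<equiv> F C (\<eta> t) (velocity \<eta> t)"
abbreviation (input) \<Psi>_at where "\<Psi>_at C \<eta> t \<equiv> \<Psi> C (\<eta> t) (velocity \<eta> t)"
abbreviation (input) Jac0_at where "Jac0_at C \<eta> t \<equiv> Jac0 C (\<eta> t) (velocity \<eta> t)"
abbreviation (input) Jac1_at where "Jac1_at C \<eta> t \<equiv> Jac1 C (\<eta> t) (velocity \<eta> t)"
abbreviation (input) Jac2_at where "Jac2_at C \<eta> t \<equiv> Jac2 C (\<eta> t) (velocity \<eta> t)"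

text \<open>Along a geodesic \<open>F' = 2 \<langle>\<nabla>\<^sub>vR\<^sub>v, R\<^sub>v\<rangle>\<close>, and the hypothesis expresses \<open>F''\<close> and \<open>\<Psi>'\<close> by \<open>F\<close>,
  \<open>\<Psi>\<close> and \<open>F'\<close>.\<close>

lemma first_derivative:
  assumes geo: "geodesic \<A> g I \<gamma>" and C: "C \<in> \<A>" and t: "t \<in> I" "\<gamma> t \<in> dom_of C"
  defines "\<eta> \<equiv> coord C \<circ> \<gamma>"
  shows "((\<lambda>s. F_at C \<eta> s) has_real_derivative
      2 * inp C (\<eta> t) (Jac1_at C \<eta> t) (Jac0_at C \<eta> t)) (at t)"
proof -
  interpret G: geodesic_on "g C" "chart_image C" \<eta> "I \<inter> \<gamma> -` dom_of C"
    unfolding \<eta>_def by (rule geodesic_in_chart[OF geo C])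
  show ?thesis unfolding F_def using G.deriv_J0_J0[of t] t by simp
qed

lemma second_derivative:
  assumes geo: "geodesic \<A> g I \<gamma>" and C: "C \<in> \<A>" and t: "t \<in> I" "\<gamma> t \<in> dom_of C"
  defines "\<eta> \<equiv> coord C \<circ> \<gamma>"
  shows "((\<lambda>s. 2 * inp C (\<eta> s) (Jac1_at C \<eta> s) (Jac0_at C \<eta> s)) has_real_derivative
      2 * (c * speed C \<eta> t * F_at C \<eta> t + \<Psi>_at C \<eta> t)) (at t)"
proof -
  interpret G: geodesic_on "g C" "chart_image C" \<eta> "I \<inter> \<gamma> -` dom_of C"
    unfolding \<eta>_def by (rule geodesic_in_chart[OF geo C])
  have tI: "t \<in> I \<inter> \<gamma> -` dom_of C" using t by simp
  have "Jac2_at C \<eta> t = (\<lambda>i j. c * speed C \<eta> t * Jac0_at C \<eta> t i j)"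
    using J2_eq[OF C G.range[OF tI]] by (intro ext)
  then have "inp C (\<eta> t) (Jac2_at C \<eta> t) (Jac0_at C \<eta> t)
      = c * speed C \<eta> t * F_at C \<eta> t"
    unfolding F_def by (simp only: G.ip_cmult)
  then show ?thesis using DERIV_cmult[OF G.deriv_J1_J0[OF tI], of 2] unfolding \<Psi>_def by simp
qed

lemma energy_derivative:
  assumes geo: "geodesic \<A> g I \<gamma>" and C: "C \<in> \<A>" and t: "t \<in> I" "\<gamma> t \<in> dom_of C"
  defines "\<eta> \<equiv> coord C \<circ> \<gamma>"
  shows "((\<lambda>s. \<Psi>_at C \<eta> s) has_real_derivative
      c * speed C \<eta> t *
        (2 * inp C (\<eta> t) (Jac1_at C \<eta> t) (Jac0_at C \<eta> t))) (at t)"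
proof -
  interpret G: geodesic_on "g C" "chart_image C" \<eta> "I \<inter> \<gamma> -` dom_of C"
    unfolding \<eta>_def by (rule geodesic_in_chart[OF geo C])
  have tI: "t \<in> I \<inter> \<gamma> -` dom_of C" using t by simp
  have "Jac2_at C \<eta> t = (\<lambda>i j. c * speed C \<eta> t * Jac0_at C \<eta> t i j)"
    using J2_eq[OF C G.range[OF tI]] by (intro ext)
  then have "inp C (\<eta> t) (Jac2_at C \<eta> t) (Jac1_at C \<eta> t)
      = c * speed C \<eta> t * inp C (\<eta> t) (Jac1_at C \<eta> t) (Jac0_at C \<eta> t)"
    using G.ip_sym[OF G.range[OF tI], of "Jac0_at C \<eta> t"] by (simp only: G.ip_cmult)
  then show ?thesis using G.deriv_J1_J1[OF tI] unfolding \<Psi>_def by (simp add: mult_ac)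
qed

text \<open>Up to terms already known to be independent of the chart, \<open>\<Psi>\<close> is half the second derivative of \<open>F\<close>
  along a geodesic; so it inherits the independence from \<open>F\<close>.\<close>

lemma \<Psi>_transform:
  assumes C: "C \<in> \<A>" and D: "D \<in> \<A>" and x: "x \<in> overlap C D"
  shows "\<Psi> C x v = \<Psi> D (transition C D x) (push C D x v)"
proof -
  have xC: "x \<in> chart_image C" "chart_inv C x \<in> dom_of D" using x unfolding overlap_eq[OF C] by auto
  obtain \<delta> \<gamma> where \<delta>: "0 < \<delta>" "coord C (\<gamma> 0) = x" "velocity (coord C \<circ> \<gamma>) 0 = v" "\<forall>t\<in>{-\<delta><..<\<delta>}. \<gamma> t \<in> dom_of C"
    and geo: "geodesic \<A> g {-\<delta><..<\<delta>} \<gamma>"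
    using geodesic_through[OF C xC(1), of v] by blast
  define \<eta> where "\<eta> = coord C \<circ> \<gamma>"
  define \<zeta> where "\<zeta> = coord D \<circ> \<gamma>"
  define I where "I = {-\<delta><..<\<delta>} \<inter> \<gamma> -` dom_of D"
  interpret cc: chart_change "g C" "overlap C D" "g D" "chart_image D" "transition C D"
    by (rule chart_change[OF C D])
  interpret GD: geodesic_on "g D" "chart_image D" \<zeta> I
    unfolding I_def \<zeta>_def by (rule geodesic_in_chart[OF geo D])
  have g0: "\<gamma> 0 = chart_inv C x" using chart_inv_coord[OF C, of "\<gamma> 0"] \<delta> by auto
  have 0: "0 \<in> I" using \<delta>(1) g0 xC(2) by (simp add: I_def)
  have geoC: "geodesic_on (g C) (overlap C D) \<eta> I"
  proof (rule geodesic_on_subset[OF geodesic_in_chart[OF geo C, folded \<eta>_def] cc.A.metric_on_axioms GD.open_I])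
    show "I \<subseteq> {-\<delta><..<\<delta>} \<inter> \<gamma> -` dom_of C" using \<delta>(4) by (auto simp: I_def)
    show "\<eta> t \<in> overlap C D" if "t \<in> I" for t
      using that \<delta>(4) by (auto simp: I_def \<eta>_def overlap_def)
  qed
  have pos: "\<zeta> t = transition C D (\<eta> t)" if "t \<in> I" for t
    using that \<delta>(4) chart_inv_coord[OF C, of "\<gamma> t"] by (auto simp: I_def \<eta>_def \<zeta>_def transition_def)
  have vel: "velocity \<zeta> t = push C D (\<eta> t) (velocity \<eta> t)" if t: "t \<in> I" for t
    using velocity_cong[OF GD.open_I t pos geodesic_on.diff_\<eta>[OF cc.geodesic_transform(1)[OF geoC] t]]
      cc.geodesic_transform(2)[OF geoC t] by simp
  define \<phi>1 where "\<phi>1 C \<eta> t = 2 * inp C (\<eta> t) (Jac1_at C \<eta> t) (Jac0_at C \<eta> t)" for C and \<eta> :: "real \<Rightarrow> real^'n" and t :: real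
  have ov: "\<eta> t \<in> overlap C D" if "t \<in> I" for t using geodesic_on.range[OF geoC that] .
  have F_eq: "F_at C \<eta> t = F_at D \<zeta> t" if "t \<in> I" for t
    unfolding pos[OF that] vel[OF that] by (rule F_transform[OF C D ov[OF that]])
  have mem: "t \<in> {-\<delta><..<\<delta>}" "\<gamma> t \<in> dom_of C" "\<gamma> t \<in> dom_of D" if "t \<in> I" for t
    using that \<delta>(4) by (auto simp: I_def)
  have \<phi>1_eq: "\<phi>1 C \<eta> t = \<phi>1 D \<zeta> t" if t: "t \<in> I" for t
  proof (rule DERIV_unique)
    show "((\<lambda>s. F_at C \<eta> s) has_real_derivative \<phi>1 C \<eta> t) (at t)"
      unfolding \<phi>1_def \<eta>_def by (rule first_derivative[OF geo C mem(1,2)[OF t]])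
    have "((\<lambda>s. F_at D \<zeta> s) has_real_derivative \<phi>1 D \<zeta> t) (at t)"
      unfolding \<phi>1_def \<zeta>_def by (rule first_derivative[OF geo D mem(1,3)[OF t]])
    then show "((\<lambda>s. F_at C \<eta> s) has_real_derivative \<phi>1 D \<zeta> t) (at t)"
      by (rule has_field_derivative_transform_within_open[OF _ GD.open_I t]) (simp add: F_eq)
  qed
  have "2 * (c * speed C \<eta> 0 * F_at C \<eta> 0 + \<Psi>_at C \<eta> 0)
      = 2 * (c * speed D \<zeta> 0 * F_at D \<zeta> 0 + \<Psi>_at D \<zeta> 0)"
  proof (rule DERIV_unique)
    show "(\<phi>1 C \<eta> has_real_derivative 2 * (c * speed C \<eta> 0 * F_at C \<eta> 0 + \<Psi>_at C \<eta> 0)) (at 0)"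
      unfolding \<phi>1_def[abs_def] \<eta>_def by (rule second_derivative[OF geo C mem(1,2)[OF 0]])
    have "(\<phi>1 D \<zeta> has_real_derivative 2 * (c * speed D \<zeta> 0 * F_at D \<zeta> 0 + \<Psi>_at D \<zeta> 0)) (at 0)"
      unfolding \<phi>1_def[abs_def] \<zeta>_def by (rule second_derivative[OF geo D mem(1,3)[OF 0]])
    then show "(\<phi>1 C \<eta> has_real_derivative 2 * (c * speed D \<zeta> 0 * F_at D \<zeta> 0 + \<Psi>_at D \<zeta> 0)) (at 0)"
      by (rule has_field_derivative_transform_within_open[OF _ GD.open_I 0]) (simp add: \<phi>1_eq)
  qed
  moreover have "speed C \<eta> 0 = speed D \<zeta> 0"
    unfolding pos[OF 0] vel[OF 0] by (rule unit_transform[OF C D ov[OF 0]])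
  ultimately have "\<Psi>_at C \<eta> 0 = \<Psi>_at D \<zeta> 0"
    using F_eq[OF 0] by simp
  then show ?thesis
    unfolding pos[OF 0] vel[OF 0] using \<delta> by (simp add: \<eta>_def)
qed

text \<open>Along the geodesic through a unit vector where \<open>\<Psi> + (\<epsilon> - c) F\<close> is maximal, the derivative of this
  function is \<open>\<epsilon> F'\<close>, because \<open>\<Psi>' = c F'\<close> at unit speed. Its second derivative \<open>2 \<epsilon> (c F + \<Psi>)\<close> is
  nonpositive at the maximum, while both summands are nonnegative.\<close>

lemma max_principle:
  assumes comp: "compact (points \<A>)" and R: "riemannian \<A> g" and C0: "C0 \<in> \<A>" and x0: "x0 \<in> chart_image C0"
    and c: "c \<ge> 0" and \<epsilon>: "\<epsilon> > 0"
  shows "\<exists>C\<in>\<A>. \<exists>x\<in>chart_image C. \<exists>v. unit C x v \<and> c * F C x v = 0 \<and> \<Psi> C x v = 0 \<and>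
    (\<forall>D\<in>\<A>. \<forall>y\<in>chart_image D. \<forall>w. unit D y w \<longrightarrow> \<Psi> D y w + (\<epsilon> - c) * F D y w \<le> (\<epsilon> - c) * F C x v)"
proof -
  let ?\<Theta> = "\<lambda>C x v. \<Psi> C x v + (\<epsilon> - c) * F C x v"
  have "\<exists>C\<in>\<A>. \<exists>x\<in>chart_image C. \<exists>v. unit C x v \<and> (\<forall>D\<in>\<A>. \<forall>y\<in>chart_image D. \<forall>w. unit D y w \<longrightarrow> ?\<Theta> D y w \<le> ?\<Theta> C x v)"
  proof (rule attains_max[OF comp R C0 x0])
    show "continuous_on (chart_image C \<times> UNIV) (\<lambda>z. ?\<Theta> C (fst z) (snd z))" if "C \<in> \<A>" for C
      by (intro continuous_on_add continuous_on_mult continuous_on_const continuous_F continuous_\<Psi> that)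
    show "?\<Theta> C x v = ?\<Theta> D (transition C D x) (push C D x v)" if "C \<in> \<A>" "D \<in> \<A>" "x \<in> overlap C D" for C D x v
      using F_transform[OF that, of v] \<Psi>_transform[OF that, of v] by simp
  qed
  then obtain C x v where C: "C \<in> \<A>" and x: "x \<in> chart_image C" and v: "unit C x v"
    and max: "\<And>D y w. D \<in> \<A> \<Longrightarrow> y \<in> chart_image D \<Longrightarrow> unit D y w \<Longrightarrow> ?\<Theta> D y w \<le> ?\<Theta> C x v"
    by blast
  obtain \<delta> \<gamma> where \<delta>: "0 < \<delta>" "coord C (\<gamma> 0) = x" "velocity (coord C \<circ> \<gamma>) 0 = v" "\<forall>t\<in>{-\<delta><..<\<delta>}. \<gamma> t \<in> dom_of C"
    and geo: "geodesic \<A> g {-\<delta><..<\<delta>} \<gamma>"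
    using geodesic_through[OF C x, of v] by blast
  define \<eta> where "\<eta> = coord C \<circ> \<gamma>"
  have eq: "{-\<delta><..<\<delta>} \<inter> \<gamma> -` dom_of C = {-\<delta><..<\<delta>}" using \<delta>(4) by auto
  interpret G: geodesic_on "g C" "chart_image C" \<eta> "{-\<delta><..<\<delta>}"
    using geodesic_in_chart[OF geo C] unfolding eq \<eta>_def .
  have \<eta>0: "\<eta> 0 = x" "velocity \<eta> 0 = v" using \<delta> by (simp_all add: \<eta>_def)
  have mem: "t \<in> {-\<delta><..<\<delta>}" "\<gamma> t \<in> dom_of C" if "\<bar>t\<bar> < \<delta>" for t
  proof -
    show "t \<in> {-\<delta><..<\<delta>}" using that by auto
    then show "\<gamma> t \<in> dom_of C" using \<delta>(4) by blast
  qed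
  have unit: "unit C (\<eta> t) (velocity \<eta> t)" if t: "\<bar>t\<bar> < \<delta>" for t
  proof -
    have "\<exists>k. \<forall>s\<in>{-\<delta><..<\<delta>}. speed C \<eta> s = k"
      by (rule has_field_derivative_zero_constant[OF _ has_field_derivative_at_within[OF G.deriv_gprod]]) auto
    then obtain k where k: "\<And>s. s \<in> {-\<delta><..<\<delta>} \<Longrightarrow> speed C \<eta> s = k" by blast
    show ?thesis using k[of 0] k[OF mem(1)[OF t]] \<delta>(1) \<eta>0 v by simp
  qed
  define \<phi>1 where "\<phi>1 t = 2 * inp C (\<eta> t) (Jac1_at C \<eta> t) (Jac0_at C \<eta> t)" for t
  have "\<epsilon> * (2 * (c * F C x v + \<Psi> C x v)) \<le> 0"
  proof (rule second_derivative_at_max[OF \<delta>(1)])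
    show "?\<Theta> C (\<eta> t) (velocity \<eta> t) \<le> ?\<Theta> C (\<eta> 0) (velocity \<eta> 0)" if "\<bar>t\<bar> < \<delta>" for t
      unfolding \<eta>0 by (rule max[OF C G.range[OF mem(1)[OF that]] unit[OF that]])
    show "((\<lambda>t. ?\<Theta> C (\<eta> t) (velocity \<eta> t)) has_real_derivative \<epsilon> * \<phi>1 t) (at t)" if t: "\<bar>t\<bar> < \<delta>" for t
    proof -
      have "((\<lambda>t. \<Psi>_at C \<eta> t) has_real_derivative c * \<phi>1 t) (at t)"
        using energy_derivative[OF geo C mem[OF t], folded \<eta>_def] unit[OF t] by (simp add: \<phi>1_def)
      moreover have "((\<lambda>t. F_at C \<eta> t) has_real_derivative \<phi>1 t) (at t)"
        using first_derivative[OF geo C mem[OF t], folded \<eta>_def] by (simp add: \<phi>1_def)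
      ultimately have "((\<lambda>t. ?\<Theta> C (\<eta> t) (velocity \<eta> t)) has_real_derivative c * \<phi>1 t + (\<epsilon> - c) * \<phi>1 t) (at t)"
        by (intro DERIV_add DERIV_cmult)
      then show ?thesis by (simp add: left_diff_distrib)
    qed
    have m0: "0 \<in> {-\<delta><..<\<delta>}" "\<gamma> 0 \<in> dom_of C" using mem[of 0] \<delta>(1) by auto
    have "(\<phi>1 has_real_derivative 2 * (c * speed C \<eta> 0 * F_at C \<eta> 0 + \<Psi>_at C \<eta> 0)) (at 0)"
      unfolding \<phi>1_def[abs_def] \<eta>_def by (rule second_derivative[OF geo C m0])
    from DERIV_cmult[OF this, of \<epsilon>]
    show "((\<lambda>t. \<epsilon> * \<phi>1 t) has_real_derivative \<epsilon> * (2 * (c * F C x v + \<Psi> C x v))) (at 0)"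
      unfolding \<eta>0 v by simp
  qed
  then have le: "c * F C x v + \<Psi> C x v \<le> 0" using \<epsilon> by (simp add: mult_le_0_iff)
  have pos: "\<forall>v. v \<noteq> 0 \<longrightarrow> 0 < gprod (g C) x v v" using R C x unfolding riemannian_def by blast
  have "0 \<le> F C x v" "0 \<le> \<Psi> C x v"
    unfolding F_def \<Psi>_def by (rule G.ip_nonneg[OF x pos])+
  then have "c * F C x v = 0" "\<Psi> C x v = 0"
    using le c mult_nonneg_nonneg[of c "F C x v"] by linarith+
  moreover from this have "?\<Theta> C x v = (\<epsilon> - c) * F C x v" by simp
  ultimately show ?thesis using C x v max by metis
qed

lemma nonneg:
  assumes R: "riemannian \<A> g" and C: "C \<in> \<A>" and x: "x \<in> chart_image C"
  shows "0 \<le> F C x v" "0 \<le> \<Psi> C x v"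
proof -
  interpret metric_on "g C" "chart_image C" by (rule metric_on_chart[OF C])
  have pos: "\<forall>v. v \<noteq> 0 \<longrightarrow> 0 < gprod (g C) x v v" using R C x unfolding riemannian_def by blast
  show "0 \<le> F C x v" "0 \<le> \<Psi> C x v"
    unfolding F_def \<Psi>_def by (rule ip_nonneg[OF x pos])+
qed

lemma flat_if_F_zero:
  assumes R: "riemannian \<A> g"
    and zero: "\<And>C x v. C \<in> \<A> \<Longrightarrow> x \<in> chart_image C \<Longrightarrow> unit C x v \<Longrightarrow> F C x v = 0"
  shows "flat \<A> g"
  unfolding flat_def
proof (intro ballI allI impI)
  fix C x and "is" :: "'n list" assume C: "C \<in> \<A>" and x: "x \<in> chart_image C" and "length is = 4"
  then obtain i j k l where is4: "is = [i, j, k, l]" using list4 by blast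
  interpret metric_on "g C" "chart_image C" by (rule metric_on_chart[OF C])
  have pos: "\<forall>v. v \<noteq> 0 \<longrightarrow> 0 < gprod (g C) x v v" using R C x unfolding riemannian_def by blast
  have "J0 x v i j = 0" for v i j
  proof (cases "v = 0")
    case True
    then show ?thesis by (simp add: J0_def)
  next
    case False
    then obtain s where s: "s \<noteq> 0" "unit C x (s *\<^sub>R v)" using exists_unit_multiple pos by blast
    have "ip x (J0 x (s *\<^sub>R v)) (J0 x (s *\<^sub>R v)) = 0" using zero[OF C x s(2)] unfolding F_def .
    then have "J0 x (s *\<^sub>R v) i j = 0" by (rule ip_eq_zero[OF x pos])
    then show ?thesis using s(1) by (simp add: J0_scale)
  qed
  then show "curvature (g C) x is = 0" unfolding is4 by (rule J0_eq_zero[OF x])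
qed

lemma locally_symmetric_if_\<Psi>_zero:
  assumes R: "riemannian \<A> g"
    and zero: "\<And>C x v. C \<in> \<A> \<Longrightarrow> x \<in> chart_image C \<Longrightarrow> unit C x v \<Longrightarrow> \<Psi> C x v = 0"
  shows "locally_symmetric \<A> g"
  unfolding locally_symmetric_def
proof (intro ballI allI impI)
  fix C x and "is" :: "'n list" assume C: "C \<in> \<A>" and x: "x \<in> chart_image C" and "length is = 5"
  then obtain a i j k l where is5: "is = [a, i, j, k, l]" using list5 by blast
  interpret metric_on "g C" "chart_image C" by (rule metric_on_chart[OF C])
  have pos: "\<forall>v. v \<noteq> 0 \<longrightarrow> 0 < gprod (g C) x v v" using R C x unfolding riemannian_def by blast
  have "J1 x v i j = 0" for v i j
  proof (cases "v = 0")
    case True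
    then show ?thesis by (simp add: J1_def del: nabla.simps)
  next
    case False
    then obtain s where s: "s \<noteq> 0" "unit C x (s *\<^sub>R v)" using exists_unit_multiple pos by blast
    have "ip x (J1 x (s *\<^sub>R v)) (J1 x (s *\<^sub>R v)) = 0" using zero[OF C x s(2)] unfolding \<Psi>_def .
    then have "J1 x (s *\<^sub>R v) i j = 0" by (rule ip_eq_zero[OF x pos])
    then show ?thesis using s(1) by (simp add: J1_scale)
  qed
  then show "nabla (g C) (curvature (g C)) x is = 0" unfolding is5 by (rule DR_eq_zero[OF x])
qed

lemma flat_imp_locally_symmetric:
  assumes "flat \<A> g" shows "locally_symmetric \<A> g"
  unfolding locally_symmetric_def
proof (intro ballI allI impI)
  fix C x and "is" :: "'n list" assume C: "C \<in> \<A>" and x: "x \<in> chart_image C" and len: "length is = 5"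
  then obtain a js where js: "is = a # js" "length js = 4" by (cases "is") auto
  have "open (chart_image C)" using chart[OF C] by blast
  then have "nabla (g C) (curvature (g C)) x (a # js) = nabla (g C) (\<lambda>y is. 0) x (a # js)"
    using assms C js(2) unfolding flat_def by (intro nabla_cong[OF _ x]) auto
  then show "nabla (g C) (curvature (g C)) x is = 0" using js(1) by simp
qed

text \<open>With \<open>\<epsilon> = c + 1\<close> the function \<open>\<Psi> + F\<close> vanishes at its maximum.\<close>

lemma flat_if_positive:
  assumes comp: "compact (points \<A>)" and R: "riemannian \<A> g" and c: "c > 0"
  shows "flat \<A> g"
proof (rule flat_if_F_zero[OF R])
  fix D y w assume D: "D \<in> \<A>" and y: "y \<in> chart_image D" and w: "unit D y w"
  obtain C x v where "c * F C x v = 0" and max: "\<Psi> D y w + (c + 1 - c) * F D y w \<le> (c + 1 - c) * F C x v"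
    using max_principle[OF comp R D y, of "c + 1"] c D y w by force
  then have "\<Psi> D y w + F D y w \<le> 0" using c by simp
  then show "F D y w = 0" using nonneg[OF R D y, of w] by linarith
qed

text \<open>Here \<open>\<Psi> \<le> \<Psi> + \<epsilon> F \<le> \<epsilon> B\<close> for every \<open>\<epsilon> > 0\<close>, where \<open>B\<close> bounds \<open>F\<close> on all unit vectors.\<close>

lemma locally_symmetric_if_zero:
  assumes comp: "compact (points \<A>)" and R: "riemannian \<A> g" and c: "c = 0"
  shows "locally_symmetric \<A> g"
proof (rule locally_symmetric_if_\<Psi>_zero[OF R])
  fix D y w assume D: "D \<in> \<A>" and y: "y \<in> chart_image D" and w: "unit D y w"
  have "\<exists>C\<in>\<A>. \<exists>x\<in>chart_image C. \<exists>v. unit C x v \<and> (\<forall>D\<in>\<A>. \<forall>y\<in>chart_image D. \<forall>w. unit D y w \<longrightarrow> F D y w \<le> F C x v)"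
    by (rule attains_max[OF comp R D y continuous_F F_transform])
  then obtain B where B: "\<And>C x v. C \<in> \<A> \<Longrightarrow> x \<in> chart_image C \<Longrightarrow> unit C x v \<Longrightarrow> F C x v \<le> B"
    by blast
  have "\<Psi> D y w \<le> \<epsilon> * B" if \<epsilon>: "\<epsilon> > 0" for \<epsilon>
  proof -
    obtain C x v where "C \<in> \<A>" "x \<in> chart_image C" "unit C x v" and max: "\<Psi> D y w + (\<epsilon> - c) * F D y w \<le> (\<epsilon> - c) * F C x v"
      using max_principle[OF comp R D y _ \<epsilon>] c D y w by force
    then have "F C x v \<le> B" using B by blast
    then have "\<epsilon> * F C x v \<le> \<epsilon> * B" using \<epsilon> by simp
    moreover have "0 \<le> \<epsilon> * F D y w" using \<epsilon> nonneg[OF R D y, of w] by simp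
    ultimately show ?thesis using max c by simp
  qed
  then have le: "\<Psi> D y w \<le> \<epsilon> * B" if "\<epsilon> > 0" for \<epsilon> using that .
  have "B \<ge> 0" using B[OF D y w] nonneg(1)[OF R D y, of w] by linarith
  have "\<Psi> D y w \<le> 0"
  proof (rule field_le_epsilon)
    fix e :: real assume e: "e > 0"
    have "e / (B + 1) * B \<le> e" using e \<open>B \<ge> 0\<close> by (simp add: field_simps)
    then show "\<Psi> D y w \<le> 0 + e" using le[of "e / (B + 1)"] e \<open>B \<ge> 0\<close> by simp
  qed
  then show "\<Psi> D y w = 0" using nonneg(2)[OF R D y, of w] by linarith
qed

end

theorem corollary1:
  fixes \<A> :: "('m::{t2_space, second_countable_topology}, 'n::finite) chart set"
    and g :: "('m, 'n) chart \<Rightarrow> real^'n \<Rightarrow> real^'n^'n"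
    and c :: real
  assumes "pseudo_riemannian_manifold \<A> g"
    and "einstein \<A> g"
    and "\<And>I \<gamma> C t i j. geodesic \<A> g I \<gamma> \<Longrightarrow> C \<in> \<A> \<Longrightarrow> t \<in> I \<Longrightarrow> \<gamma> t \<in> dom_of C \<Longrightarrow>
           jacobi_op2 (g C) (coord C \<circ> \<gamma>) t i j =
             c * gprod (g C) (coord C (\<gamma> t)) (velocity (coord C \<circ> \<gamma>) t) (velocity (coord C \<circ> \<gamma>) t)
               * jacobi_op (g C) (coord C \<circ> \<gamma>) t i j"
  shows "(\<forall>C\<in>\<A>. \<forall>x\<in>chart_image C. \<forall>e. orthonormal_frame (g C) x e \<longrightarrow>
            (\<forall>is. length is = 4 \<longrightarrow>
               rough_laplacian (g C) e (curvature (g C)) x is =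
                 - ((real CARD('n) + 4) * c / 2) * curvature (g C) x is)) \<and>
         (compact (points \<A>) \<and> riemannian \<A> g \<longrightarrow>
            (\<not> locally_symmetric \<A> g \<longrightarrow> c < 0) \<and> (\<not> flat \<A> g \<longrightarrow> c \<le> 0))"
proof -
  interpret jacobi_manifold \<A> g c
    by (rule jacobi_manifold.intro[OF assms(1)], unfold_locales) (rule assms(3))
  have "c < 0" if "compact (points \<A>)" "riemannian \<A> g" "\<not> locally_symmetric \<A> g"
    using that locally_symmetric_if_zero flat_imp_locally_symmetric[OF flat_if_positive] by linarith
  moreover have "c \<le> 0" if "compact (points \<A>)" "riemannian \<A> g" "\<not> flat \<A> g"
    using that flat_if_positive by linarith
  ultimately show ?thesis
    using rough_laplacian_curvature[OF assms(2)] by blast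
qed

end
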